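(* Let $L\ge1$ be an integer and let $a,b\in\{0,1\}^L$ with $b\notin\{a,a^R,\bar a,\bar a^R\}$. Let \[\varphi^a_n(a,b)=\mathrm{P}\{C_n(a)>C_n(b)\mid (X)^L_L=a\}-\mathrm{P}\{C_n(b)>C_n(a)\mid (X)^L_L=a\}.\] Then, as $n\to\infty$, \[\varphi^a_n(a,b)=\frac{\mu_{1,1}+\mu_{-1,-1}+2\mu_{1,-1}}{\sqrt{2^{L+2}\,p\,q\,\pi n}}+o(1/\sqrt n).\]
   Context: $(X_i,i\ge1)$ is a symmetric Bernoulli process: i.i.d. random variables with $\mathrm{P}\{X_i=0\}=\mathrm{P}\{X_i=1\}=1/2$. For a word $x=(x_1,\dots,x_L)\in\{0,1\}^L$, $x^R=(x_L,\dots,x_1)$ is its reversal, $\bar x=(1-x_1,\dots,1-x_L)$ its conjugate, and $\bar x^R$ the reversal of $\bar x$. For a word $y$ of length $m\ge 1$, $C_n(y)=\sum_{k=m}^n \mathbf 1\{(X_{k-m+1},\dots,X_k)=y\}$ is the number of (possibly overlapping) occurrences of $y$ in $X_1,\dots,X_n$ (equal to $0$ if $n<m$). For $t\ge L$ let $(X)^L_t=(X_{t-L+1},\dots,X_t)$ (so $(X)^L_L=(X_1,\dots,X_L)$); for $t<L$ let $(X)^L_t$ be the empty word. Let $T_0=0$ and $T_k=\min\{t>T_{k-1}:(X)^L_t\in\{a,b\}\}$ for $k\ge1$ (almost surely finite). Let $Y_k=1$ if $(X)^L_{T_k}=a$ and $Y_k=-1$ if $(X)^L_{T_k}=b$. The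 sequence $(Y_k)_{k\ge1}$ is a time-homogeneous Markov chain on $\{\pm1\}$ and $\mathrm{P}\{Y_2=1\mid Y_1=1\}=\mathrm{P}\{Y_2=-1\mid Y_1=-1\}$; this common value is denoted $p$, and $q=1-p$. For $c,e=\pm1$, $\mu_{c,e}=\mathrm{E}[(T_2-T_1)\mathbf 1\{Y_2=e\}\mid Y_1=c]$. *)

theory Defs
  imports "HOL-Probability.Probability"
begin

(* The letters 0 and 1 are encoded as False and True, words as bool lists. *)

definition conjugate_word :: "bool list \<Rightarrow> bool list" where
  "conjugate_word x = map Not x"

(* Only the variables X 1, X 2, ... matter; X 0 is unconstrained. *)
definition symmetric_bernoulli_process :: "'w measure \<Rightarrow> (nat \<Rightarrow> 'w \<Rightarrow> bool) \<Rightarrow> bool" where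
  "symmetric_bernoulli_process M X \<longleftrightarrow>
     prob_space M \<and>
     prob_space.indep_vars M (\<lambda>_. count_space UNIV) X {1..} \<and>
     (\<forall>i\<ge>1. \<P>(\<omega> in M. X i \<omega> = False) = 1/2 \<and> \<P>(\<omega> in M. X i \<omega> = True) = 1/2)"

(* (X_{t-L+1}, ..., X_t), and the empty word if t < L *)
definition block :: "(nat \<Rightarrow> 'w \<Rightarrow> bool) \<Rightarrow> nat \<Rightarrow> nat \<Rightarrow> 'w \<Rightarrow> bool list" where
  "block X L t \<omega> = (if t < L then [] else map (\<lambda>i. X i \<omega>) [t + 1 - L..<t + 1])"

definition occ :: "(nat \<Rightarrow> 'w \<Rightarrow> bool) \<Rightarrow> bool list \<Rightarrow> nat \<Rightarrow> 'w \<Rightarrow> nat" where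
  "occ X y n \<omega> = (\<Sum>k = length y..n. of_bool (block X (length y) k \<omega> = y))"

(* Outside the almost sure event where a or b occurs infinitely often, LEAST may be
   taken over an empty set and the value is arbitrary. *)
primrec hit_time :: "(nat \<Rightarrow> 'w \<Rightarrow> bool) \<Rightarrow> nat \<Rightarrow> bool list \<Rightarrow> bool list \<Rightarrow> nat \<Rightarrow> 'w \<Rightarrow> nat" where
  "hit_time X L a b 0 \<omega> = 0"
| "hit_time X L a b (Suc k) \<omega> =
     (LEAST t. t > hit_time X L a b k \<omega> \<and> block X L t \<omega> \<in> {a, b})"

(* The value 0 is taken only for k = 0 and on the null set above. *)
definition sign_chain :: "(nat \<Rightarrow> 'w \<Rightarrow> bool) \<Rightarrow> nat \<Rightarrow> bool list \<Rightarrow> bool list \<Rightarrow> nat \<Rightarrow> 'w \<Rightarrow> int" where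
  "sign_chain X L a b k \<omega> =
     (let w = block X L (hit_time X L a b k \<omega>) \<omega>
      in if w = a then 1 else if w = b then -1 else 0)"

definition cond_expectation_event :: "'w measure \<Rightarrow> ('w \<Rightarrow> real) \<Rightarrow> ('w \<Rightarrow> bool) \<Rightarrow> real" where
  "cond_expectation_event M Z Q =
     (\<integral>\<omega>. Z \<omega> * of_bool (Q \<omega>) \<partial>M) / \<P>(\<omega> in M. Q \<omega>)"

(* The probability p of repeating the sign. It is the same for both signs, and is
   taken here at the sign 1. *)
definition stay_prob ::
  "'w measure \<Rightarrow> (nat \<Rightarrow> 'w \<Rightarrow> bool) \<Rightarrow> nat \<Rightarrow> bool list \<Rightarrow> bool list \<Rightarrow> real" where
  "stay_prob M X L a b =
     \<P>(\<omega> in M. sign_chain X L a b 2 \<omega> = 1 \<bar> sign_chain X L a b 1 \<omega> = 1)"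

definition mean_sojourn ::
  "'w measure \<Rightarrow> (nat \<Rightarrow> 'w \<Rightarrow> bool) \<Rightarrow> nat \<Rightarrow> bool list \<Rightarrow> bool list \<Rightarrow> int \<Rightarrow> int \<Rightarrow> real" where
  "mean_sojourn M X L a b c e =
     cond_expectation_event M
       (\<lambda>\<omega>. (real (hit_time X L a b 2 \<omega>) - real (hit_time X L a b 1 \<omega>))
              * of_bool (sign_chain X L a b 2 \<omega> = e))
       (\<lambda>\<omega>. sign_chain X L a b 1 \<omega> = c)"

definition count_advantage ::
  "'w measure \<Rightarrow> (nat \<Rightarrow> 'w \<Rightarrow> bool) \<Rightarrow> nat \<Rightarrow> bool list \<Rightarrow> bool list \<Rightarrow> nat \<Rightarrow> real" where
  "count_advantage M X L a b n =
     \<P>(\<omega> in M. occ X a n \<omega> > occ X b n \<omega> \<bar> block X L L \<omega> = a)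
     - \<P>(\<omega> in M. occ X b n \<omega> > occ X a n \<omega> \<bar> block X L L \<omega> = a)"

end

theory Submission
  imports Defs "HOL-Real_Asymp.Real_Asymp"
begin

text \<open>
  The last \<open>L\<close> tosses form a Markov chain on the words of length \<open>L\<close>, with kernel \<open>next_mean\<close>
  and the uniform equilibrium. Put \<open>f = 1\<^sub>a - 1\<^sub>b\<close>. Then \<open>D\<^sub>n = C\<^sub>n(a) - C\<^sub>n(b)\<close> is the sum of \<open>f\<close>
  along the chain, so the characteristic function of \<open>D\<^sub>n\<close> is obtained from powers of the kernel
  twisted by \<open>exp (i \<theta> f)\<close>, and for an integer \<open>D\<close> the sign of \<open>D\<close> is \<open>1 / \<pi>\<close> times the integral of
  \<open>sin (D \<theta>) cot (\<theta> / 2)\<close> over \<open>(0, \<pi>)\<close>. After the substitution \<open>\<theta> = t / \<surd>n\<close> only small \<open>\<theta>\<close> matters,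
  where the twisted kernel acts through its leading eigenvalue
  \<open>1 - s \<theta>\<^sup>2 - i r \<theta>\<^sup>3 + O(\<theta>\<^sup>4)\<close> and its eigenvector \<open>1 + i \<theta> g + O(\<theta>\<^sup>2)\<close>. The mean of \<open>D\<^sub>n\<close> is bounded and
  its third cumulant grows linearly, so both enter the sign at order \<open>1 / \<surd>n\<close>; the limit of
  \<open>\<surd>n\<close> times the advantage is the Gaussian integral \<open>(m - r / (2 s)) / \<surd>(\<pi> s)\<close> with \<open>m\<close> the limiting mean.

  The eigenvalue and the eigenvector come from two corrector equations. Between two hits of
  \<open>{a, b}\<close> the function \<open>f\<close> vanishes, and therefore the correctors are explicit combinations of the
  probability that the next hit is \<open>a\<close> or \<open>b\<close> and of the mean time to it
  (\<open>corrector_order1\<close>, \<open>corrector_order2\<close>). Averaging the one-step equations of these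
  hitting quantities over the uniform equilibrium gives the identities
  \<open>hit_prob_balance\<close>, \<open>mean_hit_prob\<close> and \<open>hit_mean_total\<close>, which turn \<open>m\<close>, \<open>s\<close> and \<open>r\<close> into the
  quantities \<open>p\<close>, \<open>q\<close> and \<open>\<mu>\<close> of the theorem (\<open>limit_constant\<close>). No exact eigenvalue is needed:
  an approximate eigenpair with a residual of order \<open>\<theta>\<^sup>4\<close> suffices as soon as the powers of the twisted
  kernel decay like \<open>exp (- c n \<theta>\<^sup>2)\<close> for all \<open>\<bar>\<theta>\<bar> \<le> \<pi>\<close> (\<open>twist_decay\<close>, \<open>twist_pow_eigvec\<close>).

  That decay is the point where \<open>a\<close> and \<open>b\<close> have to be related in none of the excluded ways. It
  follows from two paths of equal length and with equal endpoints whose \<open>f\<close>-sums differ by exactly one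
  (\<open>aperiodic\<close>). Padding \<open>a\<close> or \<open>b\<close> by a constant word produces such paths unless \<open>b\<close> arises from \<open>a\<close>
  by moving letters \<open>0\<close> from one end to the other and also by moving letters \<open>1\<close>; a commutation
  argument for words shows that then \<open>b\<close> is the reversal of \<open>a\<close>. The same two paths show \<open>p > 0\<close>.

  On the probabilistic side a prefix of the process is uniformly distributed, so all events are
  counted by words, and the laws of \<open>T\<^sub>2 - T\<^sub>1\<close> and \<open>Y\<^sub>2\<close> given \<open>Y\<^sub>1\<close> follow by splitting the prefix
  at the first hit (\<open>prob_two_visits\<close>, \<open>integral_renewal\<close>).
\<close>

section \<open>Words, windows and averages\<close>

definition words :: "nat \<Rightarrow> bool list set" where
  "words n = {s. length s = n}"

definition shift :: "bool list \<Rightarrow> bool \<Rightarrow> bool list" where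
  "shift w c = tl w @ [c]"

primrec slide :: "bool list \<Rightarrow> bool list \<Rightarrow> bool list" where
  "slide w [] = w"
| "slide w (c # s) = slide (shift w c) s"

definition next_mean :: "(bool list \<Rightarrow> 'a::real_normed_field) \<Rightarrow> bool list \<Rightarrow> 'a" where
  "next_mean h w = (h (shift w False) + h (shift w True)) / 2"

definition weighted :: "(bool list \<Rightarrow> 'a::real_normed_field) \<Rightarrow> (bool list \<Rightarrow> 'a) \<Rightarrow> bool list \<Rightarrow> 'a" where
  "weighted \<phi> h = next_mean (\<lambda>v. \<phi> v * h v)"

primrec path_weight :: "(bool list \<Rightarrow> 'a::real_normed_field) \<Rightarrow> bool list \<Rightarrow> bool list \<Rightarrow> 'a" where
  "path_weight \<phi> w [] = 1"
| "path_weight \<phi> w (c # s) = \<phi> (shift w c) * path_weight \<phi> (shift w c) s"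

primrec path_sum :: "(bool list \<Rightarrow> int) \<Rightarrow> bool list \<Rightarrow> bool list \<Rightarrow> int" where
  "path_sum f w [] = 0"
| "path_sum f w (c # s) = f (shift w c) + path_sum f (shift w c) s"

definition mean :: "nat \<Rightarrow> (bool list \<Rightarrow> 'a::real_normed_field) \<Rightarrow> 'a" where
  "mean L h = (\<Sum>w\<in>words L. h w) / 2 ^ L"

lemma finite_words [simp]: "finite (words n)"
proof -
  have "words n = {xs. set xs \<subseteq> UNIV \<and> length xs = n}"
    by (auto simp: words_def)
  then show ?thesis
    using finite_lists_length_eq[of "UNIV :: bool set" n] by simp
qed

lemma card_words [simp]: "card (words n) = 2 ^ n"
proof -
  have "words n = {xs. set xs \<subseteq> UNIV \<and> length xs = n}"
    by (auto simp: words_def)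
  then show ?thesis
    using card_lists_length_eq[of "UNIV :: bool set" n] by simp
qed

lemma words_0 [simp]: "words 0 = {[]}"
  by (auto simp: words_def)

lemma sum_words_Suc:
  fixes h :: "bool list \<Rightarrow> 'a::comm_monoid_add"
  shows "(\<Sum>s\<in>words (Suc n). h s) = (\<Sum>s\<in>words n. h (False # s) + h (True # s))"
proof -
  have "words (Suc n) = (#) False ` words n \<union> (#) True ` words n" (is "_ = ?A \<union> ?B")
    by (force simp: words_def length_Suc_conv image_iff)
  moreover have "?A \<inter> ?B = {}" by auto
  ultimately have "(\<Sum>s\<in>words (Suc n). h s) = (\<Sum>s\<in>?A. h s) + (\<Sum>s\<in>?B. h s)"
    by (simp add: sum.union_disjoint)
  then show ?thesis
    by (simp add: sum.reindex sum.distrib)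
qed

lemma sum_words_Suc_snoc:
  fixes h :: "bool list \<Rightarrow> 'a::comm_monoid_add"
  shows "(\<Sum>s\<in>words (Suc n). h s) = (\<Sum>s\<in>words n. h (s @ [False]) + h (s @ [True]))"
proof -
  have bij: "(\<Sum>s\<in>words m. g (rev s)) = (\<Sum>s\<in>words m. g s)" for m and g :: "bool list \<Rightarrow> 'a"
    by (rule sum.reindex_bij_witness[of _ rev rev]) (auto simp: words_def)
  have "(\<Sum>s\<in>words (Suc n). h s) = (\<Sum>s\<in>words (Suc n). h (rev s))"
    by (rule bij[symmetric])
  also have "\<dots> = (\<Sum>s\<in>words n. h (rev s @ [False]) + h (rev s @ [True]))"
    by (simp add: sum_words_Suc)
  also have "\<dots> = (\<Sum>s\<in>words n. h (s @ [False]) + h (s @ [True]))"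
    by (rule bij)
  finally show ?thesis .
qed

lemma sum_words_append:
  fixes h :: "bool list \<Rightarrow> 'a::comm_monoid_add"
  shows "(\<Sum>s\<in>words (m + n). h s) = (\<Sum>u\<in>words m. \<Sum>v\<in>words n. h (u @ v))"
proof (induction m arbitrary: h)
  case (Suc m)
  show ?case by (simp add: sum_words_Suc Suc.IH sum.distrib)
qed simp

lemma length_shift [simp]: "w \<noteq> [] \<Longrightarrow> length (shift w c) = length w"
  by (cases w) (auto simp: shift_def)

lemma shift_in_words: "0 < L \<Longrightarrow> w \<in> words L \<Longrightarrow> shift w c \<in> words L"
  by (cases w) (auto simp: shift_def words_def)

lemma slide_in_words: "0 < L \<Longrightarrow> w \<in> words L \<Longrightarrow> slide w s \<in> words L"
  by (induction s arbitrary: w) (auto simp: shift_in_words)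

lemma slide_append [simp]: "slide w (s @ t) = slide (slide w s) t"
  by (induction s arbitrary: w) auto

lemma path_sum_append [simp]: "path_sum f w (s @ t) = path_sum f w s + path_sum f (slide w s) t"
  by (induction s arbitrary: w) auto

lemma slide_eq_drop:
  assumes "w \<noteq> []"
  shows "slide w s = drop (length s) (w @ s)"
  using assms
proof (induction s arbitrary: w)
  case (Cons c s)
  then obtain d w' where "w = d # w'" by (cases w) auto
  then show ?case using Cons.IH[of "shift w c"] by (simp add: shift_def)
qed simp

text \<open>After \<open>L\<close> steps the window has forgotten its start; this is why the chain of windows mixes exactly in time \<open>L\<close>.\<close>

lemma slide_full: "0 < L \<Longrightarrow> w \<in> words L \<Longrightarrow> s \<in> words L \<Longrightarrow> slide w s = s"
  by (subst slide_eq_drop) (auto simp: words_def)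

lemma weighted_apply:
  "weighted \<phi> h w = (\<phi> (shift w False) * h (shift w False) + \<phi> (shift w True) * h (shift w True)) / 2"
  by (simp add: weighted_def next_mean_def)

lemma path_expansion:
  "(weighted \<phi> ^^ n) h w = (\<Sum>s\<in>words n. path_weight \<phi> w s * h (slide w s)) / 2 ^ n"
proof (induction n arbitrary: w)
  case (Suc n)
  have "(weighted \<phi> ^^ Suc n) h w = weighted \<phi> ((weighted \<phi> ^^ n) h) w"
    by simp
  then show ?case
    unfolding weighted_apply[of \<phi> "(weighted \<phi> ^^ n) h"] Suc.IH
    by (simp add: sum_words_Suc sum.distrib sum_distrib_left[symmetric] mult.assoc
        add_divide_distrib) (simp add: mult.commute)
qed simp

lemma next_mean_add: "next_mean (\<lambda>v. g v + h v) w = next_mean g w + next_mean h w"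
  and next_mean_diff: "next_mean (\<lambda>v. g v - h v) w = next_mean g w - next_mean h w"
  and next_mean_mult: "next_mean (\<lambda>v. c * h v) w = c * next_mean h w"
  and next_mean_const [simp]: "next_mean (\<lambda>v. c) w = c"
  by (auto simp: next_mean_def field_simps)

lemma mean_add: "mean L (\<lambda>v. g v + h v) = mean L g + mean L h"
  and mean_diff: "mean L (\<lambda>v. g v - h v) = mean L g - mean L h"
  and mean_mult: "mean L (\<lambda>v. c * h v) = c * mean L h"
  and mean_const [simp]: "mean L (\<lambda>v. c) = c"
  by (auto simp: mean_def sum.distrib sum_subtractf sum_distrib_left field_simps)

lemma mean_cong: "(\<And>w. w \<in> words L \<Longrightarrow> g w = h w) \<Longrightarrow> mean L g = mean L h"
  by (simp add: mean_def)

text \<open>Every word of length \<open>L\<close> has exactly two predecessors, so the uniform law is invariant.\<close>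

lemma mean_next_mean:
  fixes h :: "bool list \<Rightarrow> 'a::real_normed_field"
  assumes "0 < L"
  shows "mean L (next_mean h) = mean L h"
proof -
  obtain m where m: "L = Suc m" using assms by (cases L) auto
  have "(\<Sum>w\<in>words L. next_mean h w) = (\<Sum>s\<in>words m. h (s @ [False]) + h (s @ [True]))"
    unfolding m sum_words_Suc by (simp add: next_mean_def shift_def)
  also have "\<dots> = (\<Sum>w\<in>words L. h w)"
    unfolding m sum_words_Suc_snoc ..
  finally show ?thesis by (simp add: mean_def)
qed

section \<open>Hitting probabilities and mean hitting times\<close>

locale two_words =
  fixes L :: nat and a b :: "bool list"
  assumes L_pos: "0 < L" and length_a: "length a = L" and length_b: "length b = L"
    and distinct: "a \<noteq> b"
begin

abbreviation W :: "bool list set" where "W \<equiv> words L"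

lemma a_in [simp]: "a \<in> W" and b_in [simp]: "b \<in> W"
  by (auto simp: words_def length_a length_b)

lemma shift_W [simp]: "w \<in> W \<Longrightarrow> shift w c \<in> W"
  using L_pos by (rule shift_in_words)

definition miss :: "bool list \<Rightarrow> real" where
  "miss w = of_bool (w \<notin> {a, b})"

definition at_word :: "bool list \<Rightarrow> bool list \<Rightarrow> real" where
  "at_word e w = of_bool (w = e)"

text \<open>The kernel killed on reaching \<open>a\<close> or \<open>b\<close>. Its powers applied to \<open>1\<close> are the probabilities of no hit.\<close>

definition Q :: "(bool list \<Rightarrow> real) \<Rightarrow> bool list \<Rightarrow> real" where
  "Q = weighted miss"

text \<open>The probability that the next hit comes after \<open>t + 1\<close> steps and is a hit of \<open>e\<close>. The index is shifted because the next hit comes after at least one step.\<close>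

definition first_hit :: "bool list \<Rightarrow> nat \<Rightarrow> bool list \<Rightarrow> real" where
  "first_hit e t = (Q ^^ t) (next_mean (at_word e))"

definition hit_prob :: "bool list \<Rightarrow> bool list \<Rightarrow> real" where
  "hit_prob e w = (\<Sum>t. first_hit e t w)"

definition hit_mean :: "bool list \<Rightarrow> bool list \<Rightarrow> real" where
  "hit_mean e w = (\<Sum>t. real (Suc t) * first_hit e t w)"

lemma Q_apply: "Q h w = next_mean (\<lambda>v. miss v * h v) w"
  by (simp add: Q_def weighted_def)

lemma miss_eq: "miss w = 1 - at_word a w - at_word b w"
  using distinct by (auto simp: miss_def at_word_def)

lemma Q_mono:
  assumes "w \<in> W" and "\<And>w. w \<in> W \<Longrightarrow> g w \<le> h w"
  shows "Q g w \<le> Q h w"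
  using assms by (auto simp: Q_apply next_mean_def miss_def intro!: add_mono)

lemma Q_pow_mono:
  assumes "w \<in> W" and "\<And>w. w \<in> W \<Longrightarrow> g w \<le> h w"
  shows "(Q ^^ n) g w \<le> (Q ^^ n) h w"
  using assms(1)
proof (induction n arbitrary: w)
  case (Suc n)
  then show ?case by (simp add: Q_mono)
qed (use assms in auto)

lemma Q_pow_mult: "(Q ^^ n) (\<lambda>w. c * h w) w = c * (Q ^^ n) h w"
proof (induction n arbitrary: w)
  case (Suc n)
  then show ?case by (simp add: Q_apply next_mean_def field_simps)
qed simp

lemma Q_pow_nonneg:
  assumes "w \<in> W" "\<And>w. w \<in> W \<Longrightarrow> 0 \<le> h w"
  shows "0 \<le> (Q ^^ n) h w"
  using Q_pow_mono[of w "\<lambda>_. 0" h n] Q_pow_mult[of n 0 "\<lambda>_. 0" w] assms by simp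

text \<open>From any window, spelling out \<open>a\<close> produces a hit within \<open>L\<close> steps.\<close>

lemma Q_pow_L: "w \<in> W \<Longrightarrow> (Q ^^ L) (\<lambda>_. 1) w \<le> 1 - 1 / 2 ^ L"
proof -
  assume w: "w \<in> W"
  have le1: "path_weight miss w s \<le> 1 \<and> 0 \<le> path_weight miss w s" for w s
    by (induction s arbitrary: w) (auto simp: miss_def)
  have zero: "s \<noteq> [] \<Longrightarrow> slide w s = a \<Longrightarrow> path_weight miss w s = 0" for w s
  proof (induction s arbitrary: w)
    case (Cons c s)
    then show ?case by (cases s) (auto simp: miss_def)
  qed simp
  have "(\<Sum>s\<in>W. path_weight miss w s) = (\<Sum>s\<in>W - {a}. path_weight miss w s)"
    using zero[of a w] slide_full[OF L_pos w a_in] L_pos length_a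
    by (subst sum.remove[of _ a]) auto
  also have "\<dots> \<le> (\<Sum>s\<in>W - {a}. 1)"
    by (intro sum_mono) (use le1 in auto)
  also have "\<dots> = 2 ^ L - 1"
    by (simp add: of_nat_diff)
  finally show ?thesis
    unfolding Q_def path_expansion by (simp add: field_simps)
qed

lemma Q_pow_blocks: "w \<in> W \<Longrightarrow> (Q ^^ (L * k)) (\<lambda>_. 1) w \<le> (1 - 1 / 2 ^ L) ^ k"
proof (induction k arbitrary: w)
  case (Suc k)
  have "(Q ^^ (L * Suc k)) (\<lambda>_. 1) w = (Q ^^ L) ((Q ^^ (L * k)) (\<lambda>_. 1)) w"
    by (simp add: funpow_add)
  also have "\<dots> \<le> (Q ^^ L) (\<lambda>_. (1 - 1 / 2 ^ L) ^ k * 1) w"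
    using Suc by (intro Q_pow_mono) auto
  also have "\<dots> = (1 - 1 / 2 ^ L) ^ k * (Q ^^ L) (\<lambda>_. 1) w"
    by (rule Q_pow_mult)
  also have "\<dots> \<le> (1 - 1 / 2 ^ L) ^ k * (1 - 1 / 2 ^ L)"
    by (intro mult_left_mono Q_pow_L Suc zero_le_power) auto
  finally show ?case by (simp add: mult.commute)
qed simp

lemma Q_pow_one_le: "w \<in> W \<Longrightarrow> (Q ^^ n) (\<lambda>_. 1) w \<le> 1"
proof (induction n arbitrary: w)
  case (Suc n)
  have "Q ((Q ^^ n) (\<lambda>_. 1)) w \<le> Q (\<lambda>_. 1) w"
    by (intro Q_mono Suc)
  also have "\<dots> \<le> 1"
    by (auto simp: Q_apply next_mean_def miss_def)
  finally show ?case by simp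
qed simp

lemma Q_pow_geometric:
  "\<exists>C \<rho>. 0 \<le> C \<and> 0 < \<rho> \<and> \<rho> < 1 \<and> (\<forall>n. \<forall>w\<in>W. (Q ^^ n) (\<lambda>_. 1) w \<le> C * \<rho> ^ n)"
proof -
  define r :: real where "r = 1 - 1 / 2 ^ L"
  have "(2::real) ^ 1 \<le> 2 ^ L" using L_pos by (intro power_increasing) auto
  then have r: "0 < r" "r < 1" by (auto simp: r_def field_simps)
  define \<rho> where "\<rho> = root L r"
  have \<rho>: "0 < \<rho>" "\<rho> < 1" "\<rho> ^ L = r"
    using r L_pos by (auto simp: \<rho>_def real_root_lt_1_iff)
  have "(Q ^^ n) (\<lambda>_. 1) w \<le> (1 / \<rho> ^ L) * \<rho> ^ n" if w: "w \<in> W" for n w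
  proof -
    define k where "k = n div L"
    have n: "n = n mod L + L * k" by (simp add: k_def)
    have "(Q ^^ n) (\<lambda>_. 1) w = (Q ^^ (n mod L)) ((Q ^^ (L * k)) (\<lambda>_. 1)) w"
      by (subst n) (simp add: funpow_add)
    also have "\<dots> \<le> (Q ^^ (n mod L)) (\<lambda>_. r ^ k * 1) w"
      using Q_pow_blocks[of _ k] w by (intro Q_pow_mono) (auto simp: r_def)
    also have "\<dots> = r ^ k * (Q ^^ (n mod L)) (\<lambda>_. 1) w"
      by (rule Q_pow_mult)
    also have "\<dots> \<le> r ^ k * 1"
      by (intro mult_left_mono Q_pow_one_le w) (use r in auto)
    also have "\<dots> = \<rho> ^ (L * k)" by (simp add: \<rho>(3)[symmetric] power_mult)
    also have "\<dots> = (1 / \<rho> ^ L) * \<rho> ^ (L * k + L)"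
      using \<rho>(1) by (simp add: power_add)
    also have "\<dots> \<le> (1 / \<rho> ^ L) * \<rho> ^ n"
    proof (intro mult_left_mono power_decreasing)
      have "n mod L < L" using L_pos by simp
      then show "n \<le> L * k + L" using n by linarith
    qed (use \<rho> in auto)
    finally show ?thesis .
  qed
  then show ?thesis
    using \<rho> by (intro exI[of _ "1 / \<rho> ^ L"] exI[of _ \<rho>]) auto
qed

lemma Q_pow_tendsto_0:
  assumes "w \<in> W"
  shows "(\<lambda>n. (Q ^^ n) (\<lambda>_. 1) w) \<longlonglongrightarrow> 0"
proof -
  obtain C \<rho> where *: "0 \<le> C" "0 < \<rho>" "\<rho> < 1" "\<forall>n. \<forall>w\<in>W. (Q ^^ n) (\<lambda>_. 1) w \<le> C * \<rho> ^ n"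
    using Q_pow_geometric by blast
  have "(\<lambda>n. C * \<rho> ^ n) \<longlonglongrightarrow> C * 0"
    by (intro tendsto_mult tendsto_const LIMSEQ_power_zero) (use * in auto)
  then show ?thesis
    using * assms
    by (intro tendsto_sandwich[OF _ _ tendsto_const, of 0 "\<lambda>n. (Q ^^ n) (\<lambda>_. 1) w" _ "\<lambda>n. C * \<rho> ^ n"])
      (auto intro!: Q_pow_nonneg always_eventually)
qed

text \<open>Uniqueness for the one-step equations: a difference of two solutions is fixed by the killed kernel, whose powers tend to zero.\<close>

lemma Q_fixed_zero:
  assumes "\<And>w. w \<in> W \<Longrightarrow> h w = Q h w" and "w \<in> W"
  shows "h w = 0"
proof -
  define B where "B = (\<Sum>w\<in>W. \<bar>h w\<bar>)"
  have B: "\<bar>h w\<bar> \<le> B" if "w \<in> W" for w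
    using that unfolding B_def by (intro member_le_sum) auto
  have pow: "w \<in> W \<Longrightarrow> (Q ^^ n) h w = h w" for n w
  proof (induction n arbitrary: w)
    case (Suc n)
    have "Q ((Q ^^ n) h) w = Q h w"
      using Suc by (intro antisym Q_mono) auto
    then show ?case using assms(1) Suc.prems by simp
  qed simp
  have up: "h w \<le> B * (Q ^^ n) (\<lambda>_. 1) w" for n
    using Q_pow_mono[of w h "\<lambda>_. B * 1" n] B pow[of w n] assms(2)
      Q_pow_mult[of n B "\<lambda>_. 1" w] by (force simp: abs_le_iff)
  have low: "- B * (Q ^^ n) (\<lambda>_. 1) w \<le> h w" for n
    using Q_pow_mono[of w "\<lambda>_. - B * 1" h n] B pow[of w n] assms(2)
      Q_pow_mult[of n "- B" "\<lambda>_. 1" w] by (force simp: abs_le_iff)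
  have lim: "(\<lambda>n. c * (Q ^^ n) (\<lambda>_. 1) w) \<longlonglongrightarrow> 0" for c
    using tendsto_mult_left[OF Q_pow_tendsto_0[OF assms(2)], of c] by simp
  have "h w \<le> 0" using up by (intro LIMSEQ_le_const[OF lim[of B]]) auto
  moreover have "0 \<le> h w" using low by (intro LIMSEQ_le_const2[OF lim[of "- B"]]) auto
  ultimately show ?thesis by simp
qed

lemma first_hit_nonneg: "w \<in> W \<Longrightarrow> 0 \<le> first_hit e t w"
  unfolding first_hit_def by (intro Q_pow_nonneg) (auto simp: next_mean_def at_word_def)

lemma first_hit_Suc: "first_hit e (Suc t) w = Q (first_hit e t) w"
  by (simp add: first_hit_def)

lemma summable_first_hit:
  assumes "w \<in> W"
  shows "summable (\<lambda>t. real (Suc t) * first_hit e t w)" and "summable (\<lambda>t. first_hit e t w)"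
proof -
  obtain C \<rho> where *: "0 \<le> C" "0 < \<rho>" "\<rho> < 1" "\<forall>n. \<forall>w\<in>W. (Q ^^ n) (\<lambda>_. 1) w \<le> C * \<rho> ^ n"
    using Q_pow_geometric by blast
  have le: "first_hit e t w \<le> C * \<rho> ^ t" for t
  proof -
    have "first_hit e t w \<le> (Q ^^ t) (\<lambda>_. 1) w"
      unfolding first_hit_def using assms by (intro Q_pow_mono) (auto simp: next_mean_def at_word_def)
    then show ?thesis using *(4) assms order_trans by blast
  qed
  have geo: "summable (\<lambda>t. C * (real (Suc t) * \<rho> ^ t))"
    using geometric_deriv_sums[of \<rho>] * by (intro summable_mult) (auto simp: sums_iff)
  show s: "summable (\<lambda>t. real (Suc t) * first_hit e t w)"
  proof (rule summable_comparison_test'[OF geo, of 0])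
    fix t :: nat
    show "norm (real (Suc t) * first_hit e t w) \<le> C * (real (Suc t) * \<rho> ^ t)"
      using le[of t] first_hit_nonneg[OF assms, of e t]
      by (simp add: abs_mult mult.left_commute[of C] mult_left_mono del: of_nat_Suc)
  qed
  show "summable (\<lambda>t. first_hit e t w)"
  proof (rule summable_comparison_test'[OF s, of 0])
    fix t :: nat
    have "1 * first_hit e t w \<le> real (Suc t) * first_hit e t w"
      by (intro mult_right_mono first_hit_nonneg assms) auto
    then show "norm (first_hit e t w) \<le> real (Suc t) * first_hit e t w"
      using first_hit_nonneg[OF assms, of e t] by simp
  qed
qed

lemma Q_suminf:
  assumes "w \<in> W" and "\<And>w. w \<in> W \<Longrightarrow> summable (\<lambda>t. h t w)"
  shows "(\<Sum>t. Q (h t) w) = Q (\<lambda>w. \<Sum>t. h t w) w"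
    and "summable (\<lambda>t. Q (h t) w)"
proof -
  have s: "summable (\<lambda>t. miss v * h t v)" if "v \<in> W" for v
    using assms(2) that by (intro summable_mult) auto
  have "(\<lambda>t. Q (h t) w) sums Q (\<lambda>w. \<Sum>t. h t w) w"
    unfolding Q_apply next_mean_def using assms by (intro sums_divide sums_add sums_mult summable_sums) auto
  then show "(\<Sum>t. Q (h t) w) = Q (\<lambda>w. \<Sum>t. h t w) w"
    by (simp add: sums_iff)
  show "summable (\<lambda>t. Q (h t) w)"
    unfolding Q_apply next_mean_def using assms s by (intro summable_divide summable_add) auto
qed

lemma hit_prob_rec:
  assumes "w \<in> W"
  shows "hit_prob e w = next_mean (at_word e) w + Q (hit_prob e) w"
proof -
  have "hit_prob e w = (\<Sum>t. first_hit e (Suc t) w) + first_hit e 0 w"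
    unfolding hit_prob_def
    using suminf_split_head[OF summable_first_hit(2)[OF assms]] by simp
  also have "(\<Sum>t. first_hit e (Suc t) w) = Q (hit_prob e) w"
    unfolding first_hit_Suc using Q_suminf(1)[OF assms summable_first_hit(2)]
    by (simp add: hit_prob_def[abs_def])
  finally show ?thesis by (simp add: first_hit_def)
qed

lemma hit_mean_rec:
  assumes "w \<in> W"
  shows "hit_mean e w = hit_prob e w + Q (hit_mean e) w"
proof -
  have s: "summable (\<lambda>t. real t * first_hit e t w)"
    using summable_diff[OF summable_first_hit[OF assms, of e]] by (simp add: algebra_simps)
  have "hit_mean e w = (\<Sum>t. first_hit e t w + real t * first_hit e t w)"
    unfolding hit_mean_def by (simp add: algebra_simps)
  also have "\<dots> = hit_prob e w + (\<Sum>t. real t * first_hit e t w)"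
    unfolding hit_prob_def by (rule suminf_add[symmetric]) (use assms summable_first_hit(2) s in auto)
  also have "(\<Sum>t. real t * first_hit e t w) = (\<Sum>t. real (Suc t) * first_hit e (Suc t) w)"
    using suminf_split_head[OF s] by simp
  also have "\<dots> = (\<Sum>t. Q (\<lambda>w. real (Suc t) * first_hit e t w) w)"
    unfolding first_hit_Suc using Q_pow_mult[of 1] by (simp del: of_nat_Suc)
  also have "\<dots> = Q (hit_mean e) w"
    using Q_suminf(1)[OF assms summable_first_hit(1)] by (simp add: hit_mean_def[abs_def])
  finally show ?thesis .
qed

lemma hit_prob_nonneg: "w \<in> W \<Longrightarrow> 0 \<le> hit_prob e w"
  unfolding hit_prob_def by (intro suminf_nonneg summable_first_hit first_hit_nonneg)

lemma hit_prob_total: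
  assumes "w \<in> W"
  shows "hit_prob a w + hit_prob b w = 1"
proof -
  have "1 - hit_prob a w - hit_prob b w = 0"
  proof (rule Q_fixed_zero[OF _ assms])
    fix w assume "w \<in> W"
    then show "1 - hit_prob a w - hit_prob b w = Q (\<lambda>w. 1 - hit_prob a w - hit_prob b w) w"
      by (subst (1 2) hit_prob_rec) (auto simp: Q_apply next_mean_def miss_eq field_simps)
  qed
  then show ?thesis by simp
qed

lemma mean_at_word: "e \<in> W \<Longrightarrow> mean L (\<lambda>w. at_word e w * h w) = h e / 2 ^ L"
proof -
  assume e: "e \<in> W"
  have "(\<Sum>w\<in>W. at_word e w * h w) = (\<Sum>w\<in>W. if w = e then h w else 0)"
    by (intro sum.cong) (auto simp: at_word_def)
  then show ?thesis using e by (simp add: mean_def)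
qed

lemma mean_Q: "mean L (Q h) = mean L h - (h a + h b) / 2 ^ L"
proof -
  have "mean L (Q h) = mean L (\<lambda>v. miss v * h v)"
    unfolding Q_def weighted_def by (rule mean_next_mean[OF L_pos])
  also have "\<dots> = mean L (\<lambda>v. h v - (at_word a v * h v + at_word b v * h v))"
    by (intro mean_cong) (simp add: miss_eq algebra_simps)
  also have "\<dots> = mean L h - (h a + h b) / 2 ^ L"
    by (simp add: mean_diff mean_add mean_at_word add_divide_distrib)
  finally show ?thesis .
qed

text \<open>In equilibrium the mass lost by the killed kernel equals the mass injected at \<open>e\<close>. Together with
  \<open>hit_prob_total\<close> this is the symmetry of the sign chain: both signs are repeated with the same probability.\<close>

lemma hit_prob_balance:
  assumes "e \<in> W"
  shows "hit_prob e a + hit_prob e b = 1"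
proof -
  have "mean L (hit_prob e) = mean L (\<lambda>w. next_mean (at_word e) w + Q (hit_prob e) w)"
    by (intro mean_cong) (rule hit_prob_rec)
  also have "\<dots> = 1 / 2 ^ L + (mean L (hit_prob e) - (hit_prob e a + hit_prob e b) / 2 ^ L)"
    using mean_at_word[OF assms, of "\<lambda>_. 1"] by (simp add: mean_add mean_Q mean_next_mean[OF L_pos])
  finally show ?thesis by (simp add: field_simps)
qed

text \<open>The average of the one-step equation for the mean hitting times, a form of Kac's recurrence formula; summed over \<open>e\<close> it gives \<open>hit_mean_total\<close>.\<close>

lemma mean_hit_prob: "mean L (hit_prob e) = (hit_mean e a + hit_mean e b) / 2 ^ L"
proof -
  have "mean L (hit_mean e) = mean L (\<lambda>w. hit_prob e w + Q (hit_mean e) w)"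
    by (intro mean_cong) (rule hit_mean_rec)
  also have "\<dots> = mean L (hit_prob e) + (mean L (hit_mean e) - (hit_mean e a + hit_mean e b) / 2 ^ L)"
    by (simp add: mean_add mean_Q)
  finally show ?thesis by simp
qed

lemma hit_mean_total:
  "hit_mean a a + hit_mean a b + hit_mean b a + hit_mean b b = 2 ^ L"
proof -
  have "mean L (hit_prob a) + mean L (hit_prob b) = mean L (\<lambda>w. hit_prob a w + hit_prob b w)"
    by (simp add: mean_add)
  also have "\<dots> = mean L (\<lambda>_. 1)"
    by (intro mean_cong) (rule hit_prob_total)
  finally show ?thesis by (simp add: mean_hit_prob flip: add_divide_distrib)
qed

definition p :: real where "p = hit_prob a a"
definition q :: real where "q = 1 - p"

lemma hit_prob_values: "hit_prob a a = p" "hit_prob b a = q" "hit_prob a b = q" "hit_prob b b = p"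
  using hit_prob_balance[of a] hit_prob_total[of a] hit_prob_total[of b] by (auto simp: p_def q_def)

text \<open>If \<open>b\<close> could not be the next hit after \<open>a\<close>, the set of windows from which \<open>b\<close> is never hit first would be closed under the steps of the chain, although every window leads to \<open>b\<close>.\<close>

lemma q_pos: "0 < q"
proof (rule ccontr)
  assume "\<not> 0 < q"
  then have z: "hit_prob b a = 0"
    using hit_prob_nonneg[of a b] by (simp add: hit_prob_values)
  have step: "shift w c \<noteq> b \<and> (shift w c = a \<or> hit_prob b (shift w c) = 0)"
    if "w \<in> W" "hit_prob b w = 0" for w c
  proof -
    have "0 = next_mean (\<lambda>v. at_word b v + miss v * hit_prob b v) w"
      using hit_prob_rec[OF that(1), of b] that(2) by (simp add: next_mean_add Q_apply)
    moreover have "0 \<le> at_word b (shift w d) + miss (shift w d) * hit_prob b (shift w d)" for d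
      using hit_prob_nonneg[of "shift w d" b] that by (auto simp: at_word_def miss_def)
    ultimately have "at_word b (shift w c) + miss (shift w c) * hit_prob b (shift w c) = 0"
      unfolding next_mean_def by (cases c) (smt (verit) divide_eq_0_iff)+
    then show ?thesis
      using distinct
      by (cases "shift w c = a"; cases "shift w c = b") (auto simp: at_word_def miss_def)
  qed
  have "w \<in> W \<Longrightarrow> hit_prob b w = 0 \<Longrightarrow> s \<noteq> [] \<Longrightarrow> slide w s \<noteq> b" for w s
  proof (induction s arbitrary: w)
    case (Cons c s)
    have "hit_prob b (shift w c) = 0" and "shift w c \<noteq> b"
      using step[OF Cons.prems(1,2), of c] z by auto
    then show ?case using Cons.IH[of "shift w c"] Cons.prems by (cases s) auto
  qed simp
  from this[of a b] z show False
    using slide_full[OF L_pos a_in b_in] L_pos length_b by auto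
qed

end

section \<open>Two paths whose scores differ by one\<close>

definition score :: "bool list \<Rightarrow> bool list \<Rightarrow> bool list \<Rightarrow> int" where
  "score a b w = of_bool (w = a) - of_bool (w = b)"

text \<open>A word of the form \<open>1\<^sup>k 0\<^sup>d\<close> is primitive: it decreases, while a proper power of a word with both letters has an ascent.\<close>

lemma commute_two_block:
  assumes comm: "e @ P = P @ e" and P: "P = replicate k True @ replicate d False" and "0 < k" "0 < d"
  shows "\<exists>m. e = concat (replicate m P)"
proof -
  obtain m n zs where e: "concat (replicate m zs) = e" and Pz: "concat (replicate n zs) = P"
    using comm_append_are_replicate[OF comm] by blast
  have n: "n \<noteq> 0" using Pz P assms(3) by (intro notI) simp
  have set: "set zs = {True, False}"
  proof -
    have "set P = set zs" using n by (auto simp: Pz[symmetric])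
    then show ?thesis using P assms by auto
  qed
  have "n = 1"
  proof (rule ccontr)
    assume "n \<noteq> 1"
    then obtain r where "n = Suc (Suc r)" using n by (metis One_nat_def not0_implies_Suc)
    then have "P = zs @ zs @ concat (replicate r zs)" by (simp add: Pz[symmetric])
    moreover have "sorted_wrt (\<lambda>x y. y \<le> x) P"
      unfolding P by (simp add: sorted_wrt_append) (simp add: sorted_wrt_iff_nth_less)
    ultimately have "\<forall>x\<in>set zs. \<forall>y\<in>set zs. y \<le> x"
      by (auto simp: sorted_wrt_append)
    then show False using set by auto
  qed
  then show ?thesis using e Pz by auto
qed

lemma concat_replicate_conjugate:
  "u @ concat (replicate m (v @ u)) = concat (replicate m (u @ v)) @ u"
  by (induction m) auto

lemma rev_concat_replicate: "rev (concat (replicate m xs)) = concat (replicate m (rev xs))"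
  by (simp add: rev_concat map_replicate_const rev_replicate)

text \<open>Here \<open>u\<close> and \<open>v\<close> differ by moving \<open>d\<close> zeros and also by moving \<open>k\<close> ones from one end to the other.
  Writing \<open>u = 0\<^sup>d e 1\<^sup>k\<close>, the two descriptions of \<open>v\<close> say that \<open>e\<close> commutes with \<open>1\<^sup>k 0\<^sup>d\<close>, so \<open>e\<close> is a power of
  it and \<open>v\<close> is the reversal of \<open>u\<close>.\<close>

lemma two_shifts_imp_rev:
  fixes u v x y :: "bool list"
  assumes u: "u = replicate d False @ y" "u = x @ replicate k True"
    and v: "v = y @ replicate d False" "v = replicate k True @ x"
    and pos: "0 < d" "0 < k"
  shows "v = rev u"
proof (cases "d \<le> length x")
  case True
  have len: "length y = (length x - d) + k" using arg_cong[OF u(1), of length] arg_cong[OF u(2), of length] True by simp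
  have "replicate d False @ y = x @ replicate k True" using u by simp
  then have "\<exists>us. (replicate d False = x @ us \<and> us @ y = replicate k True) \<or>
    (replicate d False @ us = x \<and> y = us @ replicate k True)"
    by (simp add: append_eq_append_conv2)
  then obtain e where e: "x = replicate d False @ e" "y = e @ replicate k True"
  proof (elim exE disjE conjE)
    fix us
    assume as: "replicate d False = x @ us" "us @ y = replicate k True"
    then have "length us = 0" using True by (metis add_le_same_cancel1 le_zero_eq length_append length_replicate)
    then show thesis using as that[of "[]"] by simp
  next
    fix us
    assume "replicate d False @ us = x" "y = us @ replicate k True"
    then show thesis using that by auto
  qed
  define P where "P = replicate k True @ replicate d False"
  have "e @ P = P @ e"
    using v e by (simp add: P_def)
  then obtain m where m: "e = concat (replicate m P)"
    using commute_two_block[OF _ P_def pos(2,1)] by blast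
  have "v = concat (replicate (Suc m) P)"
    using v(2) e m by (simp add: P_def)
  moreover have "u = concat (replicate (Suc m) (rev P))"
    using u(1) e m concat_replicate_conjugate[of "replicate d False" m "replicate k True"]
      concat_replicate_conjugate[of "replicate k True" m "replicate d False"]
    by (simp add: P_def)
  ultimately show ?thesis by (metis rev_concat_replicate rev_rev_ident)
next
  case False
  \<comment> \<open>The blocks \<open>0\<^sup>d\<close> and \<open>1\<^sup>k\<close> would overlap in \<open>u\<close>, so the letter after \<open>y\<close> in \<open>v\<close> is both \<open>0\<close> and \<open>1\<close>.\<close>
  have lt: "length y < k"
    using arg_cong[OF u(1), of length] arg_cong[OF u(2), of length] False by simp
  have "v ! length y = False" using v(1) pos by (simp add: nth_append)
  moreover have "v ! length y = True" using v(2) lt by (simp add: nth_append)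
  ultimately show ?thesis by simp
qed

lemma commute_replicate:
  assumes "y @ replicate d z = replicate d z @ y" "0 < d"
  shows "y = replicate (length y) z"
  using assms
proof (induction y)
  case (Cons x y)
  obtain d' where d: "d = Suc d'" using Cons.prems by (cases d) auto
  then have "x = z" using Cons.prems by simp
  then have "y @ replicate d z = replicate d z @ y"
    using Cons.prems(1) d replicate_app_Cons_same[of d' z y] by simp
  then show ?case using Cons \<open>x = z\<close> by simp
qed simp

lemma path_sum_as_sum:
  "path_sum f w s = (\<Sum>k\<in>{1..length s}. f (slide w (take k s)))"
proof (induction s rule: rev_induct)
  case (snoc c s)
  have "(\<Sum>k\<in>{1..length s}. f (slide w (take k (s @ [c])))) = (\<Sum>k\<in>{1..length s}. f (slide w (take k s)))"
    by (intro sum.cong) auto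
  then show ?case using snoc by (simp add: sum.nat_ivl_Suc')
qed simp

lemma count_list_replicate: "count_list (replicate n x) y = (if x = y then n else 0)"
  by (induction n) auto

lemma count_list_0_imp_replicate: "count_list xs (\<not> z) = 0 \<Longrightarrow> xs = replicate (length xs) z"
  by (induction xs) (auto split: if_splits)

text \<open>A window into \<open>a\<close> padded by \<open>z\<close> contains at most as many letters other than \<open>z\<close> as \<open>a\<close> does, with
  equality only if the lost letters of \<open>a\<close> are all equal to \<open>z\<close>, and \<open>b\<close> contains at least as many. Hence a second copy of \<open>a\<close> would force \<open>a\<close> to be
  constant, and a copy of \<open>b\<close> is \<open>a\<close> with some \<open>z\<close> moved from one end to the other.\<close>

lemma path_sum_padded:
  assumes len: "length a = L" "length b = L" and "0 < L"
    and cnt: "count_list a (\<not> z) \<le> count_list b (\<not> z)"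
    and ne: "a \<noteq> replicate L z" "a \<noteq> b"
    and no1: "\<And>d y. 0 < d \<Longrightarrow> a = replicate d z @ y \<Longrightarrow> b \<noteq> y @ replicate d z"
    and no2: "\<And>d y. 0 < d \<Longrightarrow> a = y @ replicate d z \<Longrightarrow> b \<noteq> replicate d z @ y"
  shows "path_sum (score a b) (replicate L z) (a @ replicate L z) = 1"
proof -
  define pad where "pad = replicate L z"
  have padne: "pad \<noteq> []" using \<open>0 < L\<close> by (simp add: pad_def)
  define win where "win k = slide pad (take k (a @ pad))" for k
  have cnt_le: "count_list a (\<not> z) \<le> count_list e (\<not> z)" if "e \<in> {a, b}" for e
    using cnt that by auto
  have winL: "win L = a"
    using len padne by (simp add: win_def slide_eq_drop pad_def)
  have left: "win k \<noteq> e" if k: "k < L" and e: "e \<in> {a, b}" for k e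
  proof
    assume eq: "win k = e"
    define d where "d = L - k"
    have w: "win k = replicate d z @ take k a"
      using k len padne by (simp add: win_def slide_eq_drop pad_def d_def)
    have "count_list e (\<not> z) = count_list (take k a) (\<not> z)"
      by (simp add: eq[symmetric] w count_list_append count_list_replicate)
    moreover have "count_list a (\<not> z) = count_list (take k a) (\<not> z) + count_list (drop k a) (\<not> z)"
      by (metis append_take_drop_id count_list_append)
    ultimately have "count_list (drop k a) (\<not> z) = 0" using cnt_le[OF e] by simp
    then have "drop k a = replicate d z"
      using count_list_0_imp_replicate[of "drop k a" z] len by (simp add: d_def)
    then have a: "a = take k a @ replicate d z" by (metis append_take_drop_id)
    have d: "0 < d" using k by (simp add: d_def)
    show False
    proof (cases "e = a")
      case True
      then have "take k a @ replicate d z = replicate d z @ take k a" using a eq w by metis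
      from commute_replicate[OF this d] have "take k a = replicate k z" using k len by simp
      then have "a = replicate L z" using a k by (metis d_def le_add_diff_inverse less_imp_le replicate_add)
      then show False using ne by simp
    next
      case False
      then show False using no2[OF d a] e eq w by auto
    qed
  qed
  have right: "win k \<noteq> e" if k: "L < k" "k \<le> L + L" and e: "e \<in> {a, b}" for k e
  proof
    assume eq: "win k = e"
    define d where "d = k - L"
    have d: "0 < d" "d \<le> L" using k by (auto simp: d_def)
    have w: "win k = drop d a @ replicate d z"
      using k len padne unfolding win_def
      by (subst slide_eq_drop) (auto simp: pad_def d_def)
    have "count_list e (\<not> z) = count_list (drop d a) (\<not> z)"
      by (simp add: eq[symmetric] w count_list_append count_list_replicate)
    moreover have "count_list a (\<not> z) = count_list (take d a) (\<not> z) + count_list (drop d a) (\<not> z)"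
      by (metis append_take_drop_id count_list_append)
    ultimately have "count_list (take d a) (\<not> z) = 0" using cnt_le[OF e] by simp
    then have "take d a = replicate d z"
      using count_list_0_imp_replicate[of "take d a" z] len d by simp
    then have a: "a = replicate d z @ drop d a" by (metis append_take_drop_id)
    show False
    proof (cases "e = a")
      case True
      then have "drop d a @ replicate d z = replicate d z @ drop d a" using a eq w by metis
      from commute_replicate[OF this d(1)] have "drop d a = replicate (L - d) z" using len by simp
      then have "a = replicate L z" using a d by (metis le_add_diff_inverse replicate_add)
      then show False using ne by simp
    next
      case False
      then show False using no1[OF d(1) a] e eq w by auto
    qed
  qed
  have "path_sum (score a b) pad (a @ pad) = (\<Sum>k\<in>{1..L + L}. score a b (win k))"
    by (simp add: path_sum_as_sum win_def len pad_def)
  also have "\<dots> = (\<Sum>k\<in>{1..L + L}. of_bool (k = L))"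
    using left right winL ne by (intro sum.cong refl) (auto simp: score_def, (metis insertI1 insertI2 nat_neq_iff)+)
  also have "\<dots> = 1" using \<open>0 < L\<close> by simp
  finally show ?thesis by (simp add: pad_def)
qed

lemma score_swap: "score b a w = - score a b w"
  by (simp add: score_def)

lemma path_sum_swap: "path_sum (score b a) w s = - path_sum (score a b) w s"
  by (induction s arbitrary: w) (auto simp: score_swap[of b a])

lemma shift_replicate: "0 < L \<Longrightarrow> shift (replicate L z) z = replicate L z"
  by (cases L) (auto simp: shift_def replicate_append_same)

lemma slide_replicate: "0 < L \<Longrightarrow> slide (replicate L z) (replicate n z) = replicate L z"
  by (induction n) (auto simp: shift_replicate)

lemma path_sum_replicate:
  "0 < L \<Longrightarrow> path_sum f (replicate L z) (replicate n z) = int n * f (replicate L z)"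
  by (induction n) (auto simp: shift_replicate algebra_simps)

context two_words
begin

abbreviation f :: "bool list \<Rightarrow> int" where "f \<equiv> score a b"

definition unit_gap :: bool where
  "unit_gap \<longleftrightarrow> (\<exists>w0 u u'. w0 \<in> W \<and> length u = length u' \<and> slide w0 u = slide w0 u' \<and>
    \<bar>path_sum f w0 u - path_sum f w0 u'\<bar> = 1)"

lemma aperiodic_from_loop:
  assumes "w0 \<in> W" "length u = length u'" "slide w0 u = slide w0 u'"
    and "\<bar>path_sum f w0 u - path_sum f w0 u'\<bar> = 1"
  shows "\<exists>N s s'. s \<in> words N \<and> s' \<in> words N \<and>
    (\<forall>w\<in>W. slide w s = slide w s' \<and> path_sum f w s' = path_sum f w s + 1)"
proof -
  define x where "x = (if path_sum f w0 u < path_sum f w0 u' then u else u')"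
  define y where "y = (if path_sum f w0 u < path_sum f w0 u' then u' else u)"
  have "w0 @ x \<in> words (L + length u)" "w0 @ y \<in> words (L + length u)"
    using assms by (auto simp: words_def x_def y_def)
  moreover have "slide w (w0 @ x) = slide w (w0 @ y) \<and>
     path_sum f w (w0 @ y) = path_sum f w (w0 @ x) + 1" if "w \<in> W" for w
    using that assms slide_full[OF L_pos that assms(1)] by (auto simp: x_def y_def)
  ultimately show ?thesis by blast
qed

text \<open>A longer run of the constant word contains one more copy of it, and the other word occurs equally often at the ends of both runs.\<close>

lemma aperiodic_constant:
  assumes e: "replicate L z \<in> {a, b}" and nz: "replicate L (\<not> z) \<notin> {a, b}"
  shows "unit_gap"
proof -
  define u where "u = replicate L z @ replicate L (\<not> z) @ [\<not> z]"
  define u' where "u' = replicate L z @ [z] @ replicate L (\<not> z)"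
  define w0 where "w0 = replicate L (\<not> z)"
  have in_W: "replicate L c \<in> W" for c by (simp add: words_def)
  have full: "slide (replicate L c) (replicate L d) = replicate L d" for c d
    by (rule slide_full[OF L_pos]) (rule in_W)+
  have "slide w0 u = slide w0 u'"
    by (simp add: w0_def u_def u'_def full shift_replicate[OF L_pos])
  moreover have "path_sum f w0 u' - path_sum f w0 u = f (replicate L z)"
    using nz by (simp add: w0_def u_def u'_def full shift_replicate[OF L_pos]) (simp add: score_def)
  moreover have "\<bar>f (replicate L z)\<bar> = 1" using e distinct by (auto simp: score_def)
  moreover have "w0 \<in> W" "length u = length u'" by (auto simp: w0_def u_def u'_def in_W)
  ultimately show ?thesis unfolding unit_gap_def by (smt (verit))
qed

lemma aperiodic_padded:
  assumes "replicate L z \<notin> {a, b}" "\<bar>path_sum f (replicate L z) (e @ replicate L z)\<bar> = 1"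
  shows "unit_gap"
  unfolding unit_gap_def
proof (intro exI conjI)
  show w0: "replicate L z \<in> W" by (simp add: words_def)
  show "length (e @ replicate L z) = length (replicate (length e + L) z)" by simp
  have "slide (replicate L z) (e @ replicate L z) = replicate L z"
    using slide_full[OF L_pos slide_in_words[OF L_pos w0] w0] by simp
  then show "slide (replicate L z) (e @ replicate L z) = slide (replicate L z) (replicate (length e + L) z)"
    by (simp add: slide_replicate[OF L_pos])
  show "\<bar>path_sum f (replicate L z) (e @ replicate L z) -
      path_sum f (replicate L z) (replicate (length e + L) z)\<bar> = 1"
    using assms by (simp add: path_sum_replicate[OF L_pos]) (simp add: score_def)
qed

lemma aperiodic_or_shift:
  assumes nc: "replicate L z \<notin> {a, b}"
  shows "unit_gap \<or>
    (\<exists>d y. 0 < d \<and> (a = replicate d z @ y \<and> b = y @ replicate d z \<or>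
                    b = replicate d z @ y \<and> a = y @ replicate d z))"
    (is "?A \<or> ?B")
proof (rule disjCI)
  assume nB: "\<not> ?B"
  show ?A
  proof (cases "count_list a (\<not> z) \<le> count_list b (\<not> z)")
    case True
    have "path_sum f (replicate L z) (a @ replicate L z) = 1"
      by (intro path_sum_padded length_a length_b L_pos True) (use nB nc distinct in blast)+
    then show ?thesis using aperiodic_padded[OF nc, of a] by simp
  next
    case False
    have "path_sum (score b a) (replicate L z) (b @ replicate L z) = 1"
      by (intro path_sum_padded length_a length_b L_pos) (use nB nc distinct False linorder_linear in blast)+
    then show ?thesis using aperiodic_padded[OF nc, of b] by (simp add: path_sum_swap[of b a])
  qed
qed

text \<open>For \<open>b = rev a\<close> the hits may alternate strictly (\<open>a = 01\<close>, \<open>b = 10\<close>), and for constant words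
  \<open>b = map Not a\<close> the argument with runs has no neutral letter left.\<close>

lemma aperiodic:
  assumes not_rev: "b \<noteq> rev a" and not_conj: "b \<noteq> map Not a"
  shows "\<exists>N s s'. s \<in> words N \<and> s' \<in> words N \<and>
    (\<forall>w\<in>W. slide w s = slide w s' \<and> path_sum f w s' = path_sum f w s + 1)"
proof -
  have "unit_gap"
  proof (cases "\<exists>z. replicate L z \<in> {a, b}")
    case True
    then obtain z where z: "replicate L z \<in> {a, b}" ..
    have ne: "replicate L z \<noteq> replicate L (\<not> z)" using L_pos by simp
    have "replicate L (\<not> z) \<notin> {a, b}"
      using z distinct not_conj ne by (auto simp: map_replicate_const)
    then show ?thesis using aperiodic_constant z by blast
  next
    case False
    show ?thesis
    proof (rule ccontr)
      assume no: "\<not> ?thesis"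
      obtain d y where y: "0 < d" "a = replicate d False @ y \<and> b = y @ replicate d False \<or>
                    b = replicate d False @ y \<and> a = y @ replicate d False"
        using aperiodic_or_shift[of False] no False by blast
      obtain k x where x: "0 < k" "a = replicate k True @ x \<and> b = x @ replicate k True \<or>
                    b = replicate k True @ x \<and> a = x @ replicate k True"
        using aperiodic_or_shift[of True] no False by blast
      have clash: "replicate d False @ y \<noteq> replicate k True @ x"
        using y(1) x(1) by (cases d; cases k) auto
      from y(2) x(2) clash have "b = rev a \<or> a = rev b"
        using two_shifts_imp_rev[of _ d y x k, OF _ _ _ _ y(1) x(1)] by metis
      then show False using not_rev by auto
    qed
  qed
  then show ?thesis using aperiodic_from_loop unfolding unit_gap_def by blast
qed

end

section \<open>The corrector equations\<close>

lemma weighted_pow_diff: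
  "(weighted \<phi> ^^ n) (\<lambda>w. g w - h w) w = (weighted \<phi> ^^ n) g w - (weighted \<phi> ^^ n) h w"
  by (simp add: path_expansion sum_subtractf field_simps)

lemma weighted_pow_mult:
  "(weighted \<phi> ^^ n) (\<lambda>w. c * h w) w = c * (weighted \<phi> ^^ n) h w"
  by (simp add: path_expansion sum_distrib_left mult.left_commute)

context two_words
begin

abbreviation fr :: "bool list \<Rightarrow> real" where "fr w \<equiv> of_int (f w)"

lemma fr_eq: "fr w = at_word a w - at_word b w"
  by (simp add: score_def at_word_def)

lemma fr_sq: "(fr w)\<^sup>2 = at_word a w + at_word b w"
  using distinct by (auto simp: score_def at_word_def)

text \<open>The expansion of the leading eigenvalue of the twisted kernel is
  \<open>1 - half_var \<theta>\<^sup>2 - i cumulant3 \<theta>\<^sup>3 + O(\<theta>\<^sup>4)\<close>: \<open>2 half_var\<close> and \<open>6 cumulant3\<close> are the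
  asymptotic variance and third cumulant per step of the sum of \<open>f\<close>. The eigenvector is \<open>1 + i \<theta> corr1 - \<theta>\<^sup>2 corr2 + O(\<theta>\<^sup>3)\<close>.\<close>

definition half_var :: real where "half_var = p / (q * 2 ^ L)"

definition corr1 :: "bool list \<Rightarrow> real" where
  "corr1 w = (hit_prob a w - hit_prob b w) / (2 * q)"

definition next_hit_mean :: "bool list \<Rightarrow> real" where
  "next_hit_mean w = hit_mean a w + hit_mean b w"

definition corr2 :: "bool list \<Rightarrow> real" where
  "corr2 w = - half_var * (next_hit_mean a - next_hit_mean b) / (4 * q) * (hit_prob a w - hit_prob b w)
          - half_var * next_hit_mean w"

text \<open>The first corrector is determined up to a constant; the choice above makes it
  antisymmetric, \<open>corr1 b = - corr1 a\<close>, and its mean then reappears in the third cumulant and in the drift.\<close>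

definition corr1_mean :: real where "corr1_mean = mean L corr1"

definition cumulant3 :: real where "cumulant3 = (corr2 a - corr2 b) / 2 ^ L - half_var * corr1_mean"

text \<open>What is left of the third-order corrector equation when no third corrector is added. That its mean vanishes (\<open>mean_cubic_defect\<close>) is the equation that fixes \<open>cumulant3\<close>.\<close>

definition cubic_defect :: "bool list \<Rightarrow> real" where
  "cubic_defect w = next_mean (\<lambda>v. fr v ^ 3 / 6 + (fr v)\<^sup>2 * corr1 v / 2 + fr v * corr2 v) w - (cumulant3 + half_var * corr1 w)"

lemma at_word_mult: "at_word e v * h v = h e * at_word e v"
  by (simp add: at_word_def)

lemma Q_eq_next_mean: "Q h w = next_mean h w - h a * next_mean (at_word a) w - h b * next_mean (at_word b) w"
proof -
  have "Q h w = next_mean (\<lambda>v. h v - h a * at_word a v - h b * at_word b v) w"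
    unfolding Q_apply by (simp add: miss_eq left_diff_distrib at_word_mult)
  then show ?thesis by (simp add: next_mean_diff next_mean_mult)
qed

lemma next_mean_hit_prob:
  "w \<in> W \<Longrightarrow> next_mean (hit_prob e) w = hit_prob e w - next_mean (at_word e) w
     + hit_prob e a * next_mean (at_word a) w + hit_prob e b * next_mean (at_word b) w"
  using hit_prob_rec[of w e] Q_eq_next_mean[of "hit_prob e" w] by simp

lemma next_mean_next_hit_mean:
  assumes "w \<in> W"
  shows "next_mean next_hit_mean w = next_hit_mean w - 1
     + next_hit_mean a * next_mean (at_word a) w + next_hit_mean b * next_mean (at_word b) w"
proof -
  have "next_mean next_hit_mean w = next_mean (hit_mean a) w + next_mean (hit_mean b) w"
    by (simp add: next_hit_mean_def[abs_def] next_mean_add)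
  then show ?thesis
    using hit_mean_rec[OF assms, of a] hit_mean_rec[OF assms, of b] hit_prob_total[OF assms]
      Q_eq_next_mean[of "hit_mean a" w] Q_eq_next_mean[of "hit_mean b" w]
    by (simp add: next_hit_mean_def algebra_simps)
qed

lemma pq: "p = 1 - q" by (simp add: q_def)

lemma corr1_ab: "corr1 a = (p - q) / (2 * q)" "corr1 b = (q - p) / (2 * q)"
  by (simp_all add: corr1_def hit_prob_values)

lemma corr1_ba: "corr1 b = - corr1 a"
  by (simp add: corr1_ab minus_divide_left)

text \<open>The step equation of the hitting probabilities fails only at \<open>a\<close> and \<open>b\<close>; the factor
  \<open>1 / (2 q)\<close> makes the defect there cancel against \<open>f\<close>.\<close>

lemma corrector_order1:
  assumes "w \<in> W"
  shows "next_mean (\<lambda>v. fr v + corr1 v) w = corr1 w"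
proof -
  have "next_mean (\<lambda>v. fr v + corr1 v) w =
      next_mean (\<lambda>v. at_word a v - at_word b v + (1 / (2 * q)) * (hit_prob a v - hit_prob b v)) w"
    by (simp add: fr_eq corr1_def)
  also have "\<dots> = next_mean (at_word a) w - next_mean (at_word b) w
      + (1 / (2 * q)) * (next_mean (hit_prob a) w - next_mean (hit_prob b) w)"
    by (simp only: next_mean_add next_mean_diff next_mean_mult)
  also have "\<dots> = corr1 w"
    using q_pos by (simp add: next_mean_hit_prob[OF assms] hit_prob_values corr1_def pq field_simps)
  finally show ?thesis .
qed

lemma half_var_total: "half_var * (next_hit_mean a + next_hit_mean b) = p / q"
proof -
  have "next_hit_mean a + next_hit_mean b = 2 ^ L"
    using hit_mean_total by (simp add: next_hit_mean_def)
  then show ?thesis by (simp add: half_var_def)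
qed

text \<open>The mean hitting time contributes the constant \<open>half_var\<close>. Cancelling the defects at \<open>a\<close> and at \<open>b\<close>
  are two linear conditions: their sum fixes \<open>half_var\<close> (\<open>half_var_total\<close>), their difference fixes the multiple of the
  hitting probabilities in \<open>corr2\<close>.\<close>

lemma corrector_order2:
  assumes "w \<in> W"
  shows "next_mean (\<lambda>v. (fr v)\<^sup>2 / 2 + fr v * corr1 v + corr2 v) w = half_var + corr2 w"
proof -
  define \<alpha> where "\<alpha> = - half_var * (next_hit_mean a - next_hit_mean b) / (4 * q)"
  have corr1: "fr v * corr1 v = corr1 a * at_word a v - corr1 b * at_word b v" for v
    by (simp add: fr_eq left_diff_distrib at_word_mult)
  have "next_mean (\<lambda>v. (fr v)\<^sup>2 / 2 + fr v * corr1 v + corr2 v) w =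
    next_mean (\<lambda>v. (1/2) * (at_word a v + at_word b v) + (corr1 a * at_word a v - corr1 b * at_word b v)
        + (\<alpha> * (hit_prob a v - hit_prob b v) - half_var * next_hit_mean v)) w"
    by (simp add: fr_sq corr1 corr2_def \<alpha>_def)
  also have "\<dots> = (1/2) * (next_mean (at_word a) w + next_mean (at_word b) w)
      + (corr1 a * next_mean (at_word a) w - corr1 b * next_mean (at_word b) w)
      + (\<alpha> * (next_mean (hit_prob a) w - next_mean (hit_prob b) w) - half_var * next_mean next_hit_mean w)"
    by (simp only: next_mean_add next_mean_diff next_mean_mult)
  also have "\<dots> = half_var + corr2 w
     + next_mean (at_word a) w * (1/2 + corr1 a - 2 * q * \<alpha> - half_var * next_hit_mean a)
     + next_mean (at_word b) w * (1/2 - corr1 b + 2 * q * \<alpha> - half_var * next_hit_mean b)"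
    unfolding next_mean_hit_prob[OF assms] next_mean_next_hit_mean[OF assms] hit_prob_values corr2_def \<alpha>_def[symmetric]
    by (simp add: pq algebra_simps)
  also have "1/2 + corr1 a - 2 * q * \<alpha> - half_var * next_hit_mean a = 0"
  proof -
    have "2 * q * \<alpha> = - half_var * (next_hit_mean a - next_hit_mean b) / 2"
      using q_pos by (simp add: \<alpha>_def field_simps)
    moreover have "1/2 + corr1 a = p / q / 2" using q_pos by (simp add: corr1_ab pq field_simps)
    ultimately show ?thesis using half_var_total by (simp add: algebra_simps)
  qed
  also have "1/2 - corr1 b + 2 * q * \<alpha> - half_var * next_hit_mean b = 0"
  proof -
    have "2 * q * \<alpha> = - half_var * (next_hit_mean a - next_hit_mean b) / 2"
      using q_pos by (simp add: \<alpha>_def field_simps)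
    moreover have "1/2 - corr1 b = p / q / 2" using q_pos by (simp add: corr1_ab pq field_simps)
    ultimately show ?thesis using half_var_total by (simp add: algebra_simps)
  qed
  finally show ?thesis by simp
qed

lemma mean_cubic_defect: "mean L cubic_defect = 0"
proof -
  have *: "fr v ^ 3 / 6 + (fr v)\<^sup>2 * corr1 v / 2 + fr v * corr2 v =
      at_word a v * (1/6 + corr1 v / 2 + corr2 v) - at_word b v * (1/6 - corr1 v / 2 + corr2 v)" for v
    using distinct by (auto simp: score_def at_word_def)
  have "mean L cubic_defect = mean L (\<lambda>v. at_word a v * (1/6 + corr1 v / 2 + corr2 v) - at_word b v * (1/6 - corr1 v / 2 + corr2 v))
      - (cumulant3 + half_var * corr1_mean)"
    unfolding cubic_defect_def[abs_def] mean_diff mean_next_mean[OF L_pos] mean_add mean_mult mean_const corr1_mean_def * ..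
  also have "\<dots> = 0"
    unfolding mean_diff mean_at_word[OF a_in, of "\<lambda>v. 1/6 + corr1 v / 2 + corr2 v"]
      mean_at_word[OF b_in, of "\<lambda>v. 1/6 - corr1 v / 2 + corr2 v"]
    by (simp add: cumulant3_def corr1_ba flip: diff_divide_distrib)
  finally show ?thesis .
qed

text \<open>If \<open>p = 0\<close>, then the variance \<open>2 half_var\<close> vanishes. It is the mean of the one-step variance of
  \<open>f + corr1\<close>, so \<open>f\<close> is a coboundary along every step and its sum along a path depends only on the endpoints.\<close>

lemma p_pos_if:
  assumes ss: "\<forall>w\<in>W. slide w s = slide w s' \<and> path_sum f w s' = path_sum f w s + 1"
  shows "0 < p"
proof (rule ccontr)
  assume "\<not> 0 < p"
  then have "p = 0" using hit_prob_nonneg[of a a] by (simp add: p_def)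
  then have l2: "half_var = 0" by (simp add: half_var_def)
  define G where "G v = fr v + corr1 v" for v
  define V where "V w = next_mean (\<lambda>v. (G v)\<^sup>2) w - (corr1 w)\<^sup>2" for w
  have V: "V w = ((G (shift w False) - G (shift w True)) / 2)\<^sup>2" if "w \<in> W" for w
  proof -
    have g: "corr1 w = (G (shift w False) + G (shift w True)) / 2"
      using corrector_order1[OF that] by (simp add: G_def next_mean_def)
    show ?thesis by (simp add: V_def next_mean_def g power2_eq_square field_simps)
  qed
  have "mean L (\<lambda>w. next_mean (\<lambda>v. (fr v)\<^sup>2 / 2 + fr v * corr1 v + corr2 v) w) = mean L (\<lambda>w. half_var + corr2 w)"
    by (intro mean_cong corrector_order2)
  then have o2: "mean L (\<lambda>v. (fr v)\<^sup>2 / 2 + fr v * corr1 v) = 0"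
    by (simp add: mean_next_mean[OF L_pos] mean_add l2)
  have "mean L V = mean L (\<lambda>v. (G v)\<^sup>2) - mean L (\<lambda>v. (corr1 v)\<^sup>2)"
    unfolding V_def[abs_def] by (simp add: mean_diff mean_next_mean[OF L_pos])
  also have "\<dots> = mean L (\<lambda>v. 2 * ((fr v)\<^sup>2 / 2 + fr v * corr1 v))"
    unfolding mean_diff[symmetric] by (intro mean_cong) (simp add: G_def power2_eq_square algebra_simps)
  also have "\<dots> = 0" using o2 by (simp only: mean_mult)
  finally have "(\<Sum>w\<in>W. V w) = 0" by (simp add: mean_def)
  then have V0: "\<forall>w\<in>W. V w = 0"
    using V by (subst (asm) sum_nonneg_eq_0_iff) auto
  have step: "G (shift w c) = corr1 w" if "w \<in> W" for w c
  proof -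
    have "G (shift w False) = G (shift w True)" using V0 V[OF that] that by simp
    moreover have "corr1 w = next_mean G w" using corrector_order1[OF that] by (simp add: G_def[abs_def])
    ultimately show ?thesis by (cases c) (auto simp: next_mean_def)
  qed
  have "real_of_int (path_sum f w s) = corr1 w - corr1 (slide w s)" if "w \<in> W" for w s
    using that
  proof (induction s arbitrary: w)
    case (Cons c s)
    then show ?case using step[of w c] Cons.IH[of "shift w c"] by (simp add: G_def)
  qed simp
  from this[OF a_in, of s] this[OF a_in, of s'] ss a_in show False by force
qed

end

text \<open>A bound \<open>O(\<bar>\<theta>\<bar>\<^sup>k)\<close> that holds on all of \<open>[-\<pi>, \<pi>]\<close>. There every higher power of \<open>\<theta>\<close> is dominated by a
  lower one, so remainders can be added and multiplied without shrinking the range of \<open>\<theta>\<close>.\<close>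

definition ord :: "nat \<Rightarrow> (real \<Rightarrow> complex) \<Rightarrow> bool" where
  "ord k F \<longleftrightarrow> (\<exists>C. \<forall>\<theta>. \<bar>\<theta>\<bar> \<le> pi \<longrightarrow> norm (F \<theta>) \<le> C * \<bar>\<theta>\<bar> ^ k)"

lemma ord_add: "ord k F \<Longrightarrow> ord k G \<Longrightarrow> ord k (\<lambda>\<theta>. F \<theta> + G \<theta>)"
proof -
  assume "ord k F" "ord k G"
  then obtain C D where *: "\<forall>\<theta>. \<bar>\<theta>\<bar> \<le> pi \<longrightarrow> norm (F \<theta>) \<le> C * \<bar>\<theta>\<bar> ^ k"
    "\<forall>\<theta>. \<bar>\<theta>\<bar> \<le> pi \<longrightarrow> norm (G \<theta>) \<le> D * \<bar>\<theta>\<bar> ^ k" by (auto simp: ord_def)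
  show ?thesis unfolding ord_def
  proof (intro exI[of _ "C + D"] allI impI)
    fix \<theta> :: real assume "\<bar>\<theta>\<bar> \<le> pi"
    then have "norm (F \<theta>) \<le> C * \<bar>\<theta>\<bar> ^ k" "norm (G \<theta>) \<le> D * \<bar>\<theta>\<bar> ^ k" using * by auto
    then show "norm (F \<theta> + G \<theta>) \<le> (C + D) * \<bar>\<theta>\<bar> ^ k"
      by (intro norm_triangle_le) (simp add: algebra_simps)
  qed
qed

lemma ord_mult: "ord j F \<Longrightarrow> ord k G \<Longrightarrow> ord (j + k) (\<lambda>\<theta>. F \<theta> * G \<theta>)"
proof -
  assume "ord j F" "ord k G"
  then obtain C D where *: "\<forall>\<theta>. \<bar>\<theta>\<bar> \<le> pi \<longrightarrow> norm (F \<theta>) \<le> C * \<bar>\<theta>\<bar> ^ j"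
    "\<forall>\<theta>. \<bar>\<theta>\<bar> \<le> pi \<longrightarrow> norm (G \<theta>) \<le> D * \<bar>\<theta>\<bar> ^ k" by (auto simp: ord_def)
  show ?thesis unfolding ord_def
  proof (intro exI[of _ "C * D"] allI impI)
    fix \<theta> :: real assume "\<bar>\<theta>\<bar> \<le> pi"
    then have 1: "norm (F \<theta>) \<le> C * \<bar>\<theta>\<bar> ^ j" and 2: "norm (G \<theta>) \<le> D * \<bar>\<theta>\<bar> ^ k" using * by auto
    have "norm (F \<theta> * G \<theta>) \<le> (C * \<bar>\<theta>\<bar> ^ j) * (D * \<bar>\<theta>\<bar> ^ k)"
      unfolding norm_mult using 1 2 order_trans[OF norm_ge_zero 1]
      by (intro mult_mono) auto
    then show "norm (F \<theta> * G \<theta>) \<le> (C * D) * \<bar>\<theta>\<bar> ^ (j + k)" by (simp add: power_add mult_ac)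
  qed
qed

lemma ord_const: "ord 0 (\<lambda>_. c)"
  by (auto simp: ord_def)

lemma ord_power: "ord k (\<lambda>\<theta>. of_real \<theta> ^ k)"
  unfolding ord_def by (intro exI[of _ 1]) (simp add: norm_power)

lemma ord_weaken: "ord k F \<Longrightarrow> j \<le> k \<Longrightarrow> ord j F"
proof -
  assume F: "ord k F" and "j \<le> k"
  then obtain C where *: "\<forall>\<theta>. \<bar>\<theta>\<bar> \<le> pi \<longrightarrow> norm (F \<theta>) \<le> C * \<bar>\<theta>\<bar> ^ k"
    by (auto simp: ord_def)
  show ?thesis unfolding ord_def
  proof (intro exI[of _ "\<bar>C\<bar> * pi ^ (k - j)"] allI impI)
    fix \<theta> :: real assume t: "\<bar>\<theta>\<bar> \<le> pi"
    then have "norm (F \<theta>) \<le> C * \<bar>\<theta>\<bar> ^ k" using * by auto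
    also have "\<dots> \<le> \<bar>C\<bar> * \<bar>\<theta>\<bar> ^ k" by (intro mult_right_mono) auto
    also have "\<bar>\<theta>\<bar> ^ k = \<bar>\<theta>\<bar> ^ (k - j) * \<bar>\<theta>\<bar> ^ j" using \<open>j \<le> k\<close> by (simp flip: power_add)
    also have "\<bar>C\<bar> * (\<bar>\<theta>\<bar> ^ (k - j) * \<bar>\<theta>\<bar> ^ j) \<le> \<bar>C\<bar> * (pi ^ (k - j) * \<bar>\<theta>\<bar> ^ j)"
      using t by (intro mult_left_mono mult_right_mono power_mono) auto
    finally show "norm (F \<theta>) \<le> (\<bar>C\<bar> * pi ^ (k - j)) * \<bar>\<theta>\<bar> ^ j" by simp
  qed
qed

lemma ord_monomial: "k \<le> n \<Longrightarrow> ord k (\<lambda>\<theta>. c * of_real \<theta> ^ n)"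
  using ord_weaken[OF ord_mult[OF ord_const[of c] ord_power[of n]], of k] by simp

lemma ord_uniform:
  assumes "finite A" "\<And>w. w \<in> A \<Longrightarrow> ord k (F w)"
  shows "\<exists>C\<ge>0. \<forall>w\<in>A. \<forall>\<theta>. \<bar>\<theta>\<bar> \<le> pi \<longrightarrow> norm (F w \<theta>) \<le> C * \<bar>\<theta>\<bar> ^ k"
proof -
  have "\<exists>C. \<forall>w\<in>A. \<forall>\<theta>. \<bar>\<theta>\<bar> \<le> pi \<longrightarrow> norm (F w \<theta>) \<le> C w * \<bar>\<theta>\<bar> ^ k"
    using assms(2) unfolding ord_def by (intro bchoice) auto
  then obtain C where C: "\<forall>w\<in>A. \<forall>\<theta>. \<bar>\<theta>\<bar> \<le> pi \<longrightarrow> norm (F w \<theta>) \<le> C w * \<bar>\<theta>\<bar> ^ k" ..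
  define D where "D = (\<Sum>w\<in>A. \<bar>C w\<bar>)"
  have "norm (F w \<theta>) \<le> D * \<bar>\<theta>\<bar> ^ k" if "w \<in> A" "\<bar>\<theta>\<bar> \<le> pi" for w \<theta>
  proof -
    have "norm (F w \<theta>) \<le> C w * \<bar>\<theta>\<bar> ^ k" using C that by auto
    also have "\<dots> \<le> D * \<bar>\<theta>\<bar> ^ k"
    proof (intro mult_right_mono)
      have "C w \<le> \<bar>C w\<bar>" by simp
      also have "\<dots> \<le> D" unfolding D_def using that assms(1) by (intro member_le_sum) auto
      finally show "C w \<le> D" .
    qed auto
    finally show ?thesis .
  qed
  moreover have "0 \<le> D" by (simp add: D_def)
  ultimately show ?thesis by blast
qed

lemma ord_cis:
  "ord 4 (\<lambda>\<theta>. cis (\<theta> * x) - (1 + \<i> * (\<theta> * x) - (\<theta> * x)\<^sup>2 / 2 - \<i> * (\<theta> * x) ^ 3 / 6))"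
  unfolding ord_def
proof (intro exI[of _ "\<bar>x\<bar> ^ 4 / 6"] allI impI)
  fix \<theta> :: real
  have "norm (exp (\<i> * (\<theta> * x)) - (\<Sum>i\<le>3. (\<i> * (\<theta> * x)) ^ i / fact i))
     \<le> exp \<bar>Re (\<i> * (\<theta> * x))\<bar> * norm (\<i> * (\<theta> * x)) ^ Suc 3 / fact 3"
    by (rule Taylor_exp)
  also have "\<dots> = \<bar>x\<bar> ^ 4 / 6 * \<bar>\<theta>\<bar> ^ 4"
    by (simp add: norm_mult fact_numeral power_mult_distrib abs_mult flip: of_real_mult)
  also have "(\<Sum>i\<le>3. (\<i> * (\<theta> * x)) ^ i / fact i) =
      1 + \<i> * (\<theta> * x) - (\<theta> * x)\<^sup>2 / 2 - \<i> * (\<theta> * x) ^ 3 / 6"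
    by (simp add: numeral_3_eq_3 power2_eq_square algebra_simps fact_numeral)
  finally show "norm (cis (\<theta> * x) - (1 + \<i> * (\<theta> * x) - (\<theta> * x)\<^sup>2 / 2 - \<i> * (\<theta> * x) ^ 3 / 6))
     \<le> \<bar>x\<bar> ^ 4 / 6 * \<bar>\<theta>\<bar> ^ 4"
    by (simp add: cis_conv_exp)
qed

lemma ord_exp:
  "ord 4 (\<lambda>\<theta>. exp (- complex_of_real (s * \<theta>\<^sup>2) - \<i> * complex_of_real (r * \<theta> ^ 3))
            - (1 - complex_of_real (s * \<theta>\<^sup>2) - \<i> * complex_of_real (r * \<theta> ^ 3)))"
  unfolding ord_def
proof (intro exI[of _ "exp (\<bar>s\<bar> * pi\<^sup>2) * (\<bar>s\<bar> + \<bar>r\<bar> * pi)\<^sup>2"] allI impI)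
  fix \<theta> :: real assume t: "\<bar>\<theta>\<bar> \<le> pi"
  define z where "z = - complex_of_real (s * \<theta>\<^sup>2) - \<i> * complex_of_real (r * \<theta> ^ 3)"
  have t2: "\<theta>\<^sup>2 \<le> pi\<^sup>2" using power_mono[OF t, of 2] by simp
  have "norm z \<le> norm (complex_of_real (s * \<theta>\<^sup>2)) + norm (\<i> * complex_of_real (r * \<theta> ^ 3))"
    unfolding z_def by (metis norm_minus_cancel norm_triangle_ineq4)
  also have "\<dots> = \<bar>s\<bar> * \<theta>\<^sup>2 + \<bar>r\<bar> * \<bar>\<theta>\<bar> ^ 3"
    unfolding norm_mult norm_of_real norm_ii by (simp add: abs_mult power_abs)
  also have "\<bar>\<theta>\<bar> ^ 3 = \<bar>\<theta>\<bar> * \<theta>\<^sup>2" by (simp add: power3_eq_cube power2_eq_square)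
  also have "\<bar>s\<bar> * \<theta>\<^sup>2 + \<bar>r\<bar> * (\<bar>\<theta>\<bar> * \<theta>\<^sup>2) \<le> \<bar>s\<bar> * \<theta>\<^sup>2 + \<bar>r\<bar> * (pi * \<theta>\<^sup>2)"
    using t by (intro add_left_mono mult_left_mono mult_right_mono) auto
  finally have nz: "norm z \<le> (\<bar>s\<bar> + \<bar>r\<bar> * pi) * \<theta>\<^sup>2" by (simp add: algebra_simps)
  have "norm (exp z - (\<Sum>i\<le>1. z ^ i / fact i)) \<le> exp \<bar>Re z\<bar> * norm z ^ Suc 1 / fact 1"
    by (rule Taylor_exp)
  also have "\<dots> = exp \<bar>Re z\<bar> * (norm z)\<^sup>2" by (simp add: numeral_2_eq_2)
  also have "\<dots> \<le> exp (\<bar>s\<bar> * pi\<^sup>2) * ((\<bar>s\<bar> + \<bar>r\<bar> * pi) * \<theta>\<^sup>2)\<^sup>2"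
  proof (intro mult_mono power_mono nz)
    have "\<bar>Re z\<bar> = \<bar>s\<bar> * \<theta>\<^sup>2" by (simp add: z_def abs_mult flip: of_real_power)
    then show "exp \<bar>Re z\<bar> \<le> exp (\<bar>s\<bar> * pi\<^sup>2)" using t2 by (simp add: mult_left_mono)
  qed auto
  also have "\<dots> = exp (\<bar>s\<bar> * pi\<^sup>2) * (\<bar>s\<bar> + \<bar>r\<bar> * pi)\<^sup>2 * \<bar>\<theta>\<bar> ^ 4"
    by (simp add: power_mult_distrib power_abs flip: power_mult)
  finally have *: "norm (exp z - (\<Sum>i\<le>1. z ^ i / fact i))
     \<le> exp (\<bar>s\<bar> * pi\<^sup>2) * (\<bar>s\<bar> + \<bar>r\<bar> * pi)\<^sup>2 * \<bar>\<theta>\<bar> ^ 4" .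
  show "norm (exp (- complex_of_real (s * \<theta>\<^sup>2) - \<i> * complex_of_real (r * \<theta> ^ 3)) - (1 - complex_of_real (s * \<theta>\<^sup>2) - \<i> * complex_of_real (r * \<theta> ^ 3)))
     \<le> exp (\<bar>s\<bar> * pi\<^sup>2) * (\<bar>s\<bar> + \<bar>r\<bar> * pi)\<^sup>2 * \<bar>\<theta>\<bar> ^ 4"
  proof -
    have "1 - complex_of_real (s * \<theta>\<^sup>2) - \<i> * complex_of_real (r * \<theta> ^ 3) = (\<Sum>i\<le>1. z ^ i / fact i)"
      by (simp add: z_def)
    then show ?thesis using * by (simp only: z_def)
  qed
qed

section \<open>Decay of the twisted kernel\<close>

lemma cos_half_bound:
  assumes "\<bar>\<theta>\<bar> \<le> pi"
  shows "\<theta>\<^sup>2 / 32 \<le> 1 - cos (\<theta> / 2)"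
proof -
  define y where "y = \<bar>\<theta>\<bar> / 4"
  have y: "0 \<le> y" "y \<le> pi / 3" using assms by (auto simp: y_def)
  have "sin 0 - 0 / 2 \<le> sin y - y / 2"
  proof (rule DERIV_nonneg_imp_nondecreasing[OF y(1)])
    fix x assume x: "0 \<le> x" "x \<le> y"
    have "cos (pi / 3) \<le> cos x" using x y pi_gt_zero by (intro cos_monotone_0_pi_le) auto
    then have "0 \<le> cos x - 1 / 2" by (simp add: cos_60)
    moreover have "((\<lambda>y. sin y - y / 2) has_real_derivative cos x - 1 / 2) (at x)"
      by (auto intro!: derivative_eq_intros)
    ultimately show "\<exists>l. ((\<lambda>y. sin y - y / 2) has_real_derivative l) (at x) \<and> 0 \<le> l" by blast
  qed
  then have "y / 2 \<le> sin y" by simp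
  then have "(y / 2)\<^sup>2 \<le> (sin y)\<^sup>2" using y by (intro power_mono) auto
  moreover have "cos (\<theta> / 2) = 1 - 2 * (sin y)\<^sup>2"
  proof -
    have "cos (\<theta> / 2) = cos (2 * y)" by (simp add: y_def abs_if)
    then show ?thesis by (simp add: cos_double_sin)
  qed
  moreover have "(y / 2)\<^sup>2 = \<theta>\<^sup>2 / 64" by (simp add: y_def power_divide)
  ultimately show ?thesis by simp
qed

lemma norm_one_plus_cis:
  assumes "\<bar>\<theta>\<bar> \<le> pi"
  shows "norm (1 + cis \<theta>) = 2 * cos (\<theta> / 2)"
proof -
  have "1 + cis \<theta> = complex_of_real (2 * cos (\<theta> / 2)) * cis (\<theta> / 2)"
    using cos_double_cos[of "\<theta> / 2"] sin_double[of "\<theta> / 2"]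
    by (auto simp: complex_eq_iff power2_eq_square)
  moreover have "0 \<le> cos (\<theta> / 2)" using assms by (intro cos_ge_zero) auto
  ultimately show ?thesis by (simp add: norm_mult)
qed

lemma norm_cis_minus_one: "norm (cis x - 1) \<le> \<bar>x\<bar>"
proof -
  have "norm (exp (\<i> * x) - (\<Sum>i\<le>0. (\<i> * x) ^ i / fact i)) \<le> exp \<bar>Re (\<i> * x)\<bar> * norm (\<i> * x) ^ Suc 0 / fact 0"
    by (rule Taylor_exp)
  then show ?thesis by (simp add: cis_conv_exp norm_mult)
qed

locale aperiodic_words = two_words +
  assumes not_rev: "b \<noteq> rev a" and not_conj: "b \<noteq> map Not a"
begin

lemma p_pos: "0 < p"
  using aperiodic[OF not_rev not_conj] p_pos_if by blast

lemma half_var_pos: "0 < half_var"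
  using p_pos q_pos by (simp add: half_var_def)

definition twist :: "real \<Rightarrow> (bool list \<Rightarrow> complex) \<Rightarrow> bool list \<Rightarrow> complex" where
  "twist \<theta> = weighted (\<lambda>w. cis (\<theta> * fr w))"

lemma path_weight_cis: "path_weight (\<lambda>w. cis (\<theta> * fr w)) w s = cis (\<theta> * path_sum f w s)"
  by (induction s arbitrary: w) (auto simp: cis_mult algebra_simps)

lemma twist_path: "(twist \<theta> ^^ n) h w = (\<Sum>s\<in>words n. cis (\<theta> * path_sum f w s) * h (slide w s)) / 2 ^ n"
  unfolding twist_def path_expansion path_weight_cis ..

lemma twist_pow_le:
  assumes "\<And>w. w \<in> W \<Longrightarrow> norm (h w) \<le> B" "w \<in> W"
  shows "norm ((twist \<theta> ^^ n) h w) \<le> B"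
proof -
  have "norm (\<Sum>s\<in>words n. cis (\<theta> * path_sum f w s) * h (slide w s)) \<le> of_nat (card (words n)) * B"
    using assms by (intro sum_norm_bound) (simp add: norm_mult slide_in_words[OF L_pos])
  then show ?thesis unfolding twist_path by (simp add: norm_divide norm_power field_simps)
qed

definition decay_bound :: "real \<Rightarrow> real \<Rightarrow> bool" where
  "decay_bound C c \<longleftrightarrow> (\<forall>\<theta> n h B w. \<bar>\<theta>\<bar> \<le> pi \<longrightarrow> (\<forall>w\<in>W. norm (h w) \<le> B) \<longrightarrow> w \<in> W \<longrightarrow>
     norm ((twist \<theta> ^^ n) h w) \<le> C * exp (- c * n * \<theta>\<^sup>2) * B)"

lemma decay_boundD:
  assumes "decay_bound C c" "\<bar>\<theta>\<bar> \<le> pi" "\<And>w. w \<in> W \<Longrightarrow> norm (h w) \<le> B" "w \<in> W"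
  shows "norm ((twist \<theta> ^^ n) h w) \<le> C * exp (- c * n * \<theta>\<^sup>2) * B"
  using assms unfolding decay_bound_def by blast

text \<open>Among the paths of length \<open>N\<close>, two have the same endpoint and phases that differ by \<open>cis \<theta>\<close>; together they
  contribute at most \<open>2 cos (\<theta> / 2)\<close> instead of \<open>2\<close>, a loss of order \<open>\<theta>\<^sup>2\<close>. Iterating over blocks of
  length \<open>N\<close> gives the decay.\<close>

lemma twist_decay: "\<exists>C c. 1 \<le> C \<and> 0 < c \<and> c \<le> half_var \<and> decay_bound C c"
proof -
  obtain N s s' where ss: "s \<in> words N" "s' \<in> words N"
    "\<And>w. w \<in> W \<Longrightarrow> slide w s = slide w s' \<and> path_sum f w s' = path_sum f w s + 1"
    using aperiodic[OF not_rev not_conj] by blast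
  have ne: "s \<noteq> s'" using ss(3)[OF a_in] by auto
  then have N: "0 < N" using ss(1,2) by (cases N) auto
  \<comment> \<open>The loss per block is \<open>\<theta>\<^sup>2 / (16 \<cdot> 2\<^sup>N)\<close>; the rate is spread over the \<open>N\<close> steps of the block.\<close>
  define c0 :: real where "c0 = 1 / (16 * 2 ^ N * N)"
  define c where "c = min c0 half_var"
  have c: "0 < c" "c \<le> half_var" "c \<le> c0" using N half_var_pos by (auto simp: c_def c0_def)
  have block: "norm ((twist \<theta> ^^ N) h w) \<le> exp (- c * N * \<theta>\<^sup>2) * B"
    if t: "\<bar>\<theta>\<bar> \<le> pi" and h: "\<forall>w\<in>W. norm (h w) \<le> B" and w: "w \<in> W" for \<theta> h B w
  proof -
    define T where "T u = cis (\<theta> * path_sum f w u) * h (slide w u)" for u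
    have nT: "norm (T u) \<le> B" for u
      using h slide_in_words[OF L_pos w] by (simp add: T_def norm_mult)
    have B: "0 \<le> B" using norm_ge_zero nT order_trans by blast
    have "T s + T s' = (cis (\<theta> * path_sum f w s) * h (slide w s)) * (1 + cis \<theta>)"
      using ss(3)[OF w] by (simp add: T_def algebra_simps cis_mult)
    then have "norm (T s + T s') = norm (h (slide w s)) * (2 * cos (\<theta> / 2))"
      by (simp add: norm_mult norm_one_plus_cis[OF t])
    also have "\<dots> \<le> B * (2 * cos (\<theta> / 2))"
      using h slide_in_words[OF L_pos w] t by (intro mult_right_mono) (auto intro!: cos_ge_zero)
    also have "\<dots> \<le> B * (2 - \<theta>\<^sup>2 / 16)"
      using cos_half_bound[OF t] B by (intro mult_left_mono) auto
    finally have pair: "norm (T s + T s') \<le> B * (2 - \<theta>\<^sup>2 / 16)" .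
    have "card (words N - {s} - {s'}) = 2 ^ N - 2" using ss(1,2) ne by (simp add: card_Diff_singleton_if)
    moreover have "(2::nat) ^ 1 \<le> 2 ^ N" using N by (intro power_increasing) auto
    ultimately have "norm (\<Sum>u\<in>words N - {s} - {s'}. T u) \<le> (2 ^ N - 2) * B"
      using sum_norm_bound[of "words N - {s} - {s'}" T B] nT by (simp add: of_nat_diff)
    moreover have "(\<Sum>u\<in>words N. T u) = (T s + T s') + (\<Sum>u\<in>words N - {s} - {s'}. T u)"
      using ss(1,2) ne by (simp add: sum.remove[of "words N" s] sum.remove[of "words N - {s}" s'])
    ultimately have "norm (\<Sum>u\<in>words N. T u) \<le> B * (2 - \<theta>\<^sup>2 / 16) + (2 ^ N - 2) * B"
      using norm_triangle_mono[OF pair, of "\<Sum>u\<in>words N - {s} - {s'}. T u"] by simp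
    then have "norm ((twist \<theta> ^^ N) h w) \<le> (1 - \<theta>\<^sup>2 / 16 / 2 ^ N) * B"
      unfolding twist_path T_def[symmetric] by (simp add: norm_divide norm_power field_simps)
    also have "\<dots> \<le> exp (- c * N * \<theta>\<^sup>2) * B"
    proof (intro mult_right_mono B)
      have "c * N * \<theta>\<^sup>2 \<le> c0 * N * \<theta>\<^sup>2" using c by (intro mult_right_mono) auto
      also have "\<dots> = \<theta>\<^sup>2 / 16 / 2 ^ N" using N by (simp add: c0_def)
      finally show "1 - \<theta>\<^sup>2 / 16 / 2 ^ N \<le> exp (- c * N * \<theta>\<^sup>2)"
        using exp_ge_add_one_self[of "- c * N * \<theta>\<^sup>2"] by simp
    qed
    finally show ?thesis .
  qed
  have blocks: "norm ((twist \<theta> ^^ (N * k)) h w) \<le> exp (- c * N * \<theta>\<^sup>2) ^ k * B"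
    if t: "\<bar>\<theta>\<bar> \<le> pi" and h: "\<forall>w\<in>W. norm (h w) \<le> B" and w: "w \<in> W" for \<theta> h B w k
    using w
  proof (induction k arbitrary: w)
    case (Suc k)
    have "(twist \<theta> ^^ (N * Suc k)) h w = (twist \<theta> ^^ N) ((twist \<theta> ^^ (N * k)) h) w"
      by (simp add: funpow_add)
    then show ?case
      using block[OF t, of "(twist \<theta> ^^ (N * k)) h" "exp (- c * N * \<theta>\<^sup>2) ^ k * B" w] Suc by simp
  qed (use h in simp)
  define C where "C = exp (c * N * pi\<^sup>2)"
  have "norm ((twist \<theta> ^^ n) h w) \<le> C * exp (- c * n * \<theta>\<^sup>2) * B"
    if t: "\<bar>\<theta>\<bar> \<le> pi" and h: "\<forall>w\<in>W. norm (h w) \<le> B" and w: "w \<in> W" for \<theta> n h B w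
  proof -
    define k where "k = n div N"
    have n: "n = n mod N + N * k" by (simp add: k_def)
    have nr: "real n = real (n mod N) + real N * real k" by (subst n) simp
    have "(twist \<theta> ^^ n) h w = (twist \<theta> ^^ (n mod N)) ((twist \<theta> ^^ (N * k)) h) w"
      by (subst n) (simp add: funpow_add)
    then have "norm ((twist \<theta> ^^ n) h w) \<le> exp (- c * N * \<theta>\<^sup>2) ^ k * B"
      using twist_pow_le[of "(twist \<theta> ^^ (N * k)) h"] blocks[OF t h] w by simp
    also have "\<dots> \<le> (C * exp (- c * n * \<theta>\<^sup>2)) * B"
    proof (intro mult_right_mono)
      have "real (n mod N) \<le> real N" using N by (simp add: less_imp_le)
      then have "c * (real (n mod N) * \<theta>\<^sup>2) \<le> c * (N * pi\<^sup>2)"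
        using c power_mono[OF t, of 2] by (intro mult_left_mono mult_mono) auto
      then show "exp (- c * N * \<theta>\<^sup>2) ^ k \<le> C * exp (- c * n * \<theta>\<^sup>2)"
        unfolding C_def exp_of_nat_mult[symmetric] exp_add[symmetric] nr
        by (simp add: algebra_simps)
      show "0 \<le> B" using h a_in norm_ge_zero order_trans by blast
    qed
    finally show ?thesis .
  qed
  then have "decay_bound C c" unfolding decay_bound_def by blast
  moreover have "1 \<le> C" using c by (simp add: C_def)
  ultimately show ?thesis using c by blast
qed

text \<open>The rate is capped by \<open>half_var\<close> so that it also bounds the decay of the powers of the approximate eigenvalue.\<close>

definition rate :: real where
  "rate = (SOME c. \<exists>C. 1 \<le> C \<and> 0 < c \<and> c \<le> half_var \<and> decay_bound C c)"

lemma rate: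
  obtains C where "1 \<le> C" "decay_bound C rate"
  and "0 < rate" "rate \<le> half_var"
proof -
  have "\<exists>c C. 1 \<le> C \<and> 0 < c \<and> c \<le> half_var \<and> decay_bound C c"
    using twist_decay by blast
  from someI_ex[OF this] show thesis unfolding rate_def[symmetric] using that by blast
qed

abbreviation gauss :: "nat \<Rightarrow> real \<Rightarrow> real" where
  "gauss n \<theta> \<equiv> exp (- rate * real n * \<theta>\<^sup>2)"

lemma rate_pos: "0 < rate" and rate_le: "rate \<le> half_var"
  using rate by blast+

definition centered_bound :: "real \<Rightarrow> bool" where
  "centered_bound C \<longleftrightarrow> (\<forall>\<theta> n h B w. \<bar>\<theta>\<bar> \<le> pi \<longrightarrow> (\<forall>w\<in>W. norm (h w) \<le> B) \<longrightarrow> mean L h = 0 \<longrightarrow> w \<in> W \<longrightarrow>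
     norm ((twist \<theta> ^^ n) h w) \<le> C * (\<bar>\<theta>\<bar> + of_bool (n < L)) * gauss n \<theta> * B)"

lemma centered_boundD:
  assumes "centered_bound C" "\<bar>\<theta>\<bar> \<le> pi" "\<forall>w\<in>W. norm (h w) \<le> B" "mean L h = 0" "w \<in> W"
  shows "norm ((twist \<theta> ^^ n) h w) \<le> C * (\<bar>\<theta>\<bar> + of_bool (n < L)) * gauss n \<theta> * B"
  using assms unfolding centered_bound_def by blast

text \<open>A function with mean zero is annihilated by \<open>L\<close> steps of the untwisted kernel, and twisting
  changes these steps only by \<open>O(\<theta>)\<close>. This gains a factor \<open>\<bar>\<theta>\<bar>\<close> after time \<open>L\<close>.\<close>

lemma twist_decay_centered: "\<exists>C\<ge>0. centered_bound C"
proof -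
  obtain C where C: "1 \<le> C" and dec0: "decay_bound C rate"
    by (rule rate)
  note dec = decay_boundD[OF dec0]
  define D where "D = C * (1 + L * exp (rate * L * pi\<^sup>2))"
  have D: "C \<le> D" "C * L * exp (rate * L * pi\<^sup>2) \<le> D" using C by (auto simp: D_def algebra_simps)
  have path_le: "\<bar>path_sum f w s\<bar> \<le> length s" for w s
  proof (induction s arbitrary: w)
    case (Cons c s)
    have "\<bar>f (shift w c)\<bar> \<le> 1" by (auto simp: score_def)
    then show ?case using Cons[of "shift w c"] by simp
  qed simp
  have small: "norm ((twist \<theta> ^^ L) h w) \<le> L * \<bar>\<theta>\<bar> * B"
    if h: "\<forall>w\<in>W. norm (h w) \<le> B" and m: "mean L h = 0" and w: "w \<in> W" for \<theta> :: real and h B w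
  proof -
    have "(\<Sum>s\<in>W. h s) = 0" using m by (simp add: mean_def)
    then have "(twist \<theta> ^^ L) h w = (\<Sum>s\<in>W. (cis (\<theta> * path_sum f w s) - 1) * h s) / 2 ^ L"
      unfolding twist_path using slide_full[OF L_pos w] by (simp add: algebra_simps sum_subtractf)
    moreover have "norm (\<Sum>s\<in>W. (cis (\<theta> * path_sum f w s) - 1) * h s) \<le> of_nat (card W) * (L * \<bar>\<theta>\<bar> * B)"
    proof (rule sum_norm_bound)
      fix s assume s: "s \<in> W"
      have "norm (cis (\<theta> * path_sum f w s) - 1) \<le> \<bar>\<theta>\<bar> * \<bar>real_of_int (path_sum f w s)\<bar>"
        using norm_cis_minus_one[of "\<theta> * path_sum f w s"] by (simp add: abs_mult)
      also have "\<dots> \<le> \<bar>\<theta>\<bar> * L"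
        using path_le[of w s] s by (intro mult_left_mono) (auto simp: words_def)
      finally show "norm ((cis (\<theta> * path_sum f w s) - 1) * h s) \<le> L * \<bar>\<theta>\<bar> * B"
        unfolding norm_mult using h s by (intro mult_mono) (auto simp: mult.commute)
    qed
    ultimately show ?thesis by (simp add: norm_divide norm_power divide_le_eq mult_ac)
  qed
  have "norm ((twist \<theta> ^^ n) h w) \<le> D * (\<bar>\<theta>\<bar> + of_bool (n < L)) * gauss n \<theta> * B"
    if t: "\<bar>\<theta>\<bar> \<le> pi" and h: "\<forall>w\<in>W. norm (h w) \<le> B" and m: "mean L h = 0" and w: "w \<in> W" for \<theta> n h B w
  proof -
    have B: "0 \<le> B" using h a_in norm_ge_zero order_trans by blast
    show ?thesis
    proof (cases "n < L")
      case True
      have "norm ((twist \<theta> ^^ n) h w) \<le> C * gauss n \<theta> * B"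
        using dec[OF t, of h B w n] h w by simp
      also have "\<dots> \<le> D * (\<bar>\<theta>\<bar> + 1) * gauss n \<theta> * B"
      proof (intro mult_right_mono B)
        show "C \<le> D * (\<bar>\<theta>\<bar> + 1)"
          using D(1) C by (intro order_trans[OF D(1) order_trans[OF eq_refl mult_left_mono[of 1 "\<bar>\<theta>\<bar> + 1" D]]]) auto
      qed auto
      finally show ?thesis using True by simp
    next
      case False
      then obtain j where n: "n = j + L" by (metis add.commute le_Suc_ex not_less)
      have "(twist \<theta> ^^ n) h w = (twist \<theta> ^^ j) ((twist \<theta> ^^ L) h) w" by (simp add: n funpow_add)
      then have "norm ((twist \<theta> ^^ n) h w) \<le> C * exp (- rate * j * \<theta>\<^sup>2) * (L * \<bar>\<theta>\<bar> * B)"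
        using dec[OF t, of "(twist \<theta> ^^ L) h" "L * \<bar>\<theta>\<bar> * B" w j] small[OF h m] w by simp
      also have "exp (- rate * j * \<theta>\<^sup>2) = exp (rate * L * \<theta>\<^sup>2) * gauss n \<theta>"
        unfolding exp_add[symmetric] n by (simp add: algebra_simps)
      also have "C * (exp (rate * L * \<theta>\<^sup>2) * gauss n \<theta>) * (L * \<bar>\<theta>\<bar> * B)
         = (C * L * exp (rate * L * \<theta>\<^sup>2)) * (\<bar>\<theta>\<bar> * gauss n \<theta> * B)"
        by simp
      also have "\<dots> \<le> D * (\<bar>\<theta>\<bar> * gauss n \<theta> * B)"
      proof (intro mult_right_mono)
        have "rate * L * \<theta>\<^sup>2 \<le> rate * L * pi\<^sup>2"
          using rate_pos power_mono[OF t, of 2] by (intro mult_left_mono) auto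
        then have "C * L * exp (rate * L * \<theta>\<^sup>2) \<le> C * L * exp (rate * L * pi\<^sup>2)"
          using C by (intro mult_left_mono) auto
        then show "C * L * exp (rate * L * \<theta>\<^sup>2) \<le> D" using D(2) by linarith
      qed (use B in auto)
      finally show ?thesis using False by (simp add: mult_ac)
    qed
  qed
  then have "centered_bound D" unfolding centered_bound_def by blast
  moreover have "0 \<le> D" using C D(1) by linarith
  ultimately show ?thesis by blast
qed

end

section \<open>The leading eigenvalue to third order\<close>

context aperiodic_words
begin

text \<open>The eigenvalue is needed up to \<open>O(\<theta>\<^sup>4)\<close> only; the exponential form has powers that are
  explicit.\<close>

definition eigval :: "real \<Rightarrow> complex" where
  "eigval \<theta> = exp (- complex_of_real (half_var * \<theta>\<^sup>2) - \<i> * complex_of_real (cumulant3 * \<theta> ^ 3))"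

definition eigvec :: "real \<Rightarrow> bool list \<Rightarrow> complex" where
  "eigvec \<theta> w = 1 + (\<i> * corr1 w) * of_real \<theta> ^ 1 - corr2 w * of_real \<theta> ^ 2"

lemma ord_eigvec: "ord 0 (\<lambda>\<theta>. eigvec \<theta> w)"
proof -
  have "ord 0 (\<lambda>\<theta>. 1 + (\<i> * corr1 w) * of_real \<theta> ^ 1 + (- complex_of_real (corr2 w)) * of_real \<theta> ^ 2)"
    by (intro ord_add ord_monomial ord_const) auto
  then show ?thesis by (simp add: eigvec_def[abs_def])
qed

text \<open>The third-degree Taylor polynomials, written so that averaging over the two next letters averages the coefficients.\<close>

definition cubic :: "real \<Rightarrow> real \<Rightarrow> real \<Rightarrow> real \<Rightarrow> complex" where
  "cubic c1 c2 c3 \<theta> = 1 + \<i> * c1 * \<theta> - c2 * \<theta> ^ 2 - \<i> * c3 * \<theta> ^ 3"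

lemma ord_cis_eigvec:
  "ord 4 (\<lambda>\<theta>. cis (\<theta> * x) * eigvec \<theta> u
      - cubic (x + corr1 u) (x\<^sup>2 / 2 + x * corr1 u + corr2 u) (x ^ 3 / 6 + x\<^sup>2 * corr1 u / 2 + x * corr2 u) \<theta>)"
proof -
  have "ord 4 (\<lambda>\<theta>. (cis (\<theta> * x) - (1 + \<i> * (\<theta> * x) - (\<theta> * x)\<^sup>2 / 2 - \<i> * (\<theta> * x) ^ 3 / 6)) * eigvec \<theta> u
     + complex_of_real (x\<^sup>2 * corr2 u / 2 + x ^ 3 * corr1 u / 6) * of_real \<theta> ^ 4
     + (\<i> * complex_of_real (x ^ 3 * corr2 u / 6)) * of_real \<theta> ^ 5)"
    using ord_mult[OF ord_cis[of x] ord_eigvec[of u]]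
    by (intro ord_add ord_monomial) auto
  also have "(\<lambda>\<theta>. (cis (\<theta> * x) - (1 + \<i> * (\<theta> * x) - (\<theta> * x)\<^sup>2 / 2 - \<i> * (\<theta> * x) ^ 3 / 6)) * eigvec \<theta> u
     + complex_of_real (x\<^sup>2 * corr2 u / 2 + x ^ 3 * corr1 u / 6) * of_real \<theta> ^ 4
     + (\<i> * complex_of_real (x ^ 3 * corr2 u / 6)) * of_real \<theta> ^ 5) =
     (\<lambda>\<theta>. cis (\<theta> * x) * eigvec \<theta> u
      - cubic (x + corr1 u) (x\<^sup>2 / 2 + x * corr1 u + corr2 u) (x ^ 3 / 6 + x\<^sup>2 * corr1 u / 2 + x * corr2 u) \<theta>)"
    by (rule ext) (simp add: eigvec_def cubic_def field_simps eval_nat_numeral)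
  finally show ?thesis .
qed

lemma ord_eigval_eigvec:
  "ord 4 (\<lambda>\<theta>. eigval \<theta> * eigvec \<theta> w - cubic (corr1 w) (half_var + corr2 w) (cumulant3 + half_var * corr1 w) \<theta>)"
proof -
  have "ord 4 (\<lambda>\<theta>. (eigval \<theta> - (1 - complex_of_real (half_var * \<theta>\<^sup>2) - \<i> * complex_of_real (cumulant3 * \<theta> ^ 3))) * eigvec \<theta> w
     + complex_of_real (half_var * corr2 w + cumulant3 * corr1 w) * of_real \<theta> ^ 4
     + (\<i> * complex_of_real (cumulant3 * corr2 w)) * of_real \<theta> ^ 5)"
    using ord_mult[OF ord_exp[of half_var cumulant3] ord_eigvec[of w]] unfolding eigval_def
    by (intro ord_add ord_monomial) auto
  also have "(\<lambda>\<theta>. (eigval \<theta> - (1 - complex_of_real (half_var * \<theta>\<^sup>2) - \<i> * complex_of_real (cumulant3 * \<theta> ^ 3))) * eigvec \<theta> w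
     + complex_of_real (half_var * corr2 w + cumulant3 * corr1 w) * of_real \<theta> ^ 4
     + (\<i> * complex_of_real (cumulant3 * corr2 w)) * of_real \<theta> ^ 5) =
     (\<lambda>\<theta>. eigval \<theta> * eigvec \<theta> w - cubic (corr1 w) (half_var + corr2 w) (cumulant3 + half_var * corr1 w) \<theta>)"
    by (rule ext) (simp add: eigvec_def cubic_def field_simps eval_nat_numeral)
  finally show ?thesis .
qed

text \<open>The corrector equations cancel the orders one and two, and leave the cubic defect at order three.\<close>

lemma residual:
  assumes "w \<in> W"
  shows "ord 4 (\<lambda>\<theta>. twist \<theta> (eigvec \<theta>) w - eigval \<theta> * eigvec \<theta> w + \<i> * of_real \<theta> ^ 3 * of_real (cubic_defect w))"
proof -
  define c1 where "c1 u = fr u + corr1 u" for u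
  define c2 where "c2 u = (fr u)\<^sup>2 / 2 + fr u * corr1 u + corr2 u" for u
  define c3 where "c3 u = fr u ^ 3 / 6 + (fr u)\<^sup>2 * corr1 u / 2 + fr u * corr2 u" for u
  define E where "E u \<theta> = cis (\<theta> * fr u) * eigvec \<theta> u - cubic (c1 u) (c2 u) (c3 u) \<theta>" for u \<theta>
  have E: "ord 4 (E u)" for u
    using ord_cis_eigvec[of "fr u" u] unfolding E_def c1_def c2_def c3_def .
  let ?u = "shift w False" and ?t = "shift w True"
  have k1: "c1 ?u = 2 * corr1 w - c1 ?t"
    using corrector_order1[OF assms] by (simp add: next_mean_def c1_def field_simps)
  have k2: "c2 ?u = 2 * (half_var + corr2 w) - c2 ?t"
    using corrector_order2[OF assms] unfolding next_mean_def c2_def[symmetric] by (simp add: field_simps)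
  have k3: "c3 ?u = 2 * (cubic_defect w + cumulant3 + half_var * corr1 w) - c3 ?t"
    unfolding cubic_defect_def next_mean_def c3_def[symmetric] by (simp add: field_simps)
  have "ord 4 (\<lambda>\<theta>. (1/2) * (E ?u \<theta> + E ?t \<theta>)
      + (-1) * (eigval \<theta> * eigvec \<theta> w - cubic (corr1 w) (half_var + corr2 w) (cumulant3 + half_var * corr1 w) \<theta>))"
    using ord_mult[OF ord_const[of "1/2"] ord_add[OF E[of ?u] E[of ?t]]]
      ord_mult[OF ord_const[of "-1"] ord_eigval_eigvec[of w]] by (intro ord_add) auto
  also have "(\<lambda>\<theta>. (1/2) * (E ?u \<theta> + E ?t \<theta>)
      + (-1) * (eigval \<theta> * eigvec \<theta> w - cubic (corr1 w) (half_var + corr2 w) (cumulant3 + half_var * corr1 w) \<theta>)) =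
    (\<lambda>\<theta>. twist \<theta> (eigvec \<theta>) w - eigval \<theta> * eigvec \<theta> w + \<i> * of_real \<theta> ^ 3 * of_real (cubic_defect w))"
    unfolding twist_def weighted_def next_mean_def E_def cubic_def k1 k2 k3
    by (rule ext) (simp add: field_simps)
  finally show ?thesis .
qed

lemma finite_bound: "\<exists>B\<ge>0. \<forall>w\<in>W. norm (h w) \<le> (B::real)"
proof -
  have "norm (h w) \<le> (\<Sum>w\<in>W. norm (h w))" if "w \<in> W" for w
    using that by (intro member_le_sum) auto
  then show ?thesis by (intro exI[of _ "\<Sum>w\<in>W. norm (h w)"]) (auto intro: sum_nonneg)
qed

lemma mean_of_real: "mean L (\<lambda>w. complex_of_real (h w)) = of_real (mean L h)"
  by (simp add: mean_def)

lemma twist_pow_linear: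
  "(twist \<theta> ^^ n) (\<lambda>w. g w - c * h w) w = (twist \<theta> ^^ n) g w - c * (twist \<theta> ^^ n) h w"
  unfolding twist_def weighted_pow_diff weighted_pow_mult ..

lemma twist_pow_mult: "(twist \<theta> ^^ n) (\<lambda>w. c * h w) w = c * (twist \<theta> ^^ n) h w"
  unfolding twist_def weighted_pow_mult ..

lemma twist_pow_residual:
  "\<exists>C\<ge>0. \<forall>(\<theta>::real) n w. \<bar>\<theta>\<bar> \<le> pi \<longrightarrow> w \<in> W \<longrightarrow>
    norm ((twist \<theta> ^^ n) (\<lambda>w. twist \<theta> (eigvec \<theta>) w - eigval \<theta> * eigvec \<theta> w) w)
     \<le> C * (\<theta> ^ 4 + of_bool (n < L) * \<bar>\<theta>\<bar> ^ 3) * gauss n \<theta>"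
proof -
  obtain C where C: "1 \<le> C" and dec0: "decay_bound C rate"
    by (rule rate)
  note dec = decay_boundD[OF dec0]
  obtain D where D: "0 \<le> D" and cen0: "centered_bound D"
    using twist_decay_centered by blast
  note cen = centered_boundD[OF cen0]
  obtain H where H: "0 \<le> H" "\<forall>w\<in>W. norm (complex_of_real (cubic_defect w)) \<le> H"
    using finite_bound[of "\<lambda>w. complex_of_real (cubic_defect w)"] by metis
  define r where "r \<theta> w = twist \<theta> (eigvec \<theta>) w - eigval \<theta> * eigvec \<theta> w + \<i> * of_real \<theta> ^ 3 * of_real (cubic_defect w)" for \<theta> w
  obtain R where R: "0 \<le> R" "\<forall>w\<in>W. \<forall>(\<theta>::real). \<bar>\<theta>\<bar> \<le> pi \<longrightarrow> norm (r \<theta> w) \<le> R * \<bar>\<theta>\<bar> ^ 4"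
    using ord_uniform[of W 4 "\<lambda>w \<theta>. r \<theta> w", OF finite_words] residual unfolding r_def by blast
  have "norm ((twist \<theta> ^^ n) (\<lambda>w. twist \<theta> (eigvec \<theta>) w - eigval \<theta> * eigvec \<theta> w) w)
     \<le> (C * R + D * H) * (\<theta> ^ 4 + of_bool (n < L) * \<bar>\<theta>\<bar> ^ 3) * gauss n \<theta>"
    if t: "\<bar>\<theta>\<bar> \<le> pi" and w: "w \<in> W" for \<theta> :: real and n w
  proof -
    have "(\<lambda>w. twist \<theta> (eigvec \<theta>) w - eigval \<theta> * eigvec \<theta> w) = (\<lambda>w. r \<theta> w - (\<i> * of_real \<theta> ^ 3) * of_real (cubic_defect w))"
      by (simp add: r_def)
    then have "(twist \<theta> ^^ n) (\<lambda>w. twist \<theta> (eigvec \<theta>) w - eigval \<theta> * eigvec \<theta> w) w =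
       (twist \<theta> ^^ n) (r \<theta>) w - (\<i> * of_real \<theta> ^ 3) * (twist \<theta> ^^ n) (\<lambda>w. of_real (cubic_defect w)) w"
      by (simp only: twist_pow_linear)
    then have "norm ((twist \<theta> ^^ n) (\<lambda>w. twist \<theta> (eigvec \<theta>) w - eigval \<theta> * eigvec \<theta> w) w)
       \<le> norm ((twist \<theta> ^^ n) (r \<theta>) w) + \<bar>\<theta>\<bar> ^ 3 * norm ((twist \<theta> ^^ n) (\<lambda>w. of_real (cubic_defect w)) w)"
      by (simp add: norm_mult norm_power order_trans[OF norm_triangle_ineq4])
    also have "\<dots> \<le> C * gauss n \<theta> * (R * \<bar>\<theta>\<bar> ^ 4)
        + \<bar>\<theta>\<bar> ^ 3 * (D * (\<bar>\<theta>\<bar> + of_bool (n < L)) * gauss n \<theta> * H)"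
      using R t w H mean_cubic_defect
      by (intro add_mono mult_left_mono dec cen) (auto simp: mean_of_real)
    also have "\<dots> = (C * R * \<theta> ^ 4 + D * H * (\<theta> ^ 4 + of_bool (n < L) * \<bar>\<theta>\<bar> ^ 3)) * gauss n \<theta>"
      by (cases "0 \<le> \<theta>") (auto simp: algebra_simps eval_nat_numeral)
    also have "\<dots> \<le> ((C * R + D * H) * (\<theta> ^ 4 + of_bool (n < L) * \<bar>\<theta>\<bar> ^ 3)) * gauss n \<theta>"
      using C R by (intro mult_right_mono) (auto simp: distrib_right distrib_left)
    finally show ?thesis .
  qed
  moreover have "0 \<le> C * R + D * H" using C D H R by auto
  ultimately show ?thesis by blast
qed

lemma norm_eigval: "norm (eigval \<theta>) = exp (- half_var * \<theta>\<^sup>2)"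
  by (simp add: eigval_def flip: of_real_power)

lemma norm_eigval_pow_le: "norm (eigval \<theta> ^ n) \<le> gauss n \<theta>"
proof -
  have "norm (eigval \<theta> ^ n) = exp (- half_var * n * \<theta>\<^sup>2)"
    by (simp add: norm_power norm_eigval exp_of_nat_mult[symmetric] mult_ac)
  moreover have "rate * (n * \<theta>\<^sup>2) \<le> half_var * (n * \<theta>\<^sup>2)"
    using rate_le by (intro mult_right_mono) auto
  ultimately show ?thesis by (simp add: mult.assoc)
qed

text \<open>The difference of the two powers is a telescoping sum of \<open>n\<close> residuals, each decaying at the common
  rate. The cubic defect has mean zero, so it costs only \<open>\<theta>\<^sup>4\<close> per step, except for the first \<open>L\<close> steps;
  these give the term \<open>\<bar>\<theta>\<bar>\<^sup>3\<close>.\<close>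

lemma twist_pow_eigvec:
  "\<exists>C\<ge>0. \<forall>(\<theta>::real) n w. \<bar>\<theta>\<bar> \<le> pi \<longrightarrow> w \<in> W \<longrightarrow>
    norm ((twist \<theta> ^^ n) (eigvec \<theta>) w - eigval \<theta> ^ n * eigvec \<theta> w)
     \<le> C * (n * \<theta> ^ 4 + \<bar>\<theta>\<bar> ^ 3) * gauss n \<theta>"
proof -
  obtain C where C: "0 \<le> C" and res: "\<And>(\<theta>::real) n w. \<bar>\<theta>\<bar> \<le> pi \<Longrightarrow> w \<in> W \<Longrightarrow>
    norm ((twist \<theta> ^^ n) (\<lambda>w. twist \<theta> (eigvec \<theta>) w - eigval \<theta> * eigvec \<theta> w) w)
     \<le> C * (\<theta> ^ 4 + of_bool (n < L) * \<bar>\<theta>\<bar> ^ 3) * gauss n \<theta>"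
    using twist_pow_residual by blast
  define D where "D = C * exp (rate * pi\<^sup>2)"
  have "norm ((twist \<theta> ^^ n) (eigvec \<theta>) w - eigval \<theta> ^ n * eigvec \<theta> w)
     \<le> D * (n * \<theta> ^ 4 + min n L * \<bar>\<theta>\<bar> ^ 3) * gauss n \<theta>"
    if t: "\<bar>\<theta>\<bar> \<le> pi" and w: "w \<in> W" for \<theta> :: real and n w
  proof (induction n)
    case (Suc n)
    define E where "E = (twist \<theta> ^^ n) (eigvec \<theta>) w - eigval \<theta> ^ n * eigvec \<theta> w"
    define \<rho> where "\<rho> = (twist \<theta> ^^ n) (\<lambda>w. twist \<theta> (eigvec \<theta>) w - eigval \<theta> * eigvec \<theta> w) w"
    have "(twist \<theta> ^^ Suc n) (eigvec \<theta>) w = (twist \<theta> ^^ n) (twist \<theta> (eigvec \<theta>)) w"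
      by (simp only: funpow_Suc_right o_apply)
    also have "\<dots> = \<rho> + eigval \<theta> * (twist \<theta> ^^ n) (eigvec \<theta>) w"
      unfolding \<rho>_def twist_pow_linear by simp
    finally have "(twist \<theta> ^^ Suc n) (eigvec \<theta>) w - eigval \<theta> ^ Suc n * eigvec \<theta> w = eigval \<theta> * E + \<rho>"
      by (simp add: E_def algebra_simps)
    then have "norm ((twist \<theta> ^^ Suc n) (eigvec \<theta>) w - eigval \<theta> ^ Suc n * eigvec \<theta> w) \<le> norm (eigval \<theta>) * norm E + norm \<rho>"
      using norm_triangle_ineq[of "eigval \<theta> * E" \<rho>] by (simp add: norm_mult)
    also have "\<dots> \<le> exp (- rate * \<theta>\<^sup>2) * (D * (n * \<theta> ^ 4 + min n L * \<bar>\<theta>\<bar> ^ 3) * gauss n \<theta>)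
       + D * (\<theta> ^ 4 + of_bool (n < L) * \<bar>\<theta>\<bar> ^ 3) * (exp (- rate * \<theta>\<^sup>2) * gauss n \<theta>)"
    proof (intro add_mono mult_mono)
      show "norm (eigval \<theta>) \<le> exp (- rate * \<theta>\<^sup>2)" using norm_eigval_pow_le[of \<theta> 1] by simp
      show "norm E \<le> D * (n * \<theta> ^ 4 + min n L * \<bar>\<theta>\<bar> ^ 3) * gauss n \<theta>"
        using Suc by (simp add: E_def)
      have "norm \<rho> \<le> C * (\<theta> ^ 4 + of_bool (n < L) * \<bar>\<theta>\<bar> ^ 3) * gauss n \<theta>"
        unfolding \<rho>_def by (rule res[OF t w])
      also have "C \<le> D * exp (- rate * \<theta>\<^sup>2)"
      proof -
        have "rate * \<theta>\<^sup>2 \<le> rate * pi\<^sup>2"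
          using rate_pos power_mono[OF t, of 2] by (intro mult_left_mono) auto
        then have "1 \<le> exp (rate * pi\<^sup>2) * exp (- rate * \<theta>\<^sup>2)"
          by (simp flip: exp_add)
        from mult_left_mono[OF this C] show ?thesis by (simp add: D_def mult.assoc)
      qed
      then have "C * (\<theta> ^ 4 + of_bool (n < L) * \<bar>\<theta>\<bar> ^ 3) * gauss n \<theta> \<le>
         (D * exp (- rate * \<theta>\<^sup>2)) * (\<theta> ^ 4 + of_bool (n < L) * \<bar>\<theta>\<bar> ^ 3) * gauss n \<theta>"
        by (intro mult_right_mono) auto
      finally show "norm \<rho> \<le> D * (\<theta> ^ 4 + of_bool (n < L) * \<bar>\<theta>\<bar> ^ 3) * (exp (- rate * \<theta>\<^sup>2) * gauss n \<theta>)"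
        by (simp only: mult_ac)
    qed auto
    also have "\<dots> = D * ((n * \<theta> ^ 4 + min n L * \<bar>\<theta>\<bar> ^ 3) + (\<theta> ^ 4 + of_bool (n < L) * \<bar>\<theta>\<bar> ^ 3))
        * (exp (- rate * \<theta>\<^sup>2) * gauss n \<theta>)"
      by (simp only: distrib_left distrib_right mult_ac)
    also have "exp (- rate * \<theta>\<^sup>2) * gauss n \<theta> = exp (- rate * Suc n * \<theta>\<^sup>2)"
      by (simp add: algebra_simps flip: exp_add)
    also have "(n * \<theta> ^ 4 + min n L * \<bar>\<theta>\<bar> ^ 3) + (\<theta> ^ 4 + of_bool (n < L) * \<bar>\<theta>\<bar> ^ 3)
        = Suc n * \<theta> ^ 4 + min (Suc n) L * \<bar>\<theta>\<bar> ^ 3"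
      by (auto simp: min_def algebra_simps)
    finally show ?case .
  qed simp
  note bound = this
  have D: "0 \<le> D" using C by (simp add: D_def)
  have "norm ((twist \<theta> ^^ n) (eigvec \<theta>) w - eigval \<theta> ^ n * eigvec \<theta> w)
     \<le> (D * L) * (n * \<theta> ^ 4 + \<bar>\<theta>\<bar> ^ 3) * gauss n \<theta>"
    if t: "\<bar>\<theta>\<bar> \<le> pi" and w: "w \<in> W" for \<theta> :: real and n w
  proof -
    have "D * (n * \<theta> ^ 4 + min n L * \<bar>\<theta>\<bar> ^ 3) \<le> D * (L * (n * \<theta> ^ 4 + \<bar>\<theta>\<bar> ^ 3))"
    proof (intro mult_left_mono D)
      have "n * \<theta> ^ 4 \<le> L * (n * \<theta> ^ 4)"
        using L_pos mult_right_mono[of 1 "real L" "n * \<theta> ^ 4"] by simp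
      moreover have "min n L * \<bar>\<theta>\<bar> ^ 3 \<le> L * \<bar>\<theta>\<bar> ^ 3" by (intro mult_right_mono) auto
      ultimately show "n * \<theta> ^ 4 + min n L * \<bar>\<theta>\<bar> ^ 3 \<le> L * (n * \<theta> ^ 4 + \<bar>\<theta>\<bar> ^ 3)"
        by (simp add: distrib_left)
    qed
    then have "D * (n * \<theta> ^ 4 + min n L * \<bar>\<theta>\<bar> ^ 3) * gauss n \<theta> \<le> 
      D * (L * (n * \<theta> ^ 4 + \<bar>\<theta>\<bar> ^ 3)) * gauss n \<theta>" by (intro mult_right_mono) auto
    then show ?thesis using bound[OF t w, of n] by (simp add: mult.assoc)
  qed
  moreover have "0 \<le> D * L" using D by simp
  ultimately show ?thesis by blast
qed

text \<open>The limit of the mean of \<open>C\<^sub>n(a) - C\<^sub>n(b)\<close> for a start in \<open>a\<close>: one for the start itself and the centred first corrector for the future.\<close>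

definition drift :: real where "drift = 1 + corr1 a - corr1_mean"

text \<open>The constant \<open>1\<close> is \<open>1 - i \<theta> corr1_mean\<close> times the eigenvector minus \<open>i \<theta>\<close> times the centred first
  corrector, up to \<open>O(\<theta>\<^sup>2)\<close>, and the centred part gains another factor \<open>\<theta>\<close>.\<close>

lemma twist_pow_one:
  "\<exists>C\<ge>0. \<forall>(\<theta>::real) n. \<bar>\<theta>\<bar> \<le> pi \<longrightarrow> L \<le> n \<longrightarrow>
    norm (cis \<theta> * (twist \<theta> ^^ n) (\<lambda>_. 1) a - (1 + \<i> * drift * \<theta>) * eigval \<theta> ^ n)
     \<le> C * (\<theta>\<^sup>2 + n * \<theta> ^ 4) * gauss n \<theta>"
proof -
  obtain C1 where C1: "1 \<le> C1" and dec0: "decay_bound C1 rate"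
    by (rule rate)
  note dec = decay_boundD[OF dec0]
  obtain C2 where C2: "0 \<le> C2" and cen0: "centered_bound C2"
    using twist_decay_centered by blast
  note cen = centered_boundD[OF cen0]
  obtain C3 where C3: "0 \<le> C3" and eig: "\<And>(\<theta>::real) n w. \<bar>\<theta>\<bar> \<le> pi \<Longrightarrow> w \<in> W \<Longrightarrow>
    norm ((twist \<theta> ^^ n) (eigvec \<theta>) w - eigval \<theta> ^ n * eigvec \<theta> w)
     \<le> C3 * (n * \<theta> ^ 4 + \<bar>\<theta>\<bar> ^ 3) * gauss n \<theta>"
    using twist_pow_eigvec by blast
  define g where "g w = complex_of_real (corr1 w - corr1_mean)" for w
  obtain G where G: "0 \<le> G" "\<forall>w\<in>W. norm (g w) \<le> G" using finite_bound[of g] by metis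
  have mean_g: "mean L g = 0"
    unfolding g_def[abs_def] mean_of_real by (simp add: mean_diff flip: corr1_mean_def)
  define r where "r \<theta> w = (1 - \<i> * corr1_mean * \<theta>) * eigvec \<theta> w - \<i> * \<theta> * g w - 1" for \<theta> w
  have r: "ord 2 (\<lambda>\<theta>. r \<theta> w)" for w
  proof -
    have "ord 2 (\<lambda>\<theta>. complex_of_real (corr1_mean * corr1 w - corr2 w) * of_real \<theta> ^ 2 + (\<i> * complex_of_real (corr1_mean * corr2 w)) * of_real \<theta> ^ 3)"
      by (intro ord_add ord_monomial) auto
    also have "(\<lambda>\<theta>. complex_of_real (corr1_mean * corr1 w - corr2 w) * of_real \<theta> ^ 2 + (\<i> * complex_of_real (corr1_mean * corr2 w)) * of_real \<theta> ^ 3) = (\<lambda>\<theta>. r \<theta> w)"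
      by (rule ext) (simp add: r_def eigvec_def g_def algebra_simps eval_nat_numeral)
    finally show ?thesis .
  qed
  obtain R where R: "0 \<le> R" "\<forall>w\<in>W. \<forall>(\<theta>::real). \<bar>\<theta>\<bar> \<le> pi \<longrightarrow> norm (r \<theta> w) \<le> R * \<bar>\<theta>\<bar> ^ 2"
    using ord_uniform[of W 2 "\<lambda>w \<theta>. r \<theta> w", OF finite_words r] by metis
  have z: "ord 2 (\<lambda>\<theta>. cis \<theta> * (1 - \<i> * corr1_mean * \<theta>) * eigvec \<theta> a - (1 + \<i> * drift * \<theta>))"
  proof -
    have c: "ord 2 (\<lambda>\<theta>. cis \<theta> - 1 - \<i> * \<theta>)"
    proof -
      have "ord 2 (\<lambda>\<theta>. (cis (\<theta> * 1) - (1 + \<i> * (\<theta> * 1) - (\<theta> * 1)\<^sup>2 / 2 - \<i> * (\<theta> * 1) ^ 3 / 6))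
         + (-1/2) * of_real \<theta> ^ 2 + (- \<i> / 6) * of_real \<theta> ^ 3)"
        by (intro ord_add ord_monomial ord_weaken[OF ord_cis[of 1]]) auto
      then show ?thesis by (simp add: algebra_simps)
    qed
    have "ord 0 (\<lambda>\<theta>. (1 + (- \<i> * corr1_mean) * of_real \<theta> ^ 1) * eigvec \<theta> a)"
      using ord_mult[OF ord_add[OF ord_const[of 1] ord_monomial[of 0 1 "- \<i> * corr1_mean"]] ord_eigvec[of a]] by simp
    then have "ord 0 (\<lambda>\<theta>. (1 - \<i> * corr1_mean * \<theta>) * eigvec \<theta> a)" by simp
    from ord_mult[OF c this]
    have 1: "ord 2 (\<lambda>\<theta>. (cis \<theta> - 1 - \<i> * \<theta>) * ((1 - \<i> * corr1_mean * \<theta>) * eigvec \<theta> a))" by simp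
    have "ord 0 (\<lambda>\<theta>. 1 + \<i> * of_real \<theta> ^ 1)" by (intro ord_add ord_const ord_monomial) auto
    from ord_mult[OF this r[of a]] have 2: "ord 2 (\<lambda>\<theta>. (1 + \<i> * \<theta>) * r \<theta> a)" by (simp add: numeral_2_eq_2)
    have "ord 2 (\<lambda>\<theta>. (cis \<theta> - 1 - \<i> * \<theta>) * ((1 - \<i> * corr1_mean * \<theta>) * eigvec \<theta> a) + (1 + \<i> * \<theta>) * r \<theta> a
       + (- complex_of_real (corr1 a - corr1_mean)) * of_real \<theta> ^ 2)"
      by (intro ord_add 1 2 ord_monomial) auto
    also have "(\<lambda>\<theta>. (cis \<theta> - 1 - \<i> * \<theta>) * ((1 - \<i> * corr1_mean * \<theta>) * eigvec \<theta> a) + (1 + \<i> * \<theta>) * r \<theta> a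
       + (- complex_of_real (corr1 a - corr1_mean)) * of_real \<theta> ^ 2) =
      (\<lambda>\<theta>. cis \<theta> * (1 - \<i> * corr1_mean * \<theta>) * eigvec \<theta> a - (1 + \<i> * drift * \<theta>))"
      by (rule ext) (simp add: r_def g_def drift_def algebra_simps power2_eq_square)
    finally show ?thesis .
  qed
  obtain Z where Z: "0 \<le> Z" "\<And>(\<theta>::real). \<bar>\<theta>\<bar> \<le> pi \<Longrightarrow> norm (cis \<theta> * (1 - \<i> * corr1_mean * \<theta>) * eigvec \<theta> a - (1 + \<i> * drift * \<theta>)) \<le> Z * \<bar>\<theta>\<bar> ^ 2"
    using ord_uniform[of "{a}", OF _ z] by auto
  define Kp where "Kp = 1 + \<bar>corr1_mean\<bar> * pi"
  define C where "C = Kp * C3 * (1 + pi) + C2 * G + C1 * R + Z"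
  have bound: "norm (cis \<theta> * (twist \<theta> ^^ n) (\<lambda>_. 1) a - (1 + \<i> * drift * \<theta>) * eigval \<theta> ^ n)
     \<le> C * (\<theta>\<^sup>2 + n * \<theta> ^ 4) * gauss n \<theta>"
    if t: "\<bar>\<theta>\<bar> \<le> pi" and n: "L \<le> n" for \<theta> :: real and n
  proof -
    define e where "e = gauss n \<theta>"
    define S where "S = \<theta>\<^sup>2 + n * \<theta> ^ 4"
    have S: "\<theta>\<^sup>2 \<le> S" by (simp add: S_def)
    have e: "0 \<le> e" by (simp add: e_def)
    define T1 where "T1 = (1 - \<i> * corr1_mean * \<theta>) * ((twist \<theta> ^^ n) (eigvec \<theta>) a - eigval \<theta> ^ n * eigvec \<theta> a)"
    define T2 where "T2 = (\<i> * \<theta>) * (twist \<theta> ^^ n) g a"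
    define T3 where "T3 = (twist \<theta> ^^ n) (r \<theta>) a"
    define T4 where "T4 = (cis \<theta> * (1 - \<i> * corr1_mean * \<theta>) * eigvec \<theta> a - (1 + \<i> * drift * \<theta>)) * eigval \<theta> ^ n"
    have one: "(\<lambda>_. 1) = (\<lambda>w. ((1 - \<i> * corr1_mean * \<theta>) * eigvec \<theta> w - (\<i> * \<theta>) * g w) - 1 * r \<theta> w)"
      by (simp add: r_def)
    have one_expansion: "(twist \<theta> ^^ n) (\<lambda>_. 1) a = (1 - \<i> * corr1_mean * \<theta>) * (twist \<theta> ^^ n) (eigvec \<theta>) a - T2 - T3"
    proof -
      have "(twist \<theta> ^^ n) (\<lambda>_. 1) a =
          (twist \<theta> ^^ n) (\<lambda>w. ((1 - \<i> * corr1_mean * \<theta>) * eigvec \<theta> w - (\<i> * \<theta>) * g w) - 1 * r \<theta> w) a"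
        by (rule arg_cong[where f = "\<lambda>h. (twist \<theta> ^^ n) h a", OF one])
      then show ?thesis
        unfolding twist_pow_linear twist_pow_mult T2_def T3_def by simp
    qed
    have "cis \<theta> * (twist \<theta> ^^ n) (\<lambda>_. 1) a - (1 + \<i> * drift * \<theta>) * eigval \<theta> ^ n
        = cis \<theta> * (T1 - T2 - T3) + T4"
      unfolding one_expansion T1_def T4_def by (simp add: algebra_simps)
    then have "norm (cis \<theta> * (twist \<theta> ^^ n) (\<lambda>_. 1) a - (1 + \<i> * drift * \<theta>) * eigval \<theta> ^ n)
       \<le> norm (T1 - T2 - T3) + norm T4"
      using norm_triangle_ineq[of "cis \<theta> * (T1 - T2 - T3)" T4] by (simp add: norm_mult)
    also have "norm (T1 - T2 - T3) \<le> norm T1 + norm T2 + norm T3"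
      by (intro order_trans[OF norm_triangle_ineq4] add_mono norm_triangle_ineq4) auto
    also have "norm T1 \<le> (Kp * C3 * (1 + pi)) * S * e"
    proof -
      have "norm (1 - \<i> * corr1_mean * \<theta>) \<le> 1 + \<bar>corr1_mean\<bar> * \<bar>\<theta>\<bar>"
        using norm_triangle_ineq4[of 1 "\<i> * corr1_mean * \<theta>"] by (simp add: norm_mult)
      also have "\<dots> \<le> Kp" unfolding Kp_def using t by (intro add_left_mono mult_left_mono) auto
      finally have k: "norm (1 - \<i> * corr1_mean * \<theta>) \<le> Kp" .
      have "\<bar>\<theta>\<bar> ^ 3 = \<bar>\<theta>\<bar> * \<theta>\<^sup>2" by (simp add: power3_eq_cube power2_eq_square)
      also have "\<dots> \<le> pi * \<theta>\<^sup>2" using t by (intro mult_right_mono) auto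
      finally have "\<bar>\<theta>\<bar> ^ 3 \<le> pi * \<theta>\<^sup>2" .
      moreover have "0 \<le> \<theta>\<^sup>2" "0 \<le> pi * (n * \<theta> ^ 4)" by auto
      ultimately have "n * \<theta> ^ 4 + \<bar>\<theta>\<bar> ^ 3 \<le> (1 + pi) * S"
        unfolding S_def distrib_left distrib_right mult_1 by linarith
      then have "C3 * (n * \<theta> ^ 4 + \<bar>\<theta>\<bar> ^ 3) * e \<le> C3 * ((1 + pi) * S) * e"
        using C3 e by (intro mult_right_mono mult_left_mono)
      then have "norm ((twist \<theta> ^^ n) (eigvec \<theta>) a - eigval \<theta> ^ n * eigvec \<theta> a) \<le> C3 * ((1 + pi) * S) * e"
        using eig[OF t a_in, of n] by (simp add: e_def)
      then have "norm T1 \<le> Kp * (C3 * ((1 + pi) * S) * e)"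
        unfolding T1_def norm_mult using k by (intro mult_mono) (auto simp: Kp_def)
      then show ?thesis by (simp add: mult_ac)
    qed
    also have "norm T2 \<le> (C2 * G) * S * e"
    proof -
      have "norm ((twist \<theta> ^^ n) g a) \<le> C2 * \<bar>\<theta>\<bar> * e * G"
        using cen[OF t G(2) mean_g a_in, of n] n by (simp add: e_def)
      then have "\<bar>\<theta>\<bar> * norm ((twist \<theta> ^^ n) g a) \<le> \<bar>\<theta>\<bar> * (C2 * \<bar>\<theta>\<bar> * e * G)"
        by (intro mult_left_mono) auto
      then have "norm T2 \<le> C2 * G * \<theta>\<^sup>2 * e"
        by (simp add: T2_def norm_mult mult_ac power2_eq_square)
      also have "\<dots> \<le> (C2 * G) * S * e"
        using S e C2 G by (intro mult_right_mono mult_left_mono) auto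
      finally show ?thesis .
    qed
    also have "norm T3 \<le> (C1 * R) * S * e"
    proof -
      have "norm T3 \<le> C1 * e * (R * \<theta>\<^sup>2)"
        unfolding T3_def e_def using R t by (intro dec) auto
      also have "\<dots> = (C1 * R) * \<theta>\<^sup>2 * e" by (simp add: mult_ac)
      also have "\<dots> \<le> (C1 * R) * S * e"
        using S e C1 R by (intro mult_right_mono mult_left_mono) auto
      finally show ?thesis .
    qed
    also have "norm T4 \<le> Z * S * e"
    proof -
      have "norm T4 \<le> (Z * \<theta>\<^sup>2) * e"
        unfolding T4_def norm_mult e_def using Z(1) Z(2)[OF t] norm_eigval_pow_le
        by (intro mult_mono) auto
      also have "\<dots> \<le> Z * S * e"
        using S e Z by (intro mult_right_mono mult_left_mono) auto
      finally show ?thesis .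
    qed
    finally show ?thesis by (simp add: C_def S_def e_def algebra_simps)
  qed
  have "0 \<le> C" using C1 C2 C3 G R Z by (simp add: C_def Kp_def)
  with bound show ?thesis by blast
qed

end

section \<open>Fourier inversion and the Gaussian limit\<close>

lemma has_integral_cos_nat:
  "has_bochner_integral lborel (\<lambda>x. indicator {0..pi} x *\<^sub>R cos (real k * x)) (if k = 0 then pi else 0)"
proof (cases "k = 0")
  case True
  then show ?thesis
    using has_bochner_integral_FTC_Icc[of 0 pi "\<lambda>x. x" "\<lambda>_. 1"] by (auto intro: derivative_eq_intros)
next
  case False
  have "has_bochner_integral lborel (\<lambda>x. indicator {0..pi} x *\<^sub>R cos (real k * x))
      (sin (real k * pi) / k - sin (real k * 0) / k)"
    using False
    by (intro has_bochner_integral_FTC_Icc)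
      (auto intro!: derivative_eq_intros continuous_intros
        simp flip: has_real_derivative_iff_has_vector_derivative)
  then show ?thesis using False by (simp add: sin_npi)
qed

abbreviation cot_half :: "real \<Rightarrow> real" where
  "cot_half x \<equiv> cos (x / 2) / sin (x / 2)"

text \<open>By the addition theorems, \<open>(sin ((k+1) x) - sin (k x)) cot (x / 2) = cos ((k+1) x) + cos (k x)\<close>, and only
  the step from \<open>k = 0\<close> to \<open>k = 1\<close> contributes to the integral.\<close>

lemma has_integral_sign_nat:
  "has_bochner_integral lborel (\<lambda>x. indicator {0..pi} x *\<^sub>R (sin (real k * x) * cot_half x))
     (if k = 0 then 0 else pi)"
proof (induction k)
  case (Suc k)
  have "has_bochner_integral lborel (\<lambda>x. indicator {0..pi} x *\<^sub>R (sin (real k * x) * cot_half x)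
      + (indicator {0..pi} x *\<^sub>R cos (real (Suc k) * x) + indicator {0..pi} x *\<^sub>R cos (real k * x)))
     ((if k = 0 then 0 else pi) + ((if Suc k = 0 then pi else 0) + (if k = 0 then pi else 0)))"
    by (intro has_bochner_integral_add Suc has_integral_cos_nat)
  moreover have "(if k = 0 then 0 else pi) + ((if Suc k = 0 then pi else 0) + (if k = 0 then pi else 0)) = pi"
    by simp
  \<comment> \<open>At \<open>x = 0\<close> the identity fails, since there the quotient is \<open>1 / 0 = 0\<close>.\<close>
  moreover have "AE x in lborel. indicator {0..pi} x *\<^sub>R (sin (real (Suc k) * x) * cot_half x)
     = indicator {0..pi} x *\<^sub>R (sin (real k * x) * cot_half x)
      + (indicator {0..pi} x *\<^sub>R cos (real (Suc k) * x) + indicator {0..pi} x *\<^sub>R cos (real k * x))"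
    using AE_lborel_singleton[of 0]
  proof eventually_elim
    case (elim x)
    show ?case
    proof (cases "x \<in> {0..pi}")
      case True
      then have s: "sin (x / 2) \<noteq> 0" using elim sin_gt_zero[of "x / 2"] by auto
      define y where "y = x / 2"
      define z where "z = real k * x + y"
      have 1: "real (Suc k) * x = z + y" "real k * x = z - y" by (simp_all add: z_def y_def algebra_simps)
      have "sin (z + y) * (cos y / sin y) = sin (z - y) * (cos y / sin y) + (cos (z + y) + cos (z - y))"
        using s unfolding y_def[symmetric]
        by (simp add: sin_add sin_diff cos_add cos_diff field_simps)
      then show ?thesis using True unfolding 1 y_def[symmetric] by simp
    qed simp
  qed
  ultimately show ?case
    by (subst has_bochner_integral_cong_AE) (simp_all del: of_nat_Suc real_scaleR_def)
qed (simp add: has_bochner_integral_zero)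

lemma has_integral_sign:
  "has_bochner_integral lborel (\<lambda>x. indicator {0..pi} x * (sin (x * of_int d) * cot_half x))
     (pi * of_int (sgn d))"
proof (cases "0 \<le> d")
  case True
  then obtain k where "d = int k" using nonneg_int_cases by blast
  then show ?thesis using has_integral_sign_nat[of k] by (auto simp: mult.commute sgn_if)
next
  case False
  then obtain k where k: "d = - int k" "k \<noteq> 0" by (metis int_cases4 linorder_not_less of_nat_0_less_iff less_int_code(1) not_gr_zero neg_int_cases nat_int)
  then show ?thesis using has_bochner_integral_minus[OF has_integral_sign_nat[of k]]
    by (auto simp: mult.commute sgn_if)
qed

lemma cot_half_bound:
  assumes "0 < x" "x \<le> pi"
  shows "0 \<le> cot_half x" and "cot_half x \<le> 2 / x"
proof -
  define y where "y = x / 2"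
  have y: "0 < y" "y \<le> pi / 2" using assms by (auto simp: y_def)
  have s: "0 < sin y" using y by (intro sin_gt_zero) auto
  have c: "0 \<le> cos y" using y by (intro cos_ge_zero) auto
  show "0 \<le> cot_half x" using s c by (simp add: y_def)
  have "sin 0 - 0 * cos 0 \<le> sin y - y * cos y"
  proof (rule DERIV_nonneg_imp_nondecreasing[of 0 y "\<lambda>u. sin u - u * cos u"])
    fix u assume u: "0 \<le> u" "u \<le> y"
    have "((\<lambda>u. sin u - u * cos u) has_real_derivative u * sin u) (at u)"
      by (auto intro!: derivative_eq_intros)
    moreover have "0 \<le> u * sin u" using u y by (intro mult_nonneg_nonneg sin_ge_zero) auto
    ultimately show "\<exists>l. ((\<lambda>u. sin u - u * cos u) has_real_derivative l) (at u) \<and> 0 \<le> l" by blast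
  qed (use y in auto)
  then have "cos y / sin y \<le> 1 / y" using s y by (simp add: field_simps)
  then show "cot_half x \<le> 2 / x" by (simp add: y_def)
qed

lemma sqrt_times_divide: "0 < x \<Longrightarrow> sqrt x * (y / x) = y / sqrt x"
  by (metis divide_divide_eq_left' nonzero_mult_div_cancel_left order_less_imp_le order_less_irrefl
      real_sqrt_gt_zero real_sqrt_mult_self abs_of_pos times_divide_eq_right)

lemma gaussian_half_moments:
  assumes "0 < (\<alpha>::real)"
  shows "has_bochner_integral lborel (\<lambda>t. indicator {0..} t * exp (- \<alpha> * t\<^sup>2)) (sqrt pi / (2 * sqrt \<alpha>))"
    and "has_bochner_integral lborel (\<lambda>t. indicator {0..} t * (t\<^sup>2 * exp (- \<alpha> * t\<^sup>2))) (sqrt pi / (4 * \<alpha> * sqrt \<alpha>))"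
proof -
  define c where "c = sqrt \<alpha>"
  have c: "0 < c" "c\<^sup>2 = \<alpha>" using assms by (auto simp: c_def)
  have ind: "indicator {0..} (c * t) = (indicator {0..} t :: real)"
    "indicator {0..} (t * c) = (indicator {0..} t :: real)" for t
    using c(1) by (auto simp: indicator_def zero_le_mult_iff)
  have "has_bochner_integral lborel (\<lambda>t. indicator {0..} (0 + c * t) *\<^sub>R exp (- (0 + c * t)\<^sup>2)) ((sqrt pi / 2) /\<^sub>R \<bar>c\<bar>)"
    using c by (intro lborel_has_bochner_integral_real_affine_iff[THEN iffD1] gaussian_moment_0) auto
  then show "has_bochner_integral lborel (\<lambda>t. indicator {0..} t * exp (- \<alpha> * t\<^sup>2)) (sqrt pi / (2 * sqrt \<alpha>))"
    using c by (simp add: ind power_mult_distrib c_def[symmetric] field_simps)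
  have "has_bochner_integral lborel (\<lambda>t. indicator {0..} (0 + c * t) *\<^sub>R (exp (- (0 + c * t)\<^sup>2) * (0 + c * t) ^ (2 * 1)))
     (((sqrt pi / 2) * (fact (2 * 1) / (2 ^ (2 * 1) * fact 1))) /\<^sub>R \<bar>c\<bar>)"
    using c by (intro lborel_has_bochner_integral_real_affine_iff[THEN iffD1] gaussian_moment_even_pos) auto
  also have "(\<lambda>t. indicator {0..} (0 + c * t) *\<^sub>R (exp (- (0 + c * t)\<^sup>2) * (0 + c * t) ^ (2 * 1))) =
      (\<lambda>t. indicator {0..} t * (exp (- \<alpha> * t\<^sup>2) * (\<alpha> * t\<^sup>2)))"
    by (simp add: ind power_mult_distrib c)
  also have "((sqrt pi / 2) * (fact (2 * 1) / (2 ^ (2 * 1) * fact 1))) /\<^sub>R \<bar>c\<bar> = sqrt pi / 4 / c"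
    using c by (simp add: field_simps)
  finally have "has_bochner_integral lborel (\<lambda>t. (1 / \<alpha>) * (indicator {0..} t * (exp (- \<alpha> * t\<^sup>2) * (\<alpha> * t\<^sup>2)))) ((1 / \<alpha>) * (sqrt pi / 4 / c))"
    by (rule has_bochner_integral_mult_right)
  then show "has_bochner_integral lborel (\<lambda>t. indicator {0..} t * (t\<^sup>2 * exp (- \<alpha> * t\<^sup>2))) (sqrt pi / (4 * \<alpha> * sqrt \<alpha>))"
    using assms by (simp add: c_def mult_ac)
qed

context aperiodic_words
begin

definition advantage :: "nat \<Rightarrow> real" where
  "advantage n = (\<Sum>s\<in>words n. of_int (sgn (1 + path_sum f a s))) / 2 ^ n"

definition char_fun :: "nat \<Rightarrow> real \<Rightarrow> complex" where
  "char_fun n \<theta> = cis \<theta> * (twist \<theta> ^^ n) (\<lambda>_. 1) a"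

lemma Im_char_fun: "Im (char_fun n \<theta>) = (\<Sum>s\<in>words n. sin (\<theta> * of_int (1 + path_sum f a s))) / 2 ^ n"
proof -
  have "char_fun n \<theta> = (\<Sum>s\<in>words n. cis (\<theta> * of_int (1 + path_sum f a s))) / of_real (2 ^ n)"
    by (simp add: char_fun_def twist_path sum_distrib_left cis_mult algebra_simps)
  then show ?thesis
    by (simp only: Im_divide_of_real Im_sum cis.sel)
qed

definition integrand :: "nat \<Rightarrow> real \<Rightarrow> real" where
  "integrand n \<theta> = indicator {0..pi} \<theta> * (Im (char_fun n \<theta>) * cot_half \<theta>)"

lemma advantage_integral: "has_bochner_integral lborel (integrand n) (pi * advantage n)"
proof -
  have pull_out: "(\<Sum>s\<in>A. i * (g s * k)) / c = i * ((\<Sum>s\<in>A. g s) / c * k)"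
    for A :: "bool list set" and i k c :: real and g
    by (simp add: sum_distrib_left sum_distrib_right sum_divide_distrib mult_ac)
  have "has_bochner_integral lborel (\<lambda>x. (\<Sum>s\<in>words n. indicator {0..pi} x *
       (sin (x * of_int (1 + path_sum f a s)) * cot_half x)) / 2 ^ n)
     ((\<Sum>s\<in>words n. pi * of_int (sgn (1 + path_sum f a s))) / 2 ^ n)"
    by (intro has_bochner_integral_divide has_bochner_integral_sum has_integral_sign)
  also have "(\<lambda>x. (\<Sum>s\<in>words n. indicator {0..pi} x *
       (sin (x * of_int (1 + path_sum f a s)) * cot_half x)) / 2 ^ n) = integrand n"
    by (rule ext) (simp only: integrand_def Im_char_fun pull_out)
  also have "(\<Sum>s\<in>words n. pi * of_int (sgn (1 + path_sum f a s))) / 2 ^ n = pi * advantage n"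
    by (simp add: advantage_def sum_distrib_left)
  finally show ?thesis .
qed

lemma integrand_measurable [measurable]: "integrand n \<in> borel_measurable borel"
  using advantage_integral[of n] by (auto simp: has_bochner_integral_iff dest: borel_measurable_integrable)

lemma Im_main_term:
  "Im ((1 + \<i> * drift * \<theta>) * eigval \<theta> ^ n) =
     exp (- half_var * (n * \<theta>\<^sup>2)) * (drift * \<theta> * cos (n * (cumulant3 * \<theta> ^ 3)) - sin (n * (cumulant3 * \<theta> ^ 3)))"
proof -
  have "eigval \<theta> ^ n = exp (of_nat n * (- complex_of_real (half_var * \<theta>\<^sup>2) - \<i> * complex_of_real (cumulant3 * \<theta> ^ 3)))"
    by (simp only: eigval_def exp_of_nat_mult)
  also have "of_nat n * (- complex_of_real (half_var * \<theta>\<^sup>2) - \<i> * complex_of_real (cumulant3 * \<theta> ^ 3)) =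
      Complex (- half_var * (n * \<theta>\<^sup>2)) (- (n * (cumulant3 * \<theta> ^ 3)))"
    by (simp add: complex_eq_iff)
  also have "exp \<dots> = complex_of_real (exp (- half_var * (n * \<theta>\<^sup>2))) * cis (- (n * (cumulant3 * \<theta> ^ 3)))"
    by (simp add: exp_eq_polar)
  finally show ?thesis by (simp add: algebra_simps)
qed

text \<open>The cotangent is at most \<open>2 / \<theta>\<close>, and the imaginary part of the characteristic function is
  \<open>O(\<theta> + n \<theta>\<^sup>3)\<close> times the Gaussian factor; in the variable \<open>t = \<theta> \<surd>n\<close> the product is bounded by a multiple of
  \<open>1 + t\<^sup>2\<close> times a Gaussian, uniformly in \<open>n\<close> and up to \<open>\<theta> = \<pi>\<close>.\<close>

lemma rescaled_bound:
  "\<exists>C. \<forall>n t. L \<le> n \<longrightarrow> 0 < n \<longrightarrow> t \<noteq> 0 \<longrightarrow>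
     \<bar>integrand n (t / sqrt n)\<bar> \<le> C * (indicator {0..} t * ((1 + t\<^sup>2) * exp (- rate * t\<^sup>2)))"
proof -
  obtain C where C: "0 \<le> C" and main: "\<And>(\<theta>::real) n. \<bar>\<theta>\<bar> \<le> pi \<Longrightarrow> L \<le> n \<Longrightarrow>
    norm (cis \<theta> * (twist \<theta> ^^ n) (\<lambda>_. 1) a - (1 + \<i> * drift * \<theta>) * eigval \<theta> ^ n)
     \<le> C * (\<theta>\<^sup>2 + n * \<theta> ^ 4) * gauss n \<theta>"
    using twist_pow_one by blast
  define D where "D = 2 * C * pi + 2 * \<bar>drift\<bar> + 2 * \<bar>cumulant3\<bar>"
  have "\<bar>integrand n (t / sqrt n)\<bar> \<le> D * (indicator {0..} t * ((1 + t\<^sup>2) * exp (- rate * t\<^sup>2)))"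
    if n: "L \<le> n" "0 < n" and t0: "t \<noteq> 0" for n and t :: real
  proof (cases "0 \<le> t \<and> t / sqrt n \<le> pi")
    case False
    have "D * (indicator {0..} t * ((1 + t\<^sup>2) * exp (- rate * t\<^sup>2))) \<ge> 0"
      using C by (auto simp: D_def intro!: mult_nonneg_nonneg add_nonneg_nonneg)
    moreover have "integrand n (t / sqrt n) = 0"
      using False n by (auto simp: integrand_def indicator_def zero_le_divide_iff)
    ultimately show ?thesis by simp
  next
    case True
    define \<theta> where "\<theta> = t / sqrt n"
    have \<theta>: "0 < \<theta>" "\<theta> \<le> pi" using True t0 n by (auto simp: \<theta>_def)
    have nt: "n * \<theta>\<^sup>2 = t\<^sup>2" using n by (simp add: \<theta>_def power_divide)
    define e where "e = exp (- rate * t\<^sup>2)"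
    have e: "0 \<le> e" by (simp add: e_def)
    have "\<bar>Im (char_fun n \<theta> - (1 + \<i> * drift * \<theta>) * eigval \<theta> ^ n)\<bar> \<le> C * (\<theta>\<^sup>2 + n * \<theta> ^ 4) * e"
      using order_trans[OF abs_Im_le_cmod main[of \<theta> n]] \<theta> n
      by (simp add: char_fun_def e_def mult.assoc nt)
    moreover have "\<bar>Im ((1 + \<i> * drift * \<theta>) * eigval \<theta> ^ n)\<bar> \<le> (\<bar>drift\<bar> * \<theta> + n * (\<bar>cumulant3\<bar> * \<theta> ^ 3)) * e"
    proof -
      have "half_var * t\<^sup>2 \<ge> rate * t\<^sup>2" using rate_le by (intro mult_right_mono) auto
      then have e2: "exp (- half_var * (n * \<theta>\<^sup>2)) \<le> e" by (simp add: nt e_def)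
      have "\<bar>drift * \<theta> * cos (n * (cumulant3 * \<theta> ^ 3)) - sin (n * (cumulant3 * \<theta> ^ 3))\<bar>
         \<le> \<bar>drift * \<theta> * cos (n * (cumulant3 * \<theta> ^ 3))\<bar> + \<bar>sin (n * (cumulant3 * \<theta> ^ 3))\<bar>"
        by (rule abs_triangle_ineq4)
      also have "\<bar>drift * \<theta> * cos (n * (cumulant3 * \<theta> ^ 3))\<bar> \<le> \<bar>drift\<bar> * \<theta>"
        using \<theta> mult_left_le[of "\<bar>cos (n * (cumulant3 * \<theta> ^ 3))\<bar>" "\<bar>drift\<bar> * \<theta>"]
        by (simp add: abs_mult)
      also have "\<bar>sin (n * (cumulant3 * \<theta> ^ 3))\<bar> \<le> n * (\<bar>cumulant3\<bar> * \<theta> ^ 3)"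
        using abs_sin_x_le_abs_x[of "n * (cumulant3 * \<theta> ^ 3)"] \<theta> by (simp add: abs_mult power_abs)
      finally have "\<bar>drift * \<theta> * cos (n * (cumulant3 * \<theta> ^ 3)) - sin (n * (cumulant3 * \<theta> ^ 3))\<bar>
         \<le> \<bar>drift\<bar> * \<theta> + n * (\<bar>cumulant3\<bar> * \<theta> ^ 3)" by simp
      then have "\<bar>Im ((1 + \<i> * drift * \<theta>) * eigval \<theta> ^ n)\<bar> \<le> e * (\<bar>drift\<bar> * \<theta> + n * (\<bar>cumulant3\<bar> * \<theta> ^ 3))"
        unfolding Im_main_term abs_mult abs_exp_cancel using e2 e by (intro mult_mono) auto
      then show ?thesis by (simp add: mult.commute)
    qed
    ultimately have im: "\<bar>Im (char_fun n \<theta>)\<bar> \<le>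
        C * (\<theta>\<^sup>2 + n * \<theta> ^ 4) * e + (\<bar>drift\<bar> * \<theta> + n * (\<bar>cumulant3\<bar> * \<theta> ^ 3)) * e"
      unfolding minus_complex.sel by linarith
    have "\<bar>integrand n \<theta>\<bar> = \<bar>Im (char_fun n \<theta>)\<bar> * cot_half \<theta>"
    proof -
      have ind: "indicator {0..pi} \<theta> = (1::real)" using \<theta> by simp
      show ?thesis
        unfolding integrand_def ind mult_1 abs_mult using cot_half_bound(1)[OF \<theta>] by (simp only: abs_of_nonneg)
    qed
    also have "\<dots> \<le> (C * (\<theta>\<^sup>2 + n * \<theta> ^ 4) * e + (\<bar>drift\<bar> * \<theta> + n * (\<bar>cumulant3\<bar> * \<theta> ^ 3)) * e) * (2 / \<theta>)"
      using im cot_half_bound[OF \<theta>] \<theta> e C by (intro mult_mono) auto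
    also have "\<dots> = (2 * C * (\<theta> + \<theta> * (n * \<theta>\<^sup>2)) + 2 * \<bar>drift\<bar> + 2 * \<bar>cumulant3\<bar> * (n * \<theta>\<^sup>2)) * e"
      using \<theta> by (simp add: field_simps eval_nat_numeral)
    also have "\<dots> \<le> (D * (1 + t\<^sup>2)) * e"
    proof (intro mult_right_mono e)
      have "\<theta> * (1 + t\<^sup>2) \<le> pi * (1 + t\<^sup>2)" using \<theta> by (intro mult_right_mono) auto
      then have "2 * C * (\<theta> * (1 + t\<^sup>2)) \<le> 2 * C * (pi * (1 + t\<^sup>2))"
        using C by (intro mult_left_mono) auto
      moreover have "2 * \<bar>drift\<bar> \<le> 2 * \<bar>drift\<bar> * (1 + t\<^sup>2)" by (simp add: algebra_simps)
      moreover have "2 * \<bar>cumulant3\<bar> * t\<^sup>2 \<le> 2 * \<bar>cumulant3\<bar> * (1 + t\<^sup>2)" by (simp add: algebra_simps)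
      ultimately show "2 * C * (\<theta> + \<theta> * (n * \<theta>\<^sup>2)) + 2 * \<bar>drift\<bar> + 2 * \<bar>cumulant3\<bar> * (n * \<theta>\<^sup>2) \<le> D * (1 + t\<^sup>2)"
        unfolding nt D_def by (simp only: algebra_simps)
    qed
    finally show ?thesis using True by (simp add: \<theta>_def e_def)
  qed
  then show ?thesis by blast
qed

lemma rescaled_limit:
  assumes t: "0 < t"
  shows "(\<lambda>n. integrand n (t / sqrt n)) \<longlonglongrightarrow> 2 * (drift - cumulant3 * t\<^sup>2) * exp (- half_var * t\<^sup>2)"
proof -
  obtain C where C: "0 \<le> C" and main: "\<And>(\<theta>::real) n. \<bar>\<theta>\<bar> \<le> pi \<Longrightarrow> L \<le> n \<Longrightarrow>
    norm (cis \<theta> * (twist \<theta> ^^ n) (\<lambda>_. 1) a - (1 + \<i> * drift * \<theta>) * eigval \<theta> ^ n)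
     \<le> C * (\<theta>\<^sup>2 + n * \<theta> ^ 4) * gauss n \<theta>"
    using twist_pow_one by blast
  define e where "e = exp (- half_var * t\<^sup>2)"
  have lim0: "(\<lambda>n. t / sqrt (real n)) \<longlonglongrightarrow> 0" by real_asymp
  have small: "eventually (\<lambda>n. t / sqrt (real n) \<le> pi) sequentially"
    using order_tendstoD(2)[OF lim0 pi_gt_zero] by eventually_elim simp
  define A where "A n = Im (char_fun n (t / sqrt n) - (1 + \<i> * drift * (t / sqrt n)) * eigval (t / sqrt n) ^ n)" for n
  have "(\<lambda>n. sqrt n * A n) \<longlonglongrightarrow> 0"
  proof (rule Lim_null_comparison)
    show "(\<lambda>n. C * (t\<^sup>2 + t ^ 4) / sqrt (real n)) \<longlonglongrightarrow> 0"
      by (intro tendsto_divide_0[OF tendsto_const]) real_asymp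
    show "\<forall>\<^sub>F n in sequentially. norm (sqrt n * A n) \<le> C * (t\<^sup>2 + t ^ 4) / sqrt (real n)"
      using small eventually_ge_at_top[of L] eventually_gt_at_top[of 0]
    proof eventually_elim
      case (elim n)
      define \<theta> where "\<theta> = t / sqrt n"
      have nt: "\<theta>\<^sup>2 = t\<^sup>2 / n" "n * \<theta> ^ 4 = t ^ 4 / n"
        using elim(3) by (auto simp: \<theta>_def power_divide power4_eq_xxxx)
      have "\<bar>A n\<bar> \<le> C * (\<theta>\<^sup>2 + n * \<theta> ^ 4) * gauss n \<theta>"
        unfolding A_def char_fun_def \<theta>_def[symmetric]
        using order_trans[OF abs_Im_le_cmod main[of \<theta> n]] elim t by (simp add: \<theta>_def)
      also have "\<dots> \<le> C * (\<theta>\<^sup>2 + n * \<theta> ^ 4) * 1"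
        using C rate_pos by (intro mult_left_mono) auto
      also have "\<dots> = C * (t\<^sup>2 + t ^ 4) / n" by (simp add: nt flip: add_divide_distrib)
      finally have "sqrt n * \<bar>A n\<bar> \<le> sqrt n * (C * (t\<^sup>2 + t ^ 4) / n)" by (intro mult_left_mono) auto
      also have "\<dots> = C * (t\<^sup>2 + t ^ 4) / sqrt (real n)"
        using elim(3) by (intro sqrt_times_divide) auto
      finally show ?case by (simp add: abs_mult)
    qed
  qed
  moreover have "(\<lambda>n. sqrt n * Im ((1 + \<i> * drift * (t / sqrt n)) * eigval (t / sqrt n) ^ n)) \<longlonglongrightarrow> e * (drift * t * 1 - cumulant3 * t ^ 3)"
  proof -
    define c where "c = cumulant3 * t ^ 3"
    have "(\<lambda>n. c / sqrt (real n)) \<longlonglongrightarrow> 0" by (intro tendsto_divide_0[OF tendsto_const]) real_asymp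
    then have "(\<lambda>n. cos (c / sqrt (real n))) \<longlonglongrightarrow> cos 0" by (intro tendsto_cos)
    then have cs: "(\<lambda>n. cos (c / sqrt (real n))) \<longlonglongrightarrow> 1" by simp
    have sn: "(\<lambda>n. sqrt (real n) * sin (c / sqrt (real n))) \<longlonglongrightarrow> c"
    proof (cases "c = 0")
      case False
      then show ?thesis by real_asymp
    qed simp
    have "(\<lambda>n. e * (drift * t * cos (c / sqrt (real n)) - sqrt (real n) * sin (c / sqrt (real n)))) \<longlonglongrightarrow> e * (drift * t * 1 - c)"
      by (intro tendsto_intros cs sn)
    moreover have "eventually (\<lambda>n. e * (drift * t * cos (c / sqrt (real n)) - sqrt (real n) * sin (c / sqrt (real n)))
      = sqrt n * Im ((1 + \<i> * drift * (t / sqrt n)) * eigval (t / sqrt n) ^ n)) sequentially"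
      using eventually_gt_at_top[of 0]
    proof eventually_elim
      case (elim n)
      have 1: "n * (t / sqrt n)\<^sup>2 = t\<^sup>2" using elim by (simp add: power_divide)
      have 2: "n * (cumulant3 * (t / sqrt n) ^ 3) = c / sqrt n"
        using elim by (simp add: c_def power_divide power3_eq_cube)
      show ?case
        unfolding Im_main_term 1 2 e_def using elim by (simp add: field_simps)
    qed
    ultimately show ?thesis unfolding c_def by (blast intro: Lim_transform_eventually)
  qed
  ultimately have "(\<lambda>n. sqrt n * A n + sqrt n * Im ((1 + \<i> * drift * (t / sqrt n)) * eigval (t / sqrt n) ^ n))
     \<longlonglongrightarrow> 0 + e * (drift * t * 1 - cumulant3 * t ^ 3)"
    by (rule tendsto_add)
  then have im: "(\<lambda>n. sqrt n * Im (char_fun n (t / sqrt n))) \<longlonglongrightarrow> e * (drift * t - cumulant3 * t ^ 3)"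
    by (simp add: A_def flip: distrib_left)
  have cot: "(\<lambda>n. cot_half (t / sqrt (real n)) / sqrt (real n)) \<longlonglongrightarrow> 2 / t"
    using t by real_asymp
  have "(\<lambda>n. (sqrt n * Im (char_fun n (t / sqrt n))) *
      (cot_half (t / sqrt (real n)) / sqrt (real n)))
     \<longlonglongrightarrow> e * (drift * t - cumulant3 * t ^ 3) * (2 / t)"
    by (rule tendsto_mult[OF im cot])
  moreover have "e * (drift * t - cumulant3 * t ^ 3) * (2 / t) = 2 * (drift - cumulant3 * t\<^sup>2) * e"
    using t by (simp add: field_simps eval_nat_numeral)
  moreover have "eventually (\<lambda>n. (sqrt n * Im (char_fun n (t / sqrt n))) *
      (cot_half (t / sqrt (real n)) / sqrt (real n)) =
      integrand n (t / sqrt n)) sequentially"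
    using small eventually_gt_at_top[of 0]
    by eventually_elim (use t in \<open>simp add: integrand_def\<close>)
  ultimately show ?thesis unfolding e_def using Lim_transform_eventually by fastforce
qed

text \<open>Dominated convergence after the substitution \<open>\<theta> = t / \<surd>n\<close>.\<close>

lemma advantage_limit:
  "(\<lambda>n. sqrt n * advantage n) \<longlonglongrightarrow> (drift - cumulant3 / (2 * half_var)) / sqrt (pi * half_var)"
proof -
  obtain C where C: "\<And>n t. L \<le> n \<Longrightarrow> 0 < n \<Longrightarrow> t \<noteq> 0 \<Longrightarrow>
     \<bar>integrand n (t / sqrt n)\<bar> \<le> C * (indicator {0..} t * ((1 + t\<^sup>2) * exp (- rate * t\<^sup>2)))"
    using rescaled_bound by blast
  define N where "N = L"
  define F where "F t = indicator {0..} t * (2 * (drift - cumulant3 * t\<^sup>2) * exp (- half_var * t\<^sup>2))" for t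
  define w where "w t = C * (indicator {0..} t * ((1 + t\<^sup>2) * exp (- rate * t\<^sup>2)))" for t
  have "has_bochner_integral lborel (\<lambda>t. C * (indicator {0..} t * exp (- rate * t\<^sup>2) + indicator {0..} t * (t\<^sup>2 * exp (- rate * t\<^sup>2))))
      (C * (sqrt pi / (2 * sqrt rate) + sqrt pi / (4 * rate * sqrt rate)))"
    by (intro has_bochner_integral_mult_right has_bochner_integral_add gaussian_half_moments rate_pos)
  then have wi: "integrable lborel w"
    unfolding w_def by (simp add: has_bochner_integral_iff algebra_simps)
  have F: "has_bochner_integral lborel F
     (2 * drift * (sqrt pi / (2 * sqrt half_var)) - 2 * cumulant3 * (sqrt pi / (4 * half_var * sqrt half_var)))"
  proof -
    have "has_bochner_integral lborel (\<lambda>t. 2 * drift * (indicator {0..} t * exp (- half_var * t\<^sup>2))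
        - 2 * cumulant3 * (indicator {0..} t * (t\<^sup>2 * exp (- half_var * t\<^sup>2))))
      (2 * drift * (sqrt pi / (2 * sqrt half_var)) - 2 * cumulant3 * (sqrt pi / (4 * half_var * sqrt half_var)))"
      by (intro has_bochner_integral_mult_right has_bochner_integral_diff gaussian_half_moments half_var_pos)
    then show ?thesis unfolding F_def by (simp add: algebra_simps)
  qed
  \<comment> \<open>The bound is available from \<open>n = L\<close> on.\<close>
  have "(\<lambda>n. integral\<^sup>L lborel (\<lambda>t. integrand (n + N) (t / sqrt (n + N)))) \<longlonglongrightarrow> integral\<^sup>L lborel F"
  proof (rule integral_dominated_convergence[where w = w])
    show "F \<in> borel_measurable lborel" using F by (auto simp: has_bochner_integral_iff)
    show "AE t in lborel. (\<lambda>n. integrand (n + N) (t / sqrt (n + N))) \<longlonglongrightarrow> F t"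
      using AE_lborel_singleton[of 0]
    proof eventually_elim
      case (elim t)
      show ?case
      proof (cases "0 < t")
        case True
        then show ?thesis
          using LIMSEQ_ignore_initial_segment[OF rescaled_limit[OF True], of N] by (simp add: F_def)
      next
        case False
        have "integrand (n + N) (t / sqrt (n + N)) = 0" for n
          using False elim L_pos by (auto simp: integrand_def N_def zero_le_divide_iff)
        then show ?thesis using False elim by (simp add: F_def)
      qed
    qed
    show "AE t in lborel. norm (integrand (n + N) (t / sqrt (n + N))) \<le> w t" for n
      using AE_lborel_singleton[of 0]
      by eventually_elim (use C[of "n + N"] L_pos in \<open>simp add: w_def N_def\<close>)
  qed (use wi in auto)
  then have "(\<lambda>n. integral\<^sup>L lborel (\<lambda>t. integrand n (t / sqrt n))) \<longlonglongrightarrow> integral\<^sup>L lborel F"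
    by (rule LIMSEQ_offset)
  then have "(\<lambda>n. (1 / pi) * integral\<^sup>L lborel (\<lambda>t. integrand n (t / sqrt n))) \<longlonglongrightarrow> (1 / pi) * integral\<^sup>L lborel F"
    by (rule tendsto_mult_left)
  moreover have "eventually (\<lambda>n. (1 / pi) * integral\<^sup>L lborel (\<lambda>t. integrand n (t / sqrt n)) = sqrt n * advantage n) sequentially"
    using eventually_gt_at_top[of 0]
  proof eventually_elim
    case (elim n)
    have "pi * advantage n = integral\<^sup>L lborel (integrand n)"
      using advantage_integral[of n] by (simp add: has_bochner_integral_iff)
    also have "\<dots> = \<bar>1 / sqrt n\<bar> *\<^sub>R integral\<^sup>L lborel (\<lambda>t. integrand n (0 + (1 / sqrt n) * t))"
      using elim by (intro lborel_integral_real_affine) auto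
    finally show ?case using elim by (simp add: field_simps)
  qed
  moreover have "(1 / pi) * integral\<^sup>L lborel F = (drift - cumulant3 / (2 * half_var)) / sqrt (pi * half_var)"
  proof -
    have "integral\<^sup>L lborel F = 2 * drift * (sqrt pi / (2 * sqrt half_var)) - 2 * cumulant3 * (sqrt pi / (4 * half_var * sqrt half_var))"
      using F by (simp add: has_bochner_integral_iff)
    also have "\<dots> = sqrt pi * ((drift - cumulant3 / (2 * half_var)) / sqrt half_var)"
      using half_var_pos by (simp add: field_simps)
    finally have "(1 / pi) * integral\<^sup>L lborel F = (sqrt pi / pi) * ((drift - cumulant3 / (2 * half_var)) / sqrt half_var)" by simp
    also have "sqrt pi / pi = 1 / sqrt pi" by (simp add: field_simps)
    finally show ?thesis by (simp add: real_sqrt_mult)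
  qed
  ultimately show ?thesis using Lim_transform_eventually by fastforce
qed

end

section \<open>From the process to the kernel\<close>

locale bernoulli_words = two_words L a b for L a b +
  fixes N :: "'w measure" and X :: "nat \<Rightarrow> 'w \<Rightarrow> bool"
  assumes process: "symmetric_bernoulli_process N X"
begin

sublocale prob_space N
  using process by (simp add: symmetric_bernoulli_process_def)

definition prefix :: "nat \<Rightarrow> 'w \<Rightarrow> bool list" where
  "prefix n \<omega> = map (\<lambda>i. X i \<omega>) [1..<n + 1]"

definition segment :: "nat \<Rightarrow> nat \<Rightarrow> 'w \<Rightarrow> bool list" where
  "segment s n \<omega> = map (\<lambda>i. X i \<omega>) [s + 1..<s + n + 1]"

lemma length_prefix [simp]: "length (prefix n \<omega>) = n"
  by (simp add: prefix_def)

lemma length_segment [simp]: "length (segment s n \<omega>) = n"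
  by (simp add: segment_def)

lemma prefix_add: "prefix (s + n) \<omega> = prefix s \<omega> @ segment s n \<omega>"
proof -
  have "[1..<s + n + 1] = [1..<s + 1] @ [s + 1..<s + n + 1]"
    using upt_add_eq_append[of 1 "s + 1" n] by (simp add: add.commute add.left_commute)
  then show ?thesis by (simp only: prefix_def segment_def map_append)
qed

lemma take_segment: "i \<le> n \<Longrightarrow> take i (segment s n \<omega>) = segment s i \<omega>"
  by (simp add: segment_def take_map del: upt_Suc)

lemma segment_Suc: "segment s (Suc n) \<omega> = segment s n \<omega> @ [X (s + n + 1) \<omega>]"
  by (simp add: segment_def)

lemma block_prefix: "block X L t \<omega> = (if t < L then [] else drop (t - L) (prefix t \<omega>))"
  by (simp add: block_def prefix_def drop_map Suc_diff_le)

lemma block_slide: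
  assumes "L \<le> s"
  shows "block X L (s + n) \<omega> = slide (block X L s \<omega>) (segment s n \<omega>)"
proof -
  have ne: "drop (s - L) (prefix s \<omega>) \<noteq> []" using assms L_pos by simp
  have "drop (s - L) (prefix s \<omega>) @ segment s n \<omega> = drop (s - L) (prefix (s + n) \<omega>)"
    using assms by (simp add: prefix_add)
  then show ?thesis
    using assms by (simp add: block_prefix slide_eq_drop[OF ne] add.commute)
qed

lemma block_short: "t < L \<Longrightarrow> block X L t \<omega> \<notin> {a, b}"
  using length_a length_b L_pos by (auto simp: block_prefix)

lemma rv: "1 \<le> i \<Longrightarrow> X i \<in> measurable N (count_space UNIV)"
  using process by (auto simp: symmetric_bernoulli_process_def indep_vars_def2)

lemma prob_letter: "1 \<le> i \<Longrightarrow> prob (X i -` {c} \<inter> space N) = 1 / 2"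
  using process by (cases c)
    (auto simp: symmetric_bernoulli_process_def vimage_def Int_def conj_commute)

lemma prefix_eq_iff:
  "length l = n \<Longrightarrow> prefix n \<omega> = l \<longleftrightarrow> (\<forall>i\<in>{1..n}. X i \<omega> = l ! (i - 1))"
proof -
  assume l: "length l = n"
  have "prefix n \<omega> = l \<longleftrightarrow> (\<forall>j<n. X (Suc j) \<omega> = l ! j)"
    using l by (simp add: list_eq_iff_nth_eq prefix_def del: upt_Suc)
  also have "\<dots> \<longleftrightarrow> (\<forall>i\<in>{1..n}. X i \<omega> = l ! (i - 1))"
  proof -
    have "{1..n} = Suc ` {..<n}" by (simp add: image_Suc_lessThan)
    then show ?thesis by auto
  qed
  finally show ?thesis .
qed

lemma prefix_event: "{\<omega> \<in> space N. prefix n \<omega> = l} \<in> events"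
proof (cases "length l = n")
  case True
  have "{\<omega> \<in> space N. prefix n \<omega> = l} = {\<omega> \<in> space N. \<forall>i\<in>{1..n}. X i \<omega> = l ! (i - 1)}"
    by (simp add: prefix_eq_iff[OF True])
  also have "\<dots> \<in> events"
  proof (intro sets.sets_Collect_finite_All)
    fix i assume "i \<in> {1..n}"
    then have [measurable]: "X i \<in> measurable N (count_space UNIV)" by (intro rv) auto
    show "{\<omega> \<in> space N. X i \<omega> = l ! (i - 1)} \<in> events" by measurable
  qed auto
  finally show ?thesis .
next
  case False
  then have "prefix n \<omega> \<noteq> l" for \<omega> by auto
  then show ?thesis by simp
qed

lemma prob_prefix:
  assumes "l \<in> words n"
  shows "prob {\<omega> \<in> space N. prefix n \<omega> = l} = 1 / 2 ^ n"
proof (cases "n = 0")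
  case True
  then show ?thesis using assms by (simp add: prefix_def prob_space)
next
  case False
  have l: "length l = n" using assms by (simp add: words_def)
  have "{\<omega> \<in> space N. prefix n \<omega> = l} = (\<Inter>i\<in>{1..n}. X i -` {l ! (i - 1)} \<inter> space N)"
    using False by (auto simp: prefix_eq_iff[OF l])
  also have "prob \<dots> = (\<Prod>i\<in>{1..n}. prob (X i -` {l ! (i - 1)} \<inter> space N))"
    using process False
    by (intro indep_varsD[where I = "{1..}" and M' = "\<lambda>_. count_space UNIV"])
      (auto simp: symmetric_bernoulli_process_def)
  also have "\<dots> = (\<Prod>i\<in>{1..n}. 1 / 2)"
    by (intro prod.cong refl prob_letter) auto
  finally show ?thesis by (simp add: power_divide)
qed

lemma prefix_measurable [measurable]: "prefix n \<in> measurable N (count_space UNIV)"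
proof -
  have "prefix n -` {l} \<inter> space N \<in> events" for l
    using prefix_event[of n l] by (simp add: vimage_def Int_def conj_commute)
  then show ?thesis by (subst measurable_count_space_eq2_countable) auto
qed

lemma block_measurable [measurable]: "block X L t \<in> measurable N (count_space UNIV)"
  unfolding block_prefix[abs_def] by measurable

lemma segment_measurable [measurable]: "segment s n \<in> measurable N (count_space UNIV)"
proof -
  have "segment s n = (\<lambda>\<omega>. drop s (prefix (s + n) \<omega>))"
    by (rule ext) (simp add: prefix_add)
  then show ?thesis by simp
qed

lemma prob_prefix_pred:
  "prob {\<omega> \<in> space N. P (prefix n \<omega>)} = (\<Sum>l\<in>words n. of_bool (P l)) / 2 ^ n"
proof -
  have "{\<omega> \<in> space N. P (prefix n \<omega>)} = (\<Union>l\<in>{l \<in> words n. P l}. {\<omega> \<in> space N. prefix n \<omega> = l})"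
    by (auto simp: words_def)
  also have "prob \<dots> = (\<Sum>l\<in>{l \<in> words n. P l}. prob {\<omega> \<in> space N. prefix n \<omega> = l})"
    by (intro finite_measure_finite_Union) (auto simp: disjoint_family_on_def prefix_event)
  also have "\<dots> = (\<Sum>l\<in>{l \<in> words n. P l}. 1 / 2 ^ n)"
    by (intro sum.cong) (auto simp: prob_prefix)
  also have "\<dots> = (\<Sum>l\<in>words n. of_bool (P l)) / 2 ^ n"
    by (simp add: Collect_conj_eq)
  finally show ?thesis .
qed

lemma prob_split:
  "prob {\<omega> \<in> space N. P (prefix s \<omega>) \<and> R (prefix s \<omega>) (segment s n \<omega>)} =
     (\<Sum>l\<in>words s. of_bool (P l) * ((\<Sum>u\<in>words n. of_bool (R l u)) / 2 ^ n)) / 2 ^ s"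
proof -
  have "prob {\<omega> \<in> space N. P (prefix s \<omega>) \<and> R (prefix s \<omega>) (segment s n \<omega>)} =
     prob {\<omega> \<in> space N. (\<lambda>x. P (take s x) \<and> R (take s x) (drop s x)) (prefix (s + n) \<omega>)}"
    by (simp add: prefix_add)
  also have "\<dots> = (\<Sum>l\<in>words s. \<Sum>u\<in>words n. of_bool (P l \<and> R l u)) / 2 ^ (s + n)"
    unfolding prob_prefix_pred[of "\<lambda>x. P (take s x) \<and> R (take s x) (drop s x)"] sum_words_append
    by (intro arg_cong2[where f = "(/)"] sum.cong refl) (auto simp: words_def)
  also have "\<dots> = (\<Sum>l\<in>words s. of_bool (P l) * (\<Sum>u\<in>words n. of_bool (R l u))) / 2 ^ (s + n)"
    by (simp only: of_bool_conj sum_distrib_left)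
  finally show ?thesis
    by (simp only: times_divide_eq_right sum_divide_distrib[symmetric] divide_divide_eq_left power_add
        mult.commute[of "2 ^ s"])
qed

text \<open>The next \<open>n\<close> letters are independent of the first \<open>s\<close>.\<close>

lemma prob_markov:
  assumes "\<And>l. l \<in> words s \<Longrightarrow> P l \<Longrightarrow> (\<Sum>u\<in>words n. of_bool (R l u)) / 2 ^ n = r"
  shows "prob {\<omega> \<in> space N. P (prefix s \<omega>) \<and> R (prefix s \<omega>) (segment s n \<omega>)} =
    prob {\<omega> \<in> space N. P (prefix s \<omega>)} * r"
proof -
  have "(\<Sum>l\<in>words s. of_bool (P l) * ((\<Sum>u\<in>words n. of_bool (R l u)) / 2 ^ n)) =
    (\<Sum>l\<in>words s. of_bool (P l) * r)"
    using assms by (intro sum.cong) auto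
  then show ?thesis unfolding prob_split prob_prefix_pred by (simp add: sum_distrib_right)
qed

fun first_at :: "bool list \<Rightarrow> bool list \<Rightarrow> bool list \<Rightarrow> bool" where
  "first_at e w [] = False"
| "first_at e w (c # u) = (if u = [] then shift w c = e else shift w c \<notin> {a, b} \<and> first_at e (shift w c) u)"

lemma all_prefixes_Cons:
  "(\<forall>i. 0 < i \<and> i < Suc n \<longrightarrow> P (take i (c # u))) \<longleftrightarrow>
   (0 < n \<longrightarrow> P [c] \<and> (\<forall>i. 0 < i \<and> i < n \<longrightarrow> P (c # take i u)))"
proof -
  have "(\<forall>i. 0 < i \<and> i < Suc n \<longrightarrow> P (take i (c # u))) \<longleftrightarrow> (\<forall>j<n. P (c # take j u))"
    by (metis (no_types, lifting) Suc_less_eq gr0_conv_Suc take_Suc_Cons zero_less_Suc)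
  also have "\<dots> \<longleftrightarrow> (0 < n \<longrightarrow> P [c] \<and> (\<forall>i. 0 < i \<and> i < n \<longrightarrow> P (c # take i u)))"
    by (metis take0 gr0I less_nat_zero_code)
  finally show ?thesis .
qed

lemma first_at_iff:
  "first_at e w u \<longleftrightarrow> u \<noteq> [] \<and> slide w u = e \<and> (\<forall>i. 0 < i \<and> i < length u \<longrightarrow> slide w (take i u) \<notin> {a, b})"
proof (induction u arbitrary: w)
  case (Cons c u)
  show ?case
    using all_prefixes_Cons[of "length u" "\<lambda>x. slide w x \<notin> {a, b}" c u] Cons.IH[of "shift w c"]
    by (cases u) auto
qed simp

lemma first_hit_count:
  "(\<Sum>u\<in>words (Suc t). of_bool (first_at e w u)) / 2 ^ Suc t = first_hit e t w"
proof (induction t arbitrary: w)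
  case 0
  show ?case by (simp add: sum_words_Suc first_hit_def next_mean_def at_word_def)
next
  case (Suc t)
  have "(\<Sum>u\<in>words (Suc t). of_bool (first_at e w (c # u))) =
      miss (shift w c) * (\<Sum>u\<in>words (Suc t). of_bool (first_at e (shift w c) u))" for c
    unfolding sum_distrib_left
    by (intro sum.cong) (auto simp: miss_def words_def)
  then show ?case
    unfolding sum_words_Suc[of _ "Suc t"] first_hit_Suc Q_apply next_mean_def
    by (simp add: sum.distrib Suc.IH[symmetric] add_divide_distrib mult.commute)
qed

lemma path_weight_miss:
  "path_weight miss w u = of_bool (\<forall>i. 0 < i \<and> i \<le> length u \<longrightarrow> slide w (take i u) \<notin> {a, b})"
proof (induction u arbitrary: w)
  case (Cons c u)
  have "(\<forall>i. 0 < i \<and> i \<le> Suc (length u) \<longrightarrow> slide w (take i (c # u)) \<notin> {a, b}) \<longleftrightarrow>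
    (shift w c \<notin> {a, b} \<and> (\<forall>i. 0 < i \<and> i \<le> length u \<longrightarrow> slide (shift w c) (take i u) \<notin> {a, b}))"
    using all_prefixes_Cons[of "Suc (length u)" "\<lambda>x. slide w x \<notin> {a, b}" c u]
    by (auto simp: less_Suc_eq_le)
  then show ?case using Cons by (simp add: miss_def)
qed simp

lemma AE_infinitely_many_hits: "AE \<omega> in N. \<forall>s. \<exists>t>s. block X L t \<omega> \<in> {a, b}"
proof -
  obtain C \<rho> where *: "0 \<le> C" "0 < \<rho>" "\<rho> < 1" "\<And>n w. w \<in> W \<Longrightarrow> (Q ^^ n) (\<lambda>_. 1) w \<le> C * \<rho> ^ n"
    using Q_pow_geometric by blast
  have one: "AE \<omega> in N. \<exists>t>s. block X L t \<omega> \<in> {a, b}" if s: "L \<le> s" for s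
  proof -
    define A where "A n = {\<omega> \<in> space N. \<forall>i. 0 < i \<and> i \<le> n \<longrightarrow> block X L (s + i) \<omega> \<notin> {a, b}}" for n
    have le: "prob (A n) \<le> C * \<rho> ^ n" for n
    proof -
      define R where "R l u \<longleftrightarrow> (\<forall>i. 0 < i \<and> i \<le> n \<longrightarrow> slide (drop (s - L) l) (take i u) \<notin> {a, b})" for l u
      have "A n = {\<omega> \<in> space N. True \<and> R (prefix s \<omega>) (segment s n \<omega>)}"
        using s by (auto simp: A_def R_def block_slide take_segment) (auto simp: block_prefix)
      then have "prob (A n) = (\<Sum>l\<in>words s. of_bool True * ((\<Sum>u\<in>words n. of_bool (R l u)) / 2 ^ n)) / 2 ^ s"
        using prob_split[of "\<lambda>_. True" s R n] by simp
      also have "\<dots> \<le> (\<Sum>l\<in>words s. C * \<rho> ^ n) / 2 ^ s"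
      proof (intro divide_right_mono sum_mono)
        fix l assume "l \<in> words s"
        then have l: "drop (s - L) l \<in> W" using s by (simp add: words_def)
        have "(\<Sum>u\<in>words n. of_bool (R l u)) / 2 ^ n = (Q ^^ n) (\<lambda>_. 1) (drop (s - L) l)"
          unfolding Q_def path_expansion path_weight_miss
          by (intro arg_cong2[where f = "(/)"] sum.cong refl) (auto simp: R_def words_def)
        then show "of_bool True * ((\<Sum>u\<in>words n. of_bool (R l u)) / 2 ^ n) \<le> C * \<rho> ^ n"
          using *(4)[OF l] by simp
      qed simp
      finally show ?thesis by simp
    qed
    have A: "A n \<in> events" for n
      unfolding A_def by measurable
    have "(\<lambda>n. C * \<rho> ^ n) \<longlonglongrightarrow> C * 0"
      by (intro tendsto_mult tendsto_const LIMSEQ_power_zero) (use * in auto)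
    moreover have "prob (\<Inter>n. A n) \<le> C * \<rho> ^ n" for n
    proof -
      have "prob (\<Inter>n. A n) \<le> prob (A n)" using A by (intro finite_measure_mono) auto
      then show ?thesis using le[of n] by linarith
    qed
    ultimately have "prob (\<Inter>n. A n) \<le> 0" by (intro LIMSEQ_le_const) auto
    then have "prob (\<Inter>n. A n) = 0" by (simp add: measure_le_0_iff)
    then have "(\<Inter>n. A n) \<in> null_sets N" using A by (simp add: emeasure_eq_measure null_sets_def sets.countable_INT)
    moreover have "{\<omega> \<in> space N. \<not> (\<exists>t>s. block X L t \<omega> \<in> {a, b})} \<subseteq> (\<Inter>n. A n)"
      by (auto simp: A_def) (metis less_add_same_cancel1)+
    ultimately show ?thesis by (rule AE_I')
  qed
  have "AE \<omega> in N. \<forall>s. \<exists>t>s + L. block X L t \<omega> \<in> {a, b}"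
    unfolding AE_all_countable by (intro allI one) simp
  then show ?thesis
  proof eventually_elim
    case (elim \<omega>)
    then show ?case by (metis add_lessD1)
  qed
qed

lemma hit_time_measurable [measurable]: "hit_time X L a b k \<in> measurable N (count_space UNIV)"
proof (induction k)
  case (Suc k)
  note Suc [measurable]
  have "hit_time X L a b (Suc k) = (\<lambda>\<omega>. LEAST t. t > hit_time X L a b k \<omega> \<and> block X L t \<omega> \<in> {a, b})"
    by (rule ext) simp
  also have "\<dots> \<in> measurable N (count_space UNIV)"
    by (intro measurable_Least) measurable
  finally show ?case .
qed simp

lemma sign_chain_measurable [measurable]: "sign_chain X L a b k \<in> measurable N (count_space UNIV)"
proof -
  have "(\<lambda>\<omega>. (\<lambda>t \<omega>. if block X L t \<omega> = a then 1 else if block X L t \<omega> = b then -1 else (0::int))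
      (hit_time X L a b k \<omega>) \<omega>) \<in> measurable N (count_space UNIV)"
    by (rule measurable_compose_countable) measurable
  then show ?thesis by (simp add: sign_chain_def[abs_def] Let_def)
qed

definition first_visit :: "bool list \<Rightarrow> nat \<Rightarrow> 'w \<Rightarrow> bool" where
  "first_visit c s \<omega> \<longleftrightarrow> block X L s \<omega> = c \<and> (\<forall>j<s. block X L j \<omega> \<notin> {a, b})"

definition two_visits :: "bool list \<Rightarrow> bool list \<Rightarrow> nat \<Rightarrow> nat \<Rightarrow> 'w \<Rightarrow> bool" where
  "two_visits c e s t \<omega> \<longleftrightarrow> first_visit c s \<omega> \<and> block X L (s + Suc t) \<omega> = e \<and>
     (\<forall>j. s < j \<and> j < s + Suc t \<longrightarrow> block X L j \<omega> \<notin> {a, b})"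

lemma first_visit_measurable [measurable]: "Measurable.pred N (first_visit c s)"
  unfolding first_visit_def[abs_def] by measurable

lemma two_visits_measurable [measurable]: "Measurable.pred N (two_visits c e s t)"
  unfolding two_visits_def[abs_def] by measurable

text \<open>The first visit is a statement about the prefix of length \<open>s\<close>, the second one about the following
  letters, started from the window \<open>c\<close>.\<close>

lemma prob_two_visits:
  assumes c: "c \<in> {a, b}"
  shows "prob {\<omega> \<in> space N. two_visits c e s t \<omega>} = prob {\<omega> \<in> space N. first_visit c s \<omega>} * first_hit e t c"
proof (cases "L \<le> s")
  case False
  then have "\<not> first_visit c s \<omega>" for \<omega> using block_short[of s \<omega>] c by (auto simp: first_visit_def)
  then show ?thesis by (simp add: two_visits_def)
next
  case True
  define P where "P l \<longleftrightarrow> drop (s - L) l = c \<and> (\<forall>j<s. L \<le> j \<longrightarrow> drop (j - L) (take j l) \<notin> {a, b})" for l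
  define R where "R l u \<longleftrightarrow> first_at e (drop (s - L) l) u" for l u
  have tk: "take j (prefix s \<omega>) = prefix j \<omega>" if "j < s" for j \<omega>
    using that prefix_add[of j "s - j" \<omega>] by simp
  have P: "first_visit c s \<omega> \<longleftrightarrow> P (prefix s \<omega>)" for \<omega>
  proof -
    have "(\<forall>j<s. block X L j \<omega> \<notin> {a, b}) \<longleftrightarrow> (\<forall>j<s. L \<le> j \<longrightarrow> drop (j - L) (take j (prefix s \<omega>)) \<notin> {a, b})"
      using block_short[of _ \<omega>] tk by (metis block_prefix not_le)
    then show ?thesis using True by (simp add: first_visit_def P_def block_prefix)
  qed
  have R: "two_visits c e s t \<omega> \<longleftrightarrow> P (prefix s \<omega>) \<and> R (prefix s \<omega>) (segment s (Suc t) \<omega>)" for \<omega>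
  proof -
    have 1: "block X L s \<omega> = drop (s - L) (prefix s \<omega>)" using True by (simp add: block_prefix)
    have "(\<forall>j. s < j \<and> j < s + Suc t \<longrightarrow> block X L j \<omega> \<notin> {a, b}) \<longleftrightarrow>
      (\<forall>i. 0 < i \<and> i < Suc t \<longrightarrow> block X L (s + i) \<omega> \<notin> {a, b})"
      by (metis add_less_cancel_left less_add_same_cancel1 less_imp_add_positive)
    also have "\<dots> \<longleftrightarrow> (\<forall>i. 0 < i \<and> i < Suc t \<longrightarrow> slide (block X L s \<omega>) (take i (segment s (Suc t) \<omega>)) \<notin> {a, b})"
      using True by (simp add: block_slide take_segment)
    finally have "block X L (s + Suc t) \<omega> = e \<and> (\<forall>j. s < j \<and> j < s + Suc t \<longrightarrow> block X L j \<omega> \<notin> {a, b})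
      \<longleftrightarrow> first_at e (block X L s \<omega>) (segment s (Suc t) \<omega>)"
      unfolding first_at_iff block_slide[OF True] by (auto simp flip: length_0_conv)
    then show ?thesis unfolding two_visits_def R_def P 1 by simp
  qed
  show ?thesis
    unfolding P R
  proof (rule prob_markov)
    fix l assume "P l"
    then show "(\<Sum>u\<in>words (Suc t). of_bool (R l u)) / 2 ^ Suc t = first_hit e t c"
      unfolding R_def P_def using first_hit_count[where t = t and e = e and w = c] by simp
  qed
qed

lemma first_visit_unique: "first_visit c s \<omega> \<Longrightarrow> first_visit c' s' \<omega> \<Longrightarrow> c \<in> {a, b} \<Longrightarrow> c' \<in> {a, b} \<Longrightarrow> s = s'"
  unfolding first_visit_def by (metis linorder_neqE_nat)

definition visit_prob :: "bool list \<Rightarrow> real" where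
  "visit_prob c = prob {\<omega> \<in> space N. \<exists>s. first_visit c s \<omega>}"

lemma prob_two_visits_ex:
  assumes c: "c \<in> {a, b}"
  shows "prob {\<omega> \<in> space N. \<exists>s. two_visits c e s t \<omega>} = visit_prob c * first_hit e t c"
proof -
  have "(\<lambda>s. prob {\<omega> \<in> space N. two_visits c e s t \<omega>}) sums prob (\<Union>s. {\<omega> \<in> space N. two_visits c e s t \<omega>})"
  proof (rule finite_measure_UNION)
    show "disjoint_family (\<lambda>s. {\<omega> \<in> space N. two_visits c e s t \<omega>})"
      unfolding disjoint_family_on_def two_visits_def using first_visit_unique[OF _ _ c c] by blast
  qed auto
  moreover have "(\<lambda>s. prob {\<omega> \<in> space N. first_visit c s \<omega>}) sums prob (\<Union>s. {\<omega> \<in> space N. first_visit c s \<omega>})"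
  proof (rule finite_measure_UNION)
    show "disjoint_family (\<lambda>s. {\<omega> \<in> space N. first_visit c s \<omega>})"
      unfolding disjoint_family_on_def using first_visit_unique[OF _ _ c c] by blast
  qed auto
  then have "(\<lambda>s. prob {\<omega> \<in> space N. first_visit c s \<omega>} * first_hit e t c) sums
      (prob (\<Union>s. {\<omega> \<in> space N. first_visit c s \<omega>}) * first_hit e t c)"
    by (rule sums_mult2)
  ultimately have "prob (\<Union>s. {\<omega> \<in> space N. two_visits c e s t \<omega>}) =
      prob (\<Union>s. {\<omega> \<in> space N. first_visit c s \<omega>}) * first_hit e t c"
    unfolding prob_two_visits[OF c] by (rule sums_unique2)
  moreover have "(\<Union>s. {\<omega> \<in> space N. two_visits c e s t \<omega>}) = {\<omega> \<in> space N. \<exists>s. two_visits c e s t \<omega>}"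
    "(\<Union>s. {\<omega> \<in> space N. first_visit c s \<omega>}) = {\<omega> \<in> space N. \<exists>s. first_visit c s \<omega>}" by auto
  ultimately show ?thesis by (simp add: visit_prob_def)
qed

lemma prob_block_L: "c \<in> W \<Longrightarrow> prob {\<omega> \<in> space N. block X L L \<omega> = c} = 1 / 2 ^ L"
  using prob_prefix[of c L] by (simp add: block_prefix)

lemma visit_prob_pos:
  assumes c: "c \<in> {a, b}"
  shows "0 < visit_prob c"
proof -
  have "{\<omega> \<in> space N. block X L L \<omega> = c} \<subseteq> {\<omega> \<in> space N. \<exists>s. first_visit c s \<omega>}"
    using block_short by (auto simp: first_visit_def)
  then have "prob {\<omega> \<in> space N. block X L L \<omega> = c} \<le> visit_prob c"
    unfolding visit_prob_def by (intro finite_measure_mono) auto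
  moreover have "c \<in> W" using c by auto
  ultimately show ?thesis
    using prob_block_L[of c] by (smt (verit) divide_pos_pos zero_less_power)
qed

definition sign_of :: "bool list \<Rightarrow> int" where
  "sign_of c = (if c = a then 1 else -1)"

lemma hit_time_Suc_props:
  assumes "\<exists>t>hit_time X L a b k \<omega>. block X L t \<omega> \<in> {a, b}"
  shows "hit_time X L a b k \<omega> < hit_time X L a b (Suc k) \<omega>"
    and "block X L (hit_time X L a b (Suc k) \<omega>) \<omega> \<in> {a, b}"
    and "\<And>j. hit_time X L a b k \<omega> < j \<Longrightarrow> j < hit_time X L a b (Suc k) \<omega> \<Longrightarrow> block X L j \<omega> \<notin> {a, b}"
proof -
  define P where "P t \<longleftrightarrow> t > hit_time X L a b k \<omega> \<and> block X L t \<omega> \<in> {a, b}" for t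
  have hit: "hit_time X L a b (Suc k) \<omega> = (LEAST t. P t)" by (simp add: P_def)
  have "P (LEAST t. P t)" by (rule LeastI_ex) (use assms in \<open>simp add: P_def\<close>)
  then show "hit_time X L a b k \<omega> < hit_time X L a b (Suc k) \<omega>"
    and "block X L (hit_time X L a b (Suc k) \<omega>) \<omega> \<in> {a, b}"
    unfolding hit P_def by blast+
  show "block X L j \<omega> \<notin> {a, b}"
    if j: "hit_time X L a b k \<omega> < j" "j < hit_time X L a b (Suc k) \<omega>" for j
  proof -
    have "\<not> P j" using not_less_Least[of j P] j(2) unfolding hit by blast
    then show ?thesis using j(1) unfolding P_def by blast
  qed
qed

lemma sign_chain_iff:
  assumes "block X L (hit_time X L a b k \<omega>) \<omega> \<in> {a, b}" "c \<in> {a, b}"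
  shows "sign_chain X L a b k \<omega> = sign_of c \<longleftrightarrow> block X L (hit_time X L a b k \<omega>) \<omega> = c"
  using assms distinct by (auto simp: sign_chain_def sign_of_def Let_def)

text \<open>When \<open>a\<close> or \<open>b\<close> occurs infinitely often, the minima that define the hitting times are attained, and
  the events of the sign chain become the explicit events above.\<close>

lemma good_visits:
  assumes good: "\<forall>s. \<exists>t>s. block X L t \<omega> \<in> {a, b}" and c: "c \<in> {a, b}" and e: "e \<in> {a, b}"
  shows "(\<exists>s. first_visit c s \<omega>) \<longleftrightarrow> sign_chain X L a b 1 \<omega> = sign_of c"
    and "(\<exists>s. two_visits c e s t \<omega>) \<longleftrightarrow> sign_chain X L a b 1 \<omega> = sign_of c \<and> sign_chain X L a b 2 \<omega> = sign_of e \<and>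
        hit_time X L a b 2 \<omega> = hit_time X L a b 1 \<omega> + Suc t"
proof -
  define T1 where "T1 = hit_time X L a b 1 \<omega>"
  define T2 where "T2 = hit_time X L a b 2 \<omega>"
  have two: "hit_time X L a b 2 \<omega> = hit_time X L a b (Suc 1) \<omega>" "hit_time X L a b 1 \<omega> = hit_time X L a b (Suc 0) \<omega>"
    by (simp_all add: numeral_2_eq_2)
  have ex: "\<exists>t>s. block X L t \<omega> \<in> {a, b}" for s using good by blast
  have T1: "block X L T1 \<omega> \<in> {a, b}"
    unfolding T1_def two by (rule hit_time_Suc_props(2)[OF ex])
  have T1_min: "block X L j \<omega> \<notin> {a, b}" if "0 < j" "j < T1" for j
    using hit_time_Suc_props(3)[of 0 \<omega> j, OF ex] that unfolding T1_def two hit_time.simps(1) by blast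
  have T1': "block X L j \<omega> \<notin> {a, b}" if "j < T1" for j
    using T1_min[OF _ that] block_short[of 0 \<omega>] L_pos by (cases "j = 0") auto
  have T2: "T1 < T2" "block X L T2 \<omega> \<in> {a, b}" "\<And>j. T1 < j \<Longrightarrow> j < T2 \<Longrightarrow> block X L j \<omega> \<notin> {a, b}"
    unfolding T1_def T2_def two(1) using hit_time_Suc_props[of 1 \<omega>, OF ex] by blast+
  have s1: "sign_chain X L a b 1 \<omega> = sign_of c \<longleftrightarrow> block X L T1 \<omega> = c"
    unfolding T1_def by (rule sign_chain_iff) (use T1 c in \<open>simp_all only: T1_def\<close>)
  have s2: "sign_chain X L a b 2 \<omega> = sign_of e \<longleftrightarrow> block X L T2 \<omega> = e"
    unfolding T2_def by (rule sign_chain_iff) (use T2 e in \<open>simp_all only: T2_def\<close>)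
  have fv: "first_visit c s \<omega> \<longleftrightarrow> s = T1 \<and> block X L T1 \<omega> = c" for s
  proof
    assume "first_visit c s \<omega>"
    moreover have "first_visit (block X L T1 \<omega>) T1 \<omega>" using T1' by (simp add: first_visit_def)
    ultimately have "s = T1" using first_visit_unique T1 c by blast
    then show "s = T1 \<and> block X L T1 \<omega> = c" using \<open>first_visit c s \<omega>\<close> by (simp add: first_visit_def)
  qed (use T1' in \<open>auto simp: first_visit_def\<close>)
  show "(\<exists>s. first_visit c s \<omega>) \<longleftrightarrow> sign_chain X L a b 1 \<omega> = sign_of c"
    using fv s1 by simp
  have second: "(block X L (T1 + Suc t) \<omega> = e \<and> (\<forall>j. T1 < j \<and> j < T1 + Suc t \<longrightarrow> block X L j \<omega> \<notin> {a, b}))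
     \<longleftrightarrow> (block X L T2 \<omega> = e \<and> T2 = T1 + Suc t)"
  proof
    assume *: "block X L (T1 + Suc t) \<omega> = e \<and> (\<forall>j. T1 < j \<and> j < T1 + Suc t \<longrightarrow> block X L j \<omega> \<notin> {a, b})"
    have "\<not> T2 < T1 + Suc t" using * T2 by blast
    moreover have "\<not> T1 + Suc t < T2" using * e T2(3)[of "T1 + Suc t"] by auto
    ultimately have "T2 = T1 + Suc t" by linarith
    then show "block X L T2 \<omega> = e \<and> T2 = T1 + Suc t" using * by simp
  next
    assume "block X L T2 \<omega> = e \<and> T2 = T1 + Suc t"
    then show "block X L (T1 + Suc t) \<omega> = e \<and> (\<forall>j. T1 < j \<and> j < T1 + Suc t \<longrightarrow> block X L j \<omega> \<notin> {a, b})"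
      using T2(3) by auto
  qed
  have "(\<exists>s. two_visits c e s t \<omega>) \<longleftrightarrow> block X L T1 \<omega> = c \<and> block X L (T1 + Suc t) \<omega> = e \<and>
     (\<forall>j. T1 < j \<and> j < T1 + Suc t \<longrightarrow> block X L j \<omega> \<notin> {a, b})"
    unfolding two_visits_def fv by blast
  also have "\<dots> \<longleftrightarrow> block X L T1 \<omega> = c \<and> block X L T2 \<omega> = e \<and> T2 = T1 + Suc t"
    unfolding second ..
  finally show "(\<exists>s. two_visits c e s t \<omega>) \<longleftrightarrow> sign_chain X L a b 1 \<omega> = sign_of c \<and> sign_chain X L a b 2 \<omega> = sign_of e \<and>
        hit_time X L a b 2 \<omega> = hit_time X L a b 1 \<omega> + Suc t"
    unfolding s1 s2 T1_def[symmetric] T2_def[symmetric] .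
qed

lemma prob_sign: "c \<in> {a, b} \<Longrightarrow> prob {\<omega> \<in> space N. sign_chain X L a b 1 \<omega> = sign_of c} = visit_prob c"
  unfolding visit_prob_def
proof (rule finite_measure_eq_AE)
  assume c: "c \<in> {a, b}"
  show "AE \<omega> in N. \<omega> \<in> {\<omega> \<in> space N. sign_chain X L a b 1 \<omega> = sign_of c} \<longleftrightarrow> \<omega> \<in> {\<omega> \<in> space N. \<exists>s. first_visit c s \<omega>}"
    using AE_infinitely_many_hits by eventually_elim (use good_visits(1)[OF _ c c] in blast)
qed auto

text \<open>Almost surely exactly one \<open>t\<close> satisfies \<open>T\<^sub>2 - T\<^sub>1 = t + 1\<close>, so the integrand is a series with one
  nonzero term. The cases \<open>\<kappa> = 1\<close> and \<open>\<kappa>\<close> the identity give the transition probability and the mean sojourn. The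
  value of \<open>Z\<close> is prescribed only where \<open>T\<^sub>1 < T\<^sub>2\<close>, because on the null set of finitely many hits the
  hitting times are arbitrary.\<close>

lemma integral_renewal:
  fixes \<kappa> :: "nat \<Rightarrow> real"
  assumes c: "c \<in> {a, b}" and e: "e \<in> {a, b}" and pos: "\<And>t. 0 \<le> \<kappa> t"
    and sm: "summable (\<lambda>t. \<kappa> (Suc t) * first_hit e t c)"
    and Z: "Z \<in> borel_measurable N"
      "\<And>\<omega>. hit_time X L a b 1 \<omega> < hit_time X L a b 2 \<omega> \<Longrightarrow> Z \<omega> = \<kappa> (hit_time X L a b 2 \<omega> - hit_time X L a b 1 \<omega>)"
  shows "(\<integral>\<omega>. Z \<omega> * of_bool (sign_chain X L a b 2 \<omega> = sign_of e) * of_bool (sign_chain X L a b 1 \<omega> = sign_of c) \<partial>N)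
     = visit_prob c * (\<Sum>t. \<kappa> (Suc t) * first_hit e t c)"
proof -
  define E where "E t = {\<omega> \<in> space N. \<exists>s. two_visits c e s t \<omega>}" for t
  have E [measurable]: "E t \<in> events" for t unfolding E_def by measurable
  define F where "F \<omega> = Z \<omega> * of_bool (sign_chain X L a b 2 \<omega> = sign_of e) * of_bool (sign_chain X L a b 1 \<omega> = sign_of c)" for \<omega>
  have F_meas: "F \<in> borel_measurable N"
    unfolding F_def[abs_def] using Z(1) by measurable
  have cW: "c \<in> W" using c by auto
  have good: "AE \<omega> in N. (\<lambda>t. \<kappa> (Suc t) * indicator (E t) \<omega>) sums F \<omega>"
    using AE_infinitely_many_hits AE_space
  proof eventually_elim
    case (elim \<omega>)
    define T1 where "T1 = hit_time X L a b 1 \<omega>"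
    define T2 where "T2 = hit_time X L a b 2 \<omega>"
    have lt: "T1 < T2"
    proof -
      have "\<exists>t>hit_time X L a b 1 \<omega>. block X L t \<omega> \<in> {a, b}" using elim(1) by blast
      from hit_time_Suc_props(1)[OF this] show ?thesis
        unfolding T1_def T2_def by (simp only: numeral_2_eq_2 One_nat_def)
    qed
    define t0 where "t0 = T2 - T1 - 1"
    have T2: "T2 = T1 + Suc t0" using lt by (simp add: t0_def)
    have in_E: "\<omega> \<in> E t \<longleftrightarrow> t = t0 \<and> sign_chain X L a b 1 \<omega> = sign_of c \<and> sign_chain X L a b 2 \<omega> = sign_of e" for t
      using elim(2) good_visits(2)[OF elim(1) c e, of t] T2 unfolding E_def T1_def T2_def by auto
    have "Z \<omega> = \<kappa> (Suc t0)"
      using Z(2)[of \<omega>] lt T2 unfolding T1_def[symmetric] T2_def[symmetric] by simp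
    then have "\<kappa> (Suc t) * indicator (E t) \<omega> = (if t = t0 then F \<omega> else 0)" for t
      by (auto simp: in_E indicator_def F_def)
    then show ?case using sums_single[of t0 "\<lambda>_. F \<omega>"] by simp
  qed
  have int: "integral\<^sup>L N (\<lambda>\<omega>. \<kappa> (Suc t) * indicator (E t) \<omega>) = visit_prob c * (\<kappa> (Suc t) * first_hit e t c)" for t
    using prob_two_visits_ex[OF c, of e t] by (simp add: E_def mult_ac)
  have integ: "integrable N (\<lambda>\<omega>. \<kappa> (Suc t) * indicator (E t) \<omega>)" for t
    by (intro integrable_mult_right integrable_real_indicator) (auto simp: emeasure_eq_measure)
  have "integral\<^sup>L N F = integral\<^sup>L N (\<lambda>\<omega>. \<Sum>t. \<kappa> (Suc t) * indicator (E t) \<omega>)"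
  proof (rule integral_cong_AE[OF F_meas])
    show "AE \<omega> in N. F \<omega> = (\<Sum>t. \<kappa> (Suc t) * indicator (E t) \<omega>)"
      using good by eventually_elim (auto simp: sums_iff)
  qed measurable
  also have "\<dots> = (\<Sum>t. integral\<^sup>L N (\<lambda>\<omega>. \<kappa> (Suc t) * indicator (E t) \<omega>))"
  proof (rule integral_suminf[OF integ])
    have nrm: "norm (\<kappa> (Suc t) * indicator (E t) \<omega>) = \<kappa> (Suc t) * indicator (E t) \<omega>" for t \<omega>
      using pos by (simp add: abs_mult)
    show "AE \<omega> in N. summable (\<lambda>t. norm (\<kappa> (Suc t) * indicator (E t) \<omega>))"
      unfolding nrm using good by eventually_elim (auto simp: sums_iff)
    show "summable (\<lambda>t. \<integral>\<omega>. norm (\<kappa> (Suc t) * indicator (E t) \<omega>) \<partial>N)"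
      unfolding nrm int by (intro summable_mult sm)
  qed
  also have "\<dots> = visit_prob c * (\<Sum>t. \<kappa> (Suc t) * first_hit e t c)"
    unfolding int by (intro suminf_mult sm)
  finally show ?thesis unfolding F_def[abs_def] .
qed

lemma mean_sojourn_eq:
  assumes "c \<in> {a, b}" "e \<in> {a, b}"
  shows "mean_sojourn N X L a b (sign_of c) (sign_of e) = hit_mean e c"
proof -
  have "(\<integral>\<omega>. (real (hit_time X L a b 2 \<omega>) - real (hit_time X L a b 1 \<omega>)) * of_bool (sign_chain X L a b 2 \<omega> = sign_of e)
     * of_bool (sign_chain X L a b 1 \<omega> = sign_of c) \<partial>N) = visit_prob c * (\<Sum>t. real (Suc t) * first_hit e t c)"
    using assms summable_first_hit(1)[of c e]
    by (intro integral_renewal) (auto simp: of_nat_diff simp del: hit_time.simps)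
  then show ?thesis
    using visit_prob_pos[OF assms(1)] prob_sign[OF assms(1)]
    by (simp add: mean_sojourn_def cond_expectation_event_def hit_mean_def del: hit_time.simps)
qed

lemma stay_prob_eq: "stay_prob N X L a b = p"
proof -
  have "(\<integral>\<omega>. 1 * of_bool (sign_chain X L a b 2 \<omega> = sign_of a)
     * of_bool (sign_chain X L a b 1 \<omega> = sign_of a) \<partial>N) = visit_prob a * (\<Sum>t. 1 * first_hit a t a)"
    using summable_first_hit(2)[of a a] by (intro integral_renewal) auto
  also have "(\<lambda>\<omega>. 1 * of_bool (sign_chain X L a b 2 \<omega> = sign_of a) * of_bool (sign_chain X L a b 1 \<omega> = sign_of a)) =
     (\<lambda>\<omega>. indicator {\<omega>. sign_chain X L a b 2 \<omega> = 1 \<and> sign_chain X L a b 1 \<omega> = 1} \<omega> :: real)"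
    by (auto simp: sign_of_def indicator_def fun_eq_iff)
  also have "integral\<^sup>L N \<dots> = prob {\<omega> \<in> space N. sign_chain X L a b 2 \<omega> = 1 \<and> sign_chain X L a b 1 \<omega> = 1}"
    by (simp add: Int_def conj_commute)
  finally show ?thesis
    using visit_prob_pos[of a] prob_sign[of a]
    by (simp add: stay_prob_def cond_prob_def p_def hit_prob_def sign_of_def)
qed

lemma occ_difference:
  "int (occ X a (L + m) \<omega>) - int (occ X b (L + m) \<omega>) =
     f (block X L L \<omega>) + path_sum f (block X L L \<omega>) (segment L m \<omega>)"
proof (induction m)
  case 0
  show ?case using distinct by (auto simp: occ_def length_a length_b score_def segment_def)
next
  case (Suc m)
  have "occ X c (L + Suc m) \<omega> = occ X c (L + m) \<omega> + of_bool (block X L (L + Suc m) \<omega> = c)" if "length c = L" for c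
    using that by (simp add: occ_def)
  then have "int (occ X a (L + Suc m) \<omega>) - int (occ X b (L + Suc m) \<omega>) =
      int (occ X a (L + m) \<omega>) - int (occ X b (L + m) \<omega>) + f (block X L (L + Suc m) \<omega>)"
    by (simp add: length_a length_b score_def)
  then show ?case
    unfolding Suc.IH block_slide[OF order_refl] segment_Suc by simp
qed

lemma count_advantage_eq:
  "count_advantage N X L a b (L + m) =
     (\<Sum>s\<in>words m. of_int (sgn (1 + path_sum f a s))) / 2 ^ m"
proof -
  have half: "\<P>(\<omega> in N. Z (int (occ X a (L + m) \<omega>) - int (occ X b (L + m) \<omega>)) \<bar> block X L L \<omega> = a) =
     (\<Sum>u\<in>words m. of_bool (Z (1 + path_sum f a u))) / 2 ^ m" for Z
  proof -
    have "{\<omega> \<in> space N. Z (int (occ X a (L + m) \<omega>) - int (occ X b (L + m) \<omega>)) \<and> block X L L \<omega> = a} =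
       {\<omega> \<in> space N. prefix L \<omega> = a \<and> (\<lambda>l u. Z (1 + path_sum f a u)) (prefix L \<omega>) (segment L m \<omega>)}"
      unfolding occ_difference using distinct by (auto simp: block_prefix score_def)
    also have "prob \<dots> = prob {\<omega> \<in> space N. prefix L \<omega> = a} *
        ((\<Sum>u\<in>words m. of_bool (Z (1 + path_sum f a u))) / 2 ^ m)"
      by (rule prob_markov) simp
    finally show ?thesis
      using prob_prefix[OF a_in] by (simp add: cond_prob_def block_prefix)
  qed
  have "count_advantage N X L a b (L + m) =
     (\<Sum>u\<in>words m. of_bool (0 < 1 + path_sum f a u)) / 2 ^ m - (\<Sum>u\<in>words m. of_bool (1 + path_sum f a u < 0)) / 2 ^ m"
    using half[of "\<lambda>z. 0 < z"] half[of "\<lambda>z. z < 0"] by (simp add: count_advantage_def)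
  also have "\<dots> = (\<Sum>u\<in>words m. of_bool (0 < 1 + path_sum f a u) - of_bool (1 + path_sum f a u < 0)) / 2 ^ m"
    by (simp add: sum_subtractf diff_divide_distrib)
  also have "\<dots> = (\<Sum>s\<in>words m. of_int (sgn (1 + path_sum f a s))) / 2 ^ m"
    by (intro arg_cong2[where f = "(/)"] sum.cong refl) (auto simp: sgn_if)
  finally show ?thesis .
qed

end

section \<open>The limiting constant\<close>

context aperiodic_words
begin

text \<open>Up to constant factors, the mean of the first corrector is the difference of mean hitting
  times ordered by the second word, and the difference of the second corrector at \<open>a\<close> and \<open>b\<close> is the one ordered by
  the first word. In the combination \<open>drift - cumulant3 / (2 half_var)\<close> the diagonal terms cancel.\<close>

lemma limit_constant:
  "(drift - cumulant3 / (2 * half_var)) / sqrt (pi * half_var) =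
     (hit_mean a a + hit_mean b b + 2 * hit_mean b a) / sqrt (2 ^ (L + 2) * p * q * pi)"
proof -
  define D :: real where "D = 2 ^ L"
  have D: "0 < D" by (simp add: D_def)
  define \<Delta> where "\<Delta> = next_hit_mean a - next_hit_mean b"
  have corr1_mean: "corr1_mean = (hit_mean a a + hit_mean a b - hit_mean b a - hit_mean b b) / (2 * q * D)"
  proof -
    have "corr1_mean = mean L (\<lambda>w. (1 / (2 * q)) * (hit_prob a w - hit_prob b w))"
      by (simp add: corr1_mean_def corr1_def[abs_def])
    also have "\<dots> = (1 / (2 * q)) * (mean L (hit_prob a) - mean L (hit_prob b))"
      unfolding mean_mult mean_diff ..
    finally show ?thesis
      unfolding mean_hit_prob D_def[symmetric] diff_divide_distrib[symmetric] times_divide_times_eq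
      by (simp add: algebra_simps)
  qed
  have corr2: "corr2 a - corr2 b = - half_var * \<Delta> / (2 * q)"
    using q_pos by (simp add: corr2_def hit_prob_values \<Delta>_def pq field_simps)
  have drift: "drift = 1 / (2 * q) - corr1_mean"
    using q_pos by (simp add: drift_def corr1_ab pq field_simps)
  have "cumulant3 / (2 * half_var) = - \<Delta> / (4 * q * D) - corr1_mean / 2"
    using half_var_pos q_pos D unfolding cumulant3_def corr2 D_def[symmetric] by (simp add: field_simps)
  then have "drift - cumulant3 / (2 * half_var) = 1 / (2 * q) - corr1_mean / 2 + \<Delta> / (4 * q * D)"
    by (simp add: drift)
  also have "\<dots> = (D + hit_mean b a - hit_mean a b) / (2 * q * D)"
    using q_pos D by (simp add: corr1_mean \<Delta>_def next_hit_mean_def field_simps)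
  also have "D + hit_mean b a - hit_mean a b = hit_mean a a + hit_mean b b + 2 * hit_mean b a"
    using hit_mean_total by (simp add: D_def)
  finally have num: "drift - cumulant3 / (2 * half_var) = (hit_mean a a + hit_mean b b + 2 * hit_mean b a) / (2 * q * D)" .
  have "2 * q * D * sqrt (pi * half_var) = sqrt ((2 * q * D)\<^sup>2 * (pi * half_var))"
    using q_pos D by (simp add: real_sqrt_mult)
  also have "(2 * q * D)\<^sup>2 * (pi * half_var) = 2 ^ (L + 2) * p * q * pi"
    using q_pos D unfolding half_var_def D_def[symmetric] power_add
    by (simp add: field_simps power2_eq_square)
  finally show ?thesis unfolding num by simp
qed

end

theorem mainTheorem3:
  fixes M :: "'w measure" and X :: "nat \<Rightarrow> 'w \<Rightarrow> bool"
    and L :: nat and a b :: "bool list"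
  assumes "symmetric_bernoulli_process M X"
    and "L \<ge> 1"
    and "length a = L" and "length b = L"
    and "b \<notin> {a, rev a, conjugate_word a, rev (conjugate_word a)}"
  shows "let p = stay_prob M X L a b;
             q = 1 - p;
             \<mu> = mean_sojourn M X L a b
         in (\<lambda>n. count_advantage M X L a b n
                  - (\<mu> 1 1 + \<mu> (-1) (-1) + 2 * \<mu> 1 (-1))
                    / sqrt (2 ^ (L + 2) * p * q * pi * real n))
            \<in> o(\<lambda>n. 1 / sqrt (real n))"
proof -
  interpret A: aperiodic_words L a b
    using assms by unfold_locales (auto simp: conjugate_word_def)
  interpret B: bernoulli_words L a b M X
    using assms(1) by unfold_locales
  define k where "k = A.hit_mean a a + A.hit_mean b b + 2 * A.hit_mean b a"
  define d where "d = 2 ^ (L + 2) * A.p * A.q * pi"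
  have shifted: "sqrt (L + m) * count_advantage M X L a b (L + m)
      = sqrt ((L + m) / m) * (sqrt m * A.advantage m)" if "0 < m" for m
    using that by (simp add: B.count_advantage_eq A.advantage_def real_sqrt_divide)
  have "eventually (\<lambda>m. sqrt ((L + m) / m) * (sqrt m * A.advantage m) =
      sqrt (real (m + L)) * count_advantage M X L a b (m + L)) sequentially"
    using eventually_gt_at_top[of 0] by eventually_elim (use shifted in \<open>simp add: add.commute\<close>)
  moreover have "(\<lambda>m. sqrt ((L + m) / m) * (sqrt m * A.advantage m)) \<longlonglongrightarrow> 1 * (k / sqrt d)"
  proof (rule tendsto_mult)
    show "(\<lambda>m. sqrt ((L + m) / m)) \<longlonglongrightarrow> 1" by real_asymp
    show "(\<lambda>m. sqrt m * A.advantage m) \<longlonglongrightarrow> k / sqrt d"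
      using A.advantage_limit unfolding A.limit_constant k_def d_def .
  qed
  ultimately have "(\<lambda>m. sqrt (real (m + L)) * count_advantage M X L a b (m + L)) \<longlonglongrightarrow> k / sqrt d"
    using Lim_transform_eventually by fastforce
  then have "(\<lambda>n. sqrt n * count_advantage M X L a b n) \<longlonglongrightarrow> k / sqrt d"
    by (rule LIMSEQ_offset)
  then have "(\<lambda>n. sqrt n * count_advantage M X L a b n - k / sqrt d) \<longlonglongrightarrow> 0"
    by (simp add: LIM_zero)
  moreover have "eventually (\<lambda>n. sqrt n * count_advantage M X L a b n - k / sqrt d =
      (count_advantage M X L a b n - k / sqrt (d * n)) / (1 / sqrt n)) sequentially"
    using eventually_gt_at_top[of 0]
    by eventually_elim (simp add: real_sqrt_mult field_simps)
  ultimately have "(\<lambda>n. (count_advantage M X L a b n - k / sqrt (d * n)) / (1 / sqrt n)) \<longlonglongrightarrow> 0"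
    by (rule Lim_transform_eventually)
  then have "(\<lambda>n. count_advantage M X L a b n - k / sqrt (d * n)) \<in> o(\<lambda>n. 1 / sqrt (real n))"
    by (intro smalloI_tendsto eventually_mono[OF eventually_gt_at_top[of 0]]) auto
  moreover have "mean_sojourn M X L a b 1 1 = A.hit_mean a a"
    "mean_sojourn M X L a b (-1) (-1) = A.hit_mean b b"
    "mean_sojourn M X L a b 1 (-1) = A.hit_mean b a"
    using B.mean_sojourn_eq[of a a] B.mean_sojourn_eq[of b b] B.mean_sojourn_eq[of a b] A.distinct
    by (simp_all add: B.sign_of_def)
  ultimately show ?thesis
    by (simp add: Let_def B.stay_prob_eq k_def d_def A.q_def mult.assoc)
qed

end
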